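(* Let $Q$ be a Riemannian manifold and let $F:Q\to\mathbf{R}$ be a smooth function such that the critical points of $F$ are contained in a codimension-$1$ submanifold of $Q$. Let $K:TQ\to\mathbf{R}$ be the kinetic energy function defined by the given metric, namely $K(q,\dot q)=\frac12\|\dot q\|_q^2$. Then there exists a residual subset $\mathcal{C}$ of $\mathcal{C}^\infty(Q,\mathbf{R})$ such that for any $V\in\mathcal{C}$, the Euler-Lagrange equations for the Lagrangian $L=K-V$ have no non-equilibrium solution along which $F$ is constant, and the equilibrium solutions are isolated.
   Context: All manifolds are $C^\infty$, paracompact, second countable, finite-dimensional and without boundary; smooth means $C^\infty$. $\mathcal{C}^\infty(Q,\mathbf{R})$ carries the strong (Whitney) $C^\infty$ topology. A subset is residual if it contains the intersection of a countable number of open dense subsets. In $L=K-V$, the function $V$ on $Q$ is regarded as a function on $TQ$ via the projection $TQ\to Q$. An equilibrium solution is a constant solution $q(t)\equiv q_0$. *)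

theory Defs
  imports "HOL-Analysis.Analysis"
begin

section \<open>Smoothness on open subsets of Euclidean spaces\<close>

primrec partials ::
  "'a::euclidean_space list \<Rightarrow> ('a \<Rightarrow> 'b::euclidean_space) \<Rightarrow> 'a \<Rightarrow> 'b" where
  "partials [] f = f"
| "partials (b # bs) f = (\<lambda>x. frechet_derivative (partials bs f) (at x) b)"

text \<open>Only meaningful for open \<open>S\<close>: \<open>at x\<close> refers to a full neighbourhood of \<open>x\<close>.\<close>

definition Ck_on ::
  "nat \<Rightarrow> ('a::euclidean_space \<Rightarrow> 'b::euclidean_space) \<Rightarrow> 'a set \<Rightarrow> bool" where
  "Ck_on k f S \<longleftrightarrow>
     (\<forall>bs. set bs \<subseteq> Basis \<and> length bs \<le> k \<longrightarrow>
        continuous_on S (partials bs f) \<and>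
        (length bs < k \<longrightarrow> (\<forall>x\<in>S. partials bs f differentiable (at x))))"

definition smooth_on ::
  "('a::euclidean_space \<Rightarrow> 'b::euclidean_space) \<Rightarrow> 'a set \<Rightarrow> bool" where
  "smooth_on f S \<longleftrightarrow> (\<forall>k. Ck_on k f S)"


section \<open>Smooth manifolds\<close>

text \<open>
  The underlying set of the manifold is the type \<open>'q\<close>, whose topology comes from its type class;
  the model space is \<open>'e\<close>, so the dimension is \<open>DIM('e)\<close>. A chart is a pair of its domain
  and its coordinate map; the values of the map outside the domain are irrelevant.
  Paracompactness follows from second countability, the Hausdorff property and the existence
  of charts.
\<close>

type_synonym ('q, 'e) chart = "'q set \<times> ('q \<Rightarrow> 'e)"

abbreviation chart_dom :: "('q, 'e) chart \<Rightarrow> 'q set" where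
  "chart_dom c \<equiv> fst c"

abbreviation chart_map :: "('q, 'e) chart \<Rightarrow> 'q \<Rightarrow> 'e" where
  "chart_map c \<equiv> snd c"

abbreviation chart_img :: "('q, 'e) chart \<Rightarrow> 'e set" where
  "chart_img c \<equiv> snd c ` fst c"

abbreviation chart_inv :: "('q, 'e) chart \<Rightarrow> 'e \<Rightarrow> 'q" where
  "chart_inv c \<equiv> inv_into (fst c) (snd c)"

definition is_chart :: "('q::topological_space, 'e::euclidean_space) chart \<Rightarrow> bool" where
  "is_chart c \<longleftrightarrow>
     open (chart_dom c) \<and> open (chart_img c) \<and>
     homeomorphism (chart_dom c) (chart_img c) (chart_map c) (chart_inv c)"

definition smooth_compatible ::
  "('q::topological_space, 'e::euclidean_space) chart \<Rightarrow> ('q, 'e) chart \<Rightarrow> bool" where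
  "smooth_compatible c d \<longleftrightarrow>
     smooth_on (chart_map d \<circ> chart_inv c) (chart_map c ` (chart_dom c \<inter> chart_dom d)) \<and>
     smooth_on (chart_map c \<circ> chart_inv d) (chart_map d ` (chart_dom c \<inter> chart_dom d))"

definition smooth_structure ::
  "('q::{second_countable_topology,t2_space}, 'e::euclidean_space) chart set \<Rightarrow> bool" where
  "smooth_structure A \<longleftrightarrow>
     (\<forall>c\<in>A. is_chart c) \<and>
     (\<Union>c\<in>A. chart_dom c) = UNIV \<and>
     (\<forall>c\<in>A. \<forall>d\<in>A. smooth_compatible c d) \<and>
     (\<forall>c. is_chart c \<and> (\<forall>d\<in>A. smooth_compatible c d) \<longrightarrow> c \<in> A)"

definition smooth_functions ::
  "('q::topological_space, 'e::euclidean_space) chart set \<Rightarrow> ('q \<Rightarrow> real) set" where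
  "smooth_functions A = {f. \<forall>c\<in>A. smooth_on (f \<circ> chart_inv c) (chart_img c)}"

definition critical_point ::
  "('q::topological_space, 'e::euclidean_space) chart set \<Rightarrow> ('q \<Rightarrow> real) \<Rightarrow> 'q \<Rightarrow> bool" where
  "critical_point A f p \<longleftrightarrow>
     (\<forall>c\<in>A. p \<in> chart_dom c \<longrightarrow>
        ((f \<circ> chart_inv c) has_derivative (\<lambda>_. 0)) (at (chart_map c p)))"

text \<open>Embedded submanifolds, not necessarily closed, via slice charts.\<close>

definition submanifold_of_codim ::
  "nat \<Rightarrow> ('q::topological_space, 'e::euclidean_space) chart set \<Rightarrow> 'q set \<Rightarrow> bool" where
  "submanifold_of_codim k A S \<longleftrightarrow>
     (\<forall>p\<in>S. \<exists>c\<in>A. p \<in> chart_dom c \<and>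
        (\<exists>L. subspace L \<and> dim L + k = DIM('e) \<and>
             chart_map c ` (chart_dom c \<inter> S) = chart_img c \<inter> L))"


section \<open>Tangent vectors and Riemannian metrics\<close>

text \<open>
  A tangent vector at \<open>p\<close> is the family of its coordinate vectors in the charts around \<open>p\<close>,
  related by the derivatives of the coordinate changes (and set to 0 for all other charts).
  An element of the tangent bundle is a pair of a point and a tangent vector at that point.
\<close>

type_synonym ('q, 'e) tangent = "('q, 'e) chart \<Rightarrow> 'e"

definition tangent_space ::
  "('q::topological_space, 'e::euclidean_space) chart set \<Rightarrow> 'q \<Rightarrow> ('q, 'e) tangent set" where
  "tangent_space A p =
     {X. (\<forall>c\<in>A. \<forall>d\<in>A. p \<in> chart_dom c \<and> p \<in> chart_dom d \<longrightarrow>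
            X d = frechet_derivative (chart_map d \<circ> chart_inv c) (at (chart_map c p)) (X c)) \<and>
         (\<forall>c. \<not> (c \<in> A \<and> p \<in> chart_dom c) \<longrightarrow> X c = 0)}"

text \<open>The tangent vector at \<open>p\<close> whose coordinate vector in the chart \<open>c\<close> is \<open>v\<close>.\<close>

definition tangent_of_coords ::
  "('q::topological_space, 'e::euclidean_space) chart set \<Rightarrow> ('q, 'e) chart \<Rightarrow> 'q \<Rightarrow> 'e \<Rightarrow>
     ('q, 'e) tangent" where
  "tangent_of_coords A c p v =
     (\<lambda>d. if d \<in> A \<and> p \<in> chart_dom d
          then frechet_derivative (chart_map d \<circ> chart_inv c) (at (chart_map c p)) v else 0)"

text \<open>The third condition is smoothness of the coefficients \<open>g\<^sub>i\<^sub>j\<close> in every chart.\<close>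

definition riemannian_metric ::
  "('q::topological_space, 'e::euclidean_space) chart set \<Rightarrow>
     ('q \<Rightarrow> ('q, 'e) tangent \<Rightarrow> ('q, 'e) tangent \<Rightarrow> real) \<Rightarrow> bool" where
  "riemannian_metric A g \<longleftrightarrow>
     (\<forall>p. \<forall>X\<in>tangent_space A p. \<forall>Y\<in>tangent_space A p.
        g p X Y = g p Y X \<and>
        (\<forall>Z\<in>tangent_space A p. \<forall>a. g p (\<lambda>c. a *\<^sub>R X c + Y c) Z = a * g p X Z + g p Y Z)) \<and>
     (\<forall>p. \<forall>X\<in>tangent_space A p. X \<noteq> (\<lambda>_. 0) \<longrightarrow> g p X X > 0) \<and>
     (\<forall>c\<in>A. \<forall>i\<in>Basis. \<forall>j\<in>Basis.
        smooth_on (\<lambda>x. g (chart_inv c x) (tangent_of_coords A c (chart_inv c x) i)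
                                         (tangent_of_coords A c (chart_inv c x) j)) (chart_img c))"


section \<open>Lagrangian systems\<close>

definition riemannian_norm ::
  "('q \<Rightarrow> ('q, 'e) tangent \<Rightarrow> ('q, 'e) tangent \<Rightarrow> real) \<Rightarrow> 'q \<Rightarrow> ('q, 'e) tangent \<Rightarrow> real" where
  "riemannian_norm g p X = sqrt (g p X X)"

definition kinetic_energy ::
  "('q \<Rightarrow> ('q, 'e) tangent \<Rightarrow> ('q, 'e) tangent \<Rightarrow> real) \<Rightarrow> 'q \<times> ('q, 'e) tangent \<Rightarrow> real" where
  "kinetic_energy g = (\<lambda>(p, X). (1/2) * (riemannian_norm g p X)\<^sup>2)"

text \<open>The expression \<open>L(x, v)\<close> of a function on the tangent bundle in the chart \<open>c\<close>.\<close>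

definition local_lagrangian ::
  "('q::topological_space, 'e::euclidean_space) chart set \<Rightarrow> ('q \<times> ('q, 'e) tangent \<Rightarrow> real) \<Rightarrow>
     ('q, 'e) chart \<Rightarrow> 'e \<Rightarrow> 'e \<Rightarrow> real" where
  "local_lagrangian A L c x v = L (chart_inv c x, tangent_of_coords A c (chart_inv c x) v)"

text \<open>
  Solutions are twice continuously differentiable curves on nonempty open intervals; in each chart
  the equation is \<open>d/dt (\<partial>L/\<partial>v (x, x')) = \<partial>L/\<partial>x (x, x')\<close>, evaluated on every direction \<open>e\<close>.
\<close>

definition euler_lagrange_solution ::
  "('q::topological_space, 'e::euclidean_space) chart set \<Rightarrow> ('q \<times> ('q, 'e) tangent \<Rightarrow> real) \<Rightarrow>
     real set \<Rightarrow> (real \<Rightarrow> 'q) \<Rightarrow> bool" where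
  "euler_lagrange_solution A L I q \<longleftrightarrow>
     open I \<and> is_interval I \<and> I \<noteq> {} \<and> continuous_on I q \<and>
     (\<forall>c\<in>A.
        let J = {t \<in> I. q t \<in> chart_dom c};
            x = chart_map c \<circ> q;
            x' = (\<lambda>t. vector_derivative x (at t));
            \<L> = local_lagrangian A L c
        in Ck_on 2 x J \<and>
           (\<forall>t\<in>J. \<forall>e.
              ((\<lambda>s. frechet_derivative (\<lambda>v. \<L> (x s) v) (at (x' s)) e)
                 has_real_derivative
               frechet_derivative (\<lambda>y. \<L> y (x' t)) (at (x t)) e) (at t)))"

definition equilibrium_points ::
  "('q::topological_space, 'e::euclidean_space) chart set \<Rightarrow> ('q \<times> ('q, 'e) tangent \<Rightarrow> real) \<Rightarrow>
     'q set" where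
  "equilibrium_points A L = {q0. euler_lagrange_solution A L UNIV (\<lambda>_. q0)}"


section \<open>The strong topology and residual sets\<close>

text \<open>
  A basic neighbourhood of \<open>f\<close> in the strong \<open>C\<^sup>r\<close> topology: \<open>\<Phi>\<close> is a locally finite family of
  charts indexed by \<open>I\<close> (such families are countable up to empty domains, so \<open>I\<close> may be taken
  to be a set of naturals), \<open>K i\<close> is a compact subset of the domain of \<open>\<Phi> i\<close>, and all partial
  derivatives of order at most \<open>r\<close> of the coordinate expressions are \<open>\<epsilon> i\<close>-close on \<open>K i\<close>.
\<close>

definition strong_nbhd ::
  "('q::topological_space, 'e::euclidean_space) chart set \<Rightarrow> nat \<Rightarrow> ('q \<Rightarrow> real) \<Rightarrow>
     nat set \<Rightarrow> (nat \<Rightarrow> ('q, 'e) chart) \<Rightarrow> (nat \<Rightarrow> 'q set) \<Rightarrow> (nat \<Rightarrow> real) \<Rightarrow> ('q \<Rightarrow> real) set" where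
  "strong_nbhd A r f I \<Phi> K \<epsilon> =
     {h \<in> smooth_functions A.
        \<forall>i\<in>I. \<forall>p\<in>K i. \<forall>bs. set bs \<subseteq> Basis \<and> length bs \<le> r \<longrightarrow>
          \<bar>partials bs (h \<circ> chart_inv (\<Phi> i)) (chart_map (\<Phi> i) p)
           - partials bs (f \<circ> chart_inv (\<Phi> i)) (chart_map (\<Phi> i) p)\<bar> < \<epsilon> i}"

definition locally_finite_charts ::
  "nat set \<Rightarrow> (nat \<Rightarrow> ('q::topological_space, 'e) chart) \<Rightarrow> bool" where
  "locally_finite_charts I \<Phi> \<longleftrightarrow>
     (\<forall>p. \<exists>W. open W \<and> p \<in> W \<and> finite {i \<in> I. chart_dom (\<Phi> i) \<inter> W \<noteq> {}})"

text \<open>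
  The strong (Whitney) \<open>C\<^sup>\<infinity>\<close> topology is the union of the strong \<open>C\<^sup>r\<close> topologies, \<open>r\<close> finite,
  restricted to smooth functions. (The order \<open>r\<close> may vary between neighbourhoods, but not with
  the index \<open>i\<close> inside one neighbourhood.)
\<close>

definition strong_topology ::
  "('q::topological_space, 'e::euclidean_space) chart set \<Rightarrow> ('q \<Rightarrow> real) topology" where
  "strong_topology A =
     topology_generated_by
       {strong_nbhd A r f I \<Phi> K \<epsilon> | r f I \<Phi> K \<epsilon>.
          f \<in> smooth_functions A \<and> locally_finite_charts I \<Phi> \<and>
          (\<forall>i\<in>I. \<Phi> i \<in> A \<and> compact (K i) \<and> K i \<subseteq> chart_dom (\<Phi> i) \<and> \<epsilon> i > 0)}"

definition residual_in :: "'a topology \<Rightarrow> 'a set \<Rightarrow> bool" where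
  "residual_in X C \<longleftrightarrow>
     C \<subseteq> topspace X \<and>
     (\<exists>\<U>. countable \<U> \<and> (\<forall>U\<in>\<U>. openin X U \<and> X closure_of U = topspace X) \<and>
          topspace X \<inter> \<Inter>\<U> \<subseteq> C)"

end

theory Submission
  imports Defs
begin

text \<open>Independence in the jet comes from perturbing \<open>V\<close> by \<beta>(y) (h(y) -
  h(x)) (v \<bullet> (y - x))^j with a bump function \<beta> at \<open>x\<close>. Along the
  trajectory through \<open>(x, v)\<close> the power vanishes to order exactly j, and at a common
  zero of the P_k the factor h - h(x) vanishes to higher order. Up to order j the perturbing force
  therefore acts through dh alone. It leaves P_1, ..., P_(j+1) unchanged and moves P_(j+2) by a
  nonzero multiple of the squared length of dh in the inverse metric, so the linearised system is
  triangular.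

  The dimension count is done by measure. The hypersurface is a null set in dimension 2n, and there
  are 2n perturbation parameters. Independence makes the parameter for which a given point is a
  common zero a locally Lipschitz function of that point, so the bad parameters form a null set as
  well. The hyperplanes v \<bullet> e = 1 do the same work for the Hessian: they exclude v = 0,
  where the homogeneous equation holds trivially, and they lower the dimension of the domain to 2n -
  1.\<close>

text \<open>
  Let \<open>n\<close> be the dimension. A solution along which a function \<open>h\<close> is constant satisfies \<open>P\<^sub>k = 0\<close> for
  all \<open>k \<ge> 1\<close>, where \<open>P\<^sub>k(x, v)\<close> is the \<open>k\<close>-th derivative of \<open>h\<close> along the Euler-Lagrange flow, a
  polynomial in the jet of \<open>V\<close>. Where \<open>dh\<close> and \<open>v\<close> do not vanish, \<open>P\<^sub>1 = dh(v)\<close> cuts out a hypersurface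
  of the \<open>2n\<close>-dimensional tangent bundle, and the equations with \<open>k \<ge> 2\<close> are independent in the
  jet of \<open>V\<close>, so that \<open>2n\<close> of them have no common solution on it for generic \<open>V\<close>. A
  solution that conserves \<open>F\<close> and moves at some time either meets noncritical points of \<open>F\<close>, and
  then \<open>h = F\<close> gives a contradiction, or stays for a while in the hypersurface containing the
  critical points, and then a linear function \<open>h\<close> defining it in a slice chart does. That the
  critical points of \<open>V\<close>, hence the equilibria, are isolated is the same argument for the \<open>2n\<close>
  equations \<open>dV(x) = 0\<close>, \<open>D\<^sup>2V(x) v = 0\<close> on the hyperplanes \<open>v \<bullet> e = 1\<close>.
\<close>


section \<open>Calculus of smooth functions\<close>

abbreviation fd :: "('a::real_normed_vector \<Rightarrow> 'b::real_normed_vector) \<Rightarrow> 'a \<Rightarrow> 'a \<Rightarrow> 'b" where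
  "fd f x \<equiv> frechet_derivative f (at x)"

lemma has_derivative_fd: "f differentiable at x \<Longrightarrow> (f has_derivative fd f x) (at x)"
  by (simp add: frechet_derivative_works)

lemma fd_eqI: "(f has_derivative f') (at x) \<Longrightarrow> fd f x = f'"
  by (simp add: frechet_derivative_at[symmetric])

lemma linear_fd: "f differentiable at x \<Longrightarrow> linear (fd f x)"
  by (rule linear_frechet_derivative)

lemma differentiable_cong_open:
  assumes "open S" "x \<in> S" "\<And>y. y \<in> S \<Longrightarrow> f y = g y" "f differentiable at x"
  shows "g differentiable at x"
  using assms has_derivative_transform_within_open unfolding differentiable_def by metis

lemma fd_cong_open:
  assumes "open S" "x \<in> S" "\<And>y. y \<in> S \<Longrightarrow> f y = g y"
  shows "fd f x = fd g x"
proof -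
  have "(f has_derivative F) (at x) \<longleftrightarrow> (g has_derivative F) (at x)" for F
    using assms has_derivative_transform_within_open by metis
  then show ?thesis by (simp add: frechet_derivative_def)
qed

lemma linear_eq_sum_Basis:
  fixes f :: "'a::euclidean_space \<Rightarrow> 'b::real_vector"
  assumes "linear f"
  shows "f v = (\<Sum>b\<in>Basis. (v \<bullet> b) *\<^sub>R f b)"
proof -
  have "f v = f (\<Sum>b\<in>Basis. (v \<bullet> b) *\<^sub>R b)" by (simp add: euclidean_representation)
  then show ?thesis unfolding linear_sum[OF assms] linear_scale[OF assms] .
qed

lemma fd_eq_sum_Basis:
  fixes f :: "'a::euclidean_space \<Rightarrow> 'b::real_normed_vector"
  shows "f differentiable at x \<Longrightarrow> fd f x v = (\<Sum>b\<in>Basis. (v \<bullet> b) *\<^sub>R fd f x b)"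
  by (rule linear_eq_sum_Basis[OF linear_fd])

lemma fd_add:
  assumes "f differentiable at x" "g differentiable at x"
  shows "fd (\<lambda>x. f x + g x) x = (\<lambda>v. fd f x v + fd g x v)"
  by (rule fd_eqI) (intro has_derivative_add has_derivative_fd assms)

lemma fd_bilinear:
  assumes "bounded_bilinear pr" "f differentiable at x" "g differentiable at x"
  shows "fd (\<lambda>x. pr (f x) (g x)) x = (\<lambda>v. pr (f x) (fd g x v) + pr (fd f x v) (g x))"
  by (rule fd_eqI) (intro bounded_bilinear.FDERIV[OF assms(1)] has_derivative_fd assms(2,3))

lemma fd_mult:
  fixes f g :: "'a::real_normed_vector \<Rightarrow> real"
  assumes "f differentiable at x" "g differentiable at x"
  shows "fd (\<lambda>x. f x * g x) x v = f x * fd g x v + fd f x v * g x"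
  using fd_bilinear[OF bounded_bilinear_mult assms] by simp

lemma fd_compose:
  assumes "f differentiable at (g x)" "g differentiable at x"
  shows "fd (\<lambda>x. f (g x)) x = (\<lambda>v. fd f (g x) (fd g x v))"
  by (rule fd_eqI, rule has_derivative_compose[of g "fd g x" x UNIV f "fd f (g x)"])
    (auto intro: has_derivative_fd assms)

lemma partials_append: "partials (bs @ [b]) f = partials bs (\<lambda>x. fd f x b)"
  by (induction bs) auto

lemma partials_cong_open:
  assumes "open S" "x \<in> S" "\<And>y. y \<in> S \<Longrightarrow> f y = g y"
  shows "partials bs f x = partials bs g x"
  using assms(2)
proof (induction bs arbitrary: x)
  case Nil
  then show ?case using assms by simp
next
  case (Cons b bs)
  have "fd (partials bs f) x = fd (partials bs g) x"
    using assms(1) Cons.prems Cons.IH by (rule fd_cong_open)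
  then show ?case by simp
qed

lemma Ck_on_0: "Ck_on 0 f S \<longleftrightarrow> continuous_on S f"
  by (auto simp: Ck_on_def)

text \<open>In \<open>partials\<close> the head of the list is the outermost derivative. Peeling off
  the last, innermost one lowers the order while replacing \<open>f\<close> by its first
  derivatives, which is the shape in which product and chain rules go by induction on
  \<open>k\<close>.\<close>

lemma Ck_on_Suc:
  assumes "open S"
  shows "Ck_on (Suc k) f S \<longleftrightarrow>
    (\<forall>x\<in>S. f differentiable at x) \<and> (\<forall>b\<in>Basis. Ck_on k (\<lambda>x. fd f x b) S)" (is "?L \<longleftrightarrow> ?R")
proof
  assume L: ?L
  have "f differentiable at x" if "x \<in> S" for x
    using L[unfolded Ck_on_def, rule_format, of "[]"] that by simp
  moreover have "Ck_on k (\<lambda>x. fd f x b) S" if "b \<in> Basis" for b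
    unfolding Ck_on_def
  proof (intro allI impI)
    fix bs :: "'a list"
    assume "set bs \<subseteq> Basis \<and> length bs \<le> k"
    then show "continuous_on S (partials bs (\<lambda>x. fd f x b)) \<and>
       (length bs < k \<longrightarrow> (\<forall>x\<in>S. partials bs (\<lambda>x. fd f x b) differentiable at x))"
      using L[unfolded Ck_on_def, rule_format, of "bs @ [b]"] that by (simp add: partials_append)
  qed
  ultimately show ?R by blast
next
  assume R: ?R
  show ?L unfolding Ck_on_def
  proof (intro allI impI)
    fix bs :: "'a list"
    assume bs: "set bs \<subseteq> Basis \<and> length bs \<le> Suc k"
    show "continuous_on S (partials bs f) \<and>
      (length bs < Suc k \<longrightarrow> (\<forall>x\<in>S. partials bs f differentiable at x))"
    proof (cases bs rule: rev_cases)
      case Nil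
      have "continuous_on S f"
        using R assms by (simp add: continuous_on_eq_continuous_at differentiable_imp_continuous_within)
      then show ?thesis using Nil R by simp
    next
      case (snoc cs b)
      then have "Ck_on k (\<lambda>x. fd f x b) S" using R bs by auto
      from this[unfolded Ck_on_def, rule_format, of cs] show ?thesis
        using bs snoc by (simp add: partials_append)
    qed
  qed
qed

lemma Ck_on_Suc_imp: "Ck_on (Suc k) f S \<Longrightarrow> Ck_on k f S"
  by (auto simp: Ck_on_def)

lemma Ck_on_cong_open:
  assumes "open S" "\<And>x. x \<in> S \<Longrightarrow> f x = g x" "Ck_on k f S"
  shows "Ck_on k g S"
  unfolding Ck_on_def
proof (intro allI impI)
  fix bs :: "'a list"
  assume bs: "set bs \<subseteq> Basis \<and> length bs \<le> k"
  have eq: "partials bs f x = partials bs g x" if "x \<in> S" for x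
    using assms(1) that assms(2) by (rule partials_cong_open)
  have "continuous_on S (partials bs f)"
    and "length bs < k \<longrightarrow> (\<forall>x\<in>S. partials bs f differentiable at x)"
    using assms(3)[unfolded Ck_on_def, rule_format, OF bs] by auto
  then show "continuous_on S (partials bs g) \<and>
      (length bs < k \<longrightarrow> (\<forall>x\<in>S. partials bs g differentiable at x))"
    using differentiable_cong_open[OF assms(1) _ eq] continuous_on_cong[OF refl eq, of S]
    by simp
qed

lemma Ck_on_const: "Ck_on k (\<lambda>x::'a::euclidean_space. c) S"
proof -
  have "partials bs (\<lambda>x. c) = (\<lambda>x. if bs = [] then c else 0)" for bs :: "'a list"
    by (induction bs) (auto simp: frechet_derivative_const)
  then have "continuous_on S (partials bs (\<lambda>x. c)) \<and> (\<forall>x\<in>S. partials bs (\<lambda>x. c) differentiable at x)"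
    for bs :: "'a list" by (cases "bs = []") auto
  then show ?thesis unfolding Ck_on_def by blast
qed

lemma Ck_on_add:
  assumes "open S" "Ck_on k f S" "Ck_on k g S"
  shows "Ck_on k (\<lambda>x. f x + g x) S"
  using assms(2,3)
proof (induction k arbitrary: f g)
  case 0
  then show ?case by (auto simp: Ck_on_0 intro: continuous_on_add)
next
  case (Suc k)
  have "Ck_on k (\<lambda>x. fd (\<lambda>x. f x + g x) x b) S" if "b \<in> Basis" for b
  proof (rule Ck_on_cong_open[OF assms(1)])
    show "Ck_on k (\<lambda>x. fd f x b + fd g x b) S"
      using Suc that by (auto simp: Ck_on_Suc[OF assms(1)])
    show "fd f x b + fd g x b = fd (\<lambda>x. f x + g x) x b" if "x \<in> S" for x
      using Suc.prems that by (simp add: Ck_on_Suc[OF assms(1)] fd_add)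
  qed
  then show ?case using Suc.prems by (auto simp: Ck_on_Suc[OF assms(1)] intro: differentiable_add)
qed

lemma Ck_on_bilinear:
  fixes pr :: "'b::euclidean_space \<Rightarrow> 'c::euclidean_space \<Rightarrow> 'd::euclidean_space"
  assumes "bounded_bilinear pr" "open S" "Ck_on k f S" "Ck_on k g S"
  shows "Ck_on k (\<lambda>x. pr (f x) (g x)) S"
  using assms(3,4)
proof (induction k arbitrary: f g)
  case 0
  then show ?case by (auto simp: Ck_on_0 intro: bounded_bilinear.continuous_on[OF assms(1)])
next
  case (Suc k)
  have "Ck_on k (\<lambda>x. fd (\<lambda>x. pr (f x) (g x)) x b) S" if "b \<in> Basis" for b
  proof (rule Ck_on_cong_open[OF assms(2)])
    show "Ck_on k (\<lambda>x. pr (f x) (fd g x b) + pr (fd f x b) (g x)) S"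
      using Suc that by (auto simp: Ck_on_Suc[OF assms(2)] intro!: Ck_on_add Suc.IH assms(2)
        intro: Ck_on_Suc_imp)
    show "pr (f x) (fd g x b) + pr (fd f x b) (g x) = fd (\<lambda>x. pr (f x) (g x)) x b" 
      if "x \<in> S" for x
      using Suc.prems that by (simp add: Ck_on_Suc[OF assms(2)] fd_bilinear[OF assms(1)])
  qed
  moreover have "(\<lambda>x. pr (f x) (g x)) differentiable at x" if "x \<in> S" for x
  proof -
    have "f differentiable at x" "g differentiable at x"
      using Suc.prems that by (auto simp: Ck_on_Suc[OF assms(2)])
    from bounded_bilinear.FDERIV[OF assms(1) this[THEN has_derivative_fd]] show ?thesis
      unfolding differentiable_def by blast
  qed
  ultimately show ?case by (auto simp: Ck_on_Suc[OF assms(2)])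
qed

lemma Ck_on_sum:
  assumes "open S" "\<And>i. i \<in> I \<Longrightarrow> Ck_on k (f i) S"
  shows "Ck_on k (\<lambda>x. \<Sum>i\<in>I. f i x) S"
proof (cases "finite I")
  case True
  then show ?thesis using assms(2)
    by (induction I) (auto intro: Ck_on_const Ck_on_add assms(1))
qed (simp add: Ck_on_const)

text \<open>By the chain rule a derivative of the composite is a sum of products of derivatives of
  \<open>g\<close> with first derivatives of \<open>f\<close> composed with the same
  \<open>g\<close>; hence the induction varies \<open>f\<close> and keeps \<open>g\<close>.\<close>

lemma Ck_on_compose:
  assumes "open S" "open T" "g ` S \<subseteq> T" "Ck_on k f T" "Ck_on k g S"
  shows "Ck_on k (\<lambda>x. f (g x)) S"
  using assms(4,5)
proof (induction k arbitrary: f)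
  case 0
  then show ?case using assms(3) by (auto simp: Ck_on_0 intro: continuous_on_compose2)
next
  case (Suc k)
  have df: "f differentiable at (g x)" "g differentiable at x" if "x \<in> S" for x
    using Suc.prems that assms(3) by (auto simp: Ck_on_Suc[OF assms(1)] Ck_on_Suc[OF assms(2)])
  have "Ck_on k (\<lambda>x. fd (\<lambda>x. f (g x)) x b) S" if b: "b \<in> Basis" for b
  proof (rule Ck_on_cong_open[OF assms(1)])
    have "Ck_on k (\<lambda>x. fd g x b \<bullet> i) S" for i
      by (rule Ck_on_bilinear[OF bounded_bilinear_inner])
        (use Suc.prems b in \<open>auto simp: Ck_on_Suc[OF assms(1)] Ck_on_const assms(1)\<close>)
    moreover have "Ck_on k (\<lambda>x. fd f (g x) i) S" if "i \<in> Basis" for i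
      using Suc.prems that Ck_on_Suc_imp[OF Suc.prems(2)]
      by (intro Suc.IH[of "\<lambda>y. fd f y i"]) (auto simp: Ck_on_Suc[OF assms(2)])
    ultimately show "Ck_on k (\<lambda>x. \<Sum>i\<in>Basis. (fd g x b \<bullet> i) *\<^sub>R fd f (g x) i) S"
      by (intro Ck_on_sum assms(1) Ck_on_bilinear[OF bounded_bilinear_scaleR])
    show "(\<Sum>i\<in>Basis. (fd g x b \<bullet> i) *\<^sub>R fd f (g x) i) = fd (\<lambda>x. f (g x)) x b" if "x \<in> S" for x
      using df[OF that] by (simp add: fd_compose fd_eq_sum_Basis[of f, symmetric])
  qed
  moreover have "(\<lambda>x. f (g x)) differentiable at x" if "x \<in> S" for x
    using df[OF that] differentiable_compose[of f g x UNIV] by simp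
  ultimately show ?case by (auto simp: Ck_on_Suc[OF assms(1)])
qed

lemma Ck_on_linear:
  assumes "bounded_linear f" "open S"
  shows "Ck_on k f S"
proof (cases k)
  case 0
  then show ?thesis
    using assms(1) by (simp add: Ck_on_0 linear_continuous_on)
next
  case (Suc j)
  have "fd f x = f" for x using assms(1) by (intro fd_eqI bounded_linear_imp_has_derivative)
  then show ?thesis unfolding Suc Ck_on_Suc[OF assms(2)]
    using assms(1) by (auto intro: Ck_on_const bounded_linear_imp_differentiable)
qed

section \<open>Closure properties of smooth functions\<close>

lemma smooth_on_const [simp, intro]: "smooth_on (\<lambda>x. c) S"
  by (simp add: smooth_on_def Ck_on_const)

lemma smooth_on_add:
  "open S \<Longrightarrow> smooth_on f S \<Longrightarrow> smooth_on g S \<Longrightarrow> smooth_on (\<lambda>x. f x + g x) S"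
  by (simp add: smooth_on_def Ck_on_add)

lemma smooth_on_sum:
  "open S \<Longrightarrow> (\<And>i. i \<in> I \<Longrightarrow> smooth_on (f i) S) \<Longrightarrow> smooth_on (\<lambda>x. \<Sum>i\<in>I. f i x) S"
  by (simp add: smooth_on_def Ck_on_sum)

lemma smooth_on_bilinear:
  fixes pr :: "'b::euclidean_space \<Rightarrow> 'c::euclidean_space \<Rightarrow> 'd::euclidean_space"
  shows "bounded_bilinear pr \<Longrightarrow> open S \<Longrightarrow> smooth_on f S \<Longrightarrow> smooth_on g S \<Longrightarrow>
    smooth_on (\<lambda>x. pr (f x) (g x)) S"
  by (simp add: smooth_on_def Ck_on_bilinear)

lemmas smooth_on_mult = smooth_on_bilinear[OF bounded_bilinear_mult[where 'a = real]]
  and smooth_on_scaleR = smooth_on_bilinear[OF bounded_bilinear_scaleR]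
  and smooth_on_inner = smooth_on_bilinear[OF bounded_bilinear_inner]

lemma smooth_on_linear: "bounded_linear f \<Longrightarrow> open S \<Longrightarrow> smooth_on f S"
  by (simp add: smooth_on_def Ck_on_linear)

lemma smooth_on_id [intro]: "open S \<Longrightarrow> smooth_on (\<lambda>x. x) S"
  by (intro smooth_on_linear bounded_linear_ident)

lemma smooth_on_compose:
  "open S \<Longrightarrow> open T \<Longrightarrow> g ` S \<subseteq> T \<Longrightarrow> smooth_on f T \<Longrightarrow> smooth_on g S \<Longrightarrow>
   smooth_on (\<lambda>x. f (g x)) S"
  unfolding smooth_on_def using Ck_on_compose by blast

lemma smooth_on_linear_compose:
  "bounded_linear l \<Longrightarrow> open S \<Longrightarrow> smooth_on g S \<Longrightarrow> smooth_on (\<lambda>x. l (g x)) S"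
  by (rule smooth_on_compose[of S UNIV g l]) (auto intro: smooth_on_linear)

lemma smooth_on_minus:
  "open S \<Longrightarrow> smooth_on f S \<Longrightarrow> smooth_on (\<lambda>x. - f x) S"
  by (rule smooth_on_linear_compose) (auto intro: bounded_linear_minus bounded_linear_ident)

lemma smooth_on_diff:
  "open S \<Longrightarrow> smooth_on f S \<Longrightarrow> smooth_on g S \<Longrightarrow> smooth_on (\<lambda>x. f x - g x) S"
  using smooth_on_add[of S f "\<lambda>x. - g x"] smooth_on_minus[of S g] by simp

lemma smooth_on_Pair:
  assumes "open S" "smooth_on f S" "smooth_on g S"
  shows "smooth_on (\<lambda>x. (f x, g x)) S"
proof -
  have "smooth_on (\<lambda>x. (f x, 0) + (0, g x)) S"
    using assms by (intro smooth_on_add smooth_on_linear_compose[of "\<lambda>y. (y, 0)"]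
        smooth_on_linear_compose[of "\<lambda>y. (0, y)"] bounded_linear_Pair
        bounded_linear_ident bounded_linear_zero)
  then show ?thesis by simp
qed

lemma smooth_on_power:
  fixes f :: "'a::euclidean_space \<Rightarrow> real"
  shows "open S \<Longrightarrow> smooth_on f S \<Longrightarrow> smooth_on (\<lambda>x. f x ^ n) S"
  by (induction n) (auto intro: smooth_on_mult)

lemma smooth_on_subset: "smooth_on f S \<Longrightarrow> T \<subseteq> S \<Longrightarrow> smooth_on f T"
  unfolding smooth_on_def Ck_on_def by (meson continuous_on_subset subset_iff)

lemma smooth_on_cong_open:
  "open S \<Longrightarrow> (\<And>x. x \<in> S \<Longrightarrow> f x = g x) \<Longrightarrow> smooth_on f S \<Longrightarrow> smooth_on g S"
  unfolding smooth_on_def using Ck_on_cong_open by metis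

lemma smooth_on_partials_differentiable:
  "smooth_on f S \<Longrightarrow> set bs \<subseteq> Basis \<Longrightarrow> x \<in> S \<Longrightarrow> partials bs f differentiable at x"
  unfolding smooth_on_def Ck_on_def by (metis less_Suc_eq less_imp_le)

text \<open>With all orders available, continuity of each partial derivative follows from its
  differentiability. What remains is a pointwise condition, and \<open>smooth_on_local\<close> rests
  on that.\<close>

lemma smooth_on_iff:
  assumes "open S"
  shows "smooth_on f S \<longleftrightarrow> (\<forall>bs. set bs \<subseteq> Basis \<longrightarrow> (\<forall>x\<in>S. partials bs f differentiable at x))"
proof
  assume "\<forall>bs. set bs \<subseteq> Basis \<longrightarrow> (\<forall>x\<in>S. partials bs f differentiable at x)"
  then show "smooth_on f S" using assms
    by (auto simp: smooth_on_def Ck_on_def continuous_on_eq_continuous_at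
      differentiable_imp_continuous_within)
qed (use smooth_on_partials_differentiable in blast)

lemma smooth_on_differentiable: "smooth_on f S \<Longrightarrow> x \<in> S \<Longrightarrow> f differentiable at x"
  using smooth_on_partials_differentiable[of f S "[]"] by simp

lemma smooth_on_continuous: "smooth_on f S \<Longrightarrow> continuous_on S f"
  unfolding smooth_on_def using Ck_on_0 by blast

lemma smooth_on_partials:
  assumes "open S" "smooth_on f S" "set bs \<subseteq> Basis"
  shows "smooth_on (partials bs f) S"
proof -
  have "partials cs (partials bs f) = partials (cs @ bs) f" for cs
    by (induction cs) auto
  then show ?thesis using assms by (simp add: smooth_on_iff)
qed

lemma smooth_on_fd_Basis:
  "open S \<Longrightarrow> smooth_on f S \<Longrightarrow> b \<in> Basis \<Longrightarrow> smooth_on (\<lambda>x. fd f x b) S"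
  using smooth_on_partials[of S f "[b]"] by simp

lemma smooth_on_fd:
  assumes "open S" "smooth_on f S" "smooth_on v S"
  shows "smooth_on (\<lambda>x. fd f x (v x)) S"
proof (rule smooth_on_cong_open[OF assms(1)])
  show "smooth_on (\<lambda>x. \<Sum>b\<in>Basis. (v x \<bullet> b) *\<^sub>R fd f x b) S"
    by (intro smooth_on_sum smooth_on_scaleR smooth_on_inner smooth_on_fd_Basis assms smooth_on_const)
qed (use smooth_on_differentiable[OF assms(2)] in \<open>simp add: fd_eq_sum_Basis[symmetric]\<close>)

lemma smooth_on_local:
  assumes "open S" "\<And>x. x \<in> S \<Longrightarrow> \<exists>T. x \<in> T \<and> smooth_on f T"
  shows "smooth_on f S"
  unfolding smooth_on_iff[OF assms(1)]
  using assms(2) smooth_on_partials_differentiable by blast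

lemma smooth_on_divide:
  fixes f g :: "'a::euclidean_space \<Rightarrow> real"
  assumes "open S" "smooth_on f S" "smooth_on g S" "\<And>x. x \<in> S \<Longrightarrow> g x \<noteq> 0"
  shows "smooth_on (\<lambda>x. f x / g x) S"
proof -
  \<comment> \<open>The derivative of \<open>1 / g\<close> is a product of \<open>fd g\<close> with
    two copies of \<open>1 / g\<close>, so the induction hypothesis at order \<open>k\<close> covers
    it.\<close>
  have inv: "Ck_on k (\<lambda>x. inverse (g x)) S" for k
  proof (induction k)
    case 0
    then show ?case using assms smooth_on_continuous by (auto simp: Ck_on_0 intro!: continuous_on_inverse)
  next
    case (Suc k)
    have der: "((\<lambda>x. inverse (g x)) has_derivative (\<lambda>h. - (inverse (g x) * fd g x h * inverse (g x)))) (at x)"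
      if "x \<in> S" for x
      using assms(4) that smooth_on_differentiable[OF assms(3)]
      by (intro Deriv.has_derivative_inverse has_derivative_fd) auto
    have "Ck_on k (\<lambda>x. fd (\<lambda>x. inverse (g x)) x b) S" if b: "b \<in> Basis" for b
    proof (rule Ck_on_cong_open[OF assms(1)])
      have "Ck_on k (\<lambda>x. fd g x b) S"
        using smooth_on_fd_Basis[OF assms(1,3) b] by (simp add: smooth_on_def)
      then have "Ck_on k (\<lambda>x. inverse (g x) * fd g x b * inverse (g x)) S"
        by (intro Ck_on_bilinear[OF bounded_bilinear_mult] Suc assms(1))
      then show "Ck_on k (\<lambda>x. - 1 * (inverse (g x) * fd g x b * inverse (g x))) S"
        by (rule Ck_on_bilinear[OF bounded_bilinear_mult assms(1) Ck_on_const])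
    qed (use fd_eqI[OF der] in simp)
    then show ?case using der by (auto simp: Ck_on_Suc[OF assms(1)] differentiable_def)
  qed
  then have "smooth_on (\<lambda>x. inverse (g x)) S" by (simp add: smooth_on_def)
  then show ?thesis unfolding divide_inverse by (intro smooth_on_mult assms)
qed

lemma partials_add_scaled:
  fixes f g :: "'a::euclidean_space \<Rightarrow> real"
  assumes "open S" "smooth_on f S" "smooth_on g S" "set bs \<subseteq> Basis" "x \<in> S"
  shows "partials bs (\<lambda>x. f x + t * g x) x = partials bs f x + t * partials bs g x"
  using assms(4,5)
proof (induction bs arbitrary: x)
  case (Cons b bs)
  have d: "partials bs f differentiable at x" "partials bs g differentiable at x"
    using Cons assms smooth_on_partials_differentiable by auto
  have "fd (partials bs (\<lambda>x. f x + t * g x)) x = fd (\<lambda>x. partials bs f x + t * partials bs g x) x"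
    using Cons by (intro fd_cong_open[OF assms(1)]) auto
  also have "\<dots> = (\<lambda>v. fd (partials bs f) x v + t * fd (partials bs g) x v)"
    by (intro fd_eqI has_derivative_add has_derivative_mult_right has_derivative_fd d)
  finally show ?case by simp
qed simp

lemma partials_zero [simp]: "partials bs (\<lambda>x. 0) = (\<lambda>x. 0)"
  by (induction bs) (auto simp: frechet_derivative_const)

lemma partials_add_sum:
  fixes f :: "'a::euclidean_space \<Rightarrow> real"
  assumes "open S" "smooth_on f S" "\<And>i. i \<in> I \<Longrightarrow> smooth_on (g i) S" "set bs \<subseteq> Basis" "x \<in> S"
    "finite I"
  shows "partials bs (\<lambda>x. f x + (\<Sum>i\<in>I. s i * g i x)) x =
    partials bs f x + (\<Sum>i\<in>I. s i * partials bs (g i) x)"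
  using assms(6,3)
proof (induction I)
  case (insert i I)
  have "smooth_on (\<lambda>x. f x + (\<Sum>i\<in>I. s i * g i x)) S"
    by (intro smooth_on_add smooth_on_sum smooth_on_mult assms smooth_on_const insert.prems insertI2)
  from partials_add_scaled[OF assms(1) this _ assms(4,5), of "g i" "s i"] insert
  show ?case by (simp add: algebra_simps)
qed simp


section \<open>Polynomials in the jet of a function, with linearisation\<close>

text \<open>
  \<open>T' V \<psi>\<close> is the derivative of \<open>T\<close> at \<open>V\<close> in the direction \<open>\<psi>\<close>. Carrying it along makes
  the linearisation commute with the derivatives in \<open>(x, v)\<close> by construction.
\<close>

inductive diffop :: "'e::euclidean_space set \<Rightarrow> (('e \<Rightarrow> real) \<Rightarrow> 'e \<times> 'e \<Rightarrow> real) \<Rightarrow>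
    (('e \<Rightarrow> real) \<Rightarrow> ('e \<Rightarrow> real) \<Rightarrow> 'e \<times> 'e \<Rightarrow> real) \<Rightarrow> bool" for U where
  const: "smooth_on a (U \<times> UNIV) \<Longrightarrow> diffop U (\<lambda>V. a) (\<lambda>V \<psi> z. 0)"
| jet: "set bs \<subseteq> Basis \<Longrightarrow>
    diffop U (\<lambda>V z. partials bs V (fst z)) (\<lambda>V \<psi> z. partials bs \<psi> (fst z))"
| add: "diffop U S S' \<Longrightarrow> diffop U T T' \<Longrightarrow>
    diffop U (\<lambda>V z. S V z + T V z) (\<lambda>V \<psi> z. S' V \<psi> z + T' V \<psi> z)"
| mult: "diffop U S S' \<Longrightarrow> diffop U T T' \<Longrightarrow>
    diffop U (\<lambda>V z. S V z * T V z) (\<lambda>V \<psi> z. S V z * T' V \<psi> z + S' V \<psi> z * T V z)"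
| cong: "diffop U S S' \<Longrightarrow>
    (\<And>V z. smooth_on V U \<Longrightarrow> z \<in> U \<times> UNIV \<Longrightarrow> S V z = T V z) \<Longrightarrow>
    (\<And>V \<psi> z. smooth_on V U \<Longrightarrow> smooth_on \<psi> U \<Longrightarrow> z \<in> U \<times> UNIV \<Longrightarrow> S' V \<psi> z = T' V \<psi> z) \<Longrightarrow>
    diffop U T T'"

lemma open_tangent: "open U \<Longrightarrow> open (U \<times> (UNIV::'e::topological_space set))"
  by (simp add: open_Times)

lemma smooth_on_fst_compose:
  fixes U :: "'e::euclidean_space set"
  assumes "open U" "smooth_on f U"
  shows "smooth_on (\<lambda>z. f (fst z)) (U \<times> (UNIV::'f::euclidean_space set))"
  by (rule smooth_on_compose[where T = U])
    (use assms in \<open>auto intro!: smooth_on_linear bounded_linear_fst open_tangent\<close>)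

lemma fd_fst_compose:
  assumes "f differentiable at (fst z)"
  shows "fd (\<lambda>z. f (fst z)) z v = fd f (fst z) (fst v)"
proof -
  have "fd fst z = fst" by (rule fd_eqI) (rule bounded_linear_imp_has_derivative[OF bounded_linear_fst])
  moreover have "(fst :: 'a \<times> 'c \<Rightarrow> 'a) differentiable at z"
    by (rule bounded_linear_imp_differentiable[OF bounded_linear_fst])
  ultimately show ?thesis using fd_compose[of f fst z] assms by simp
qed

context
  fixes U :: "'e::euclidean_space set"
  assumes U: "open U"
begin

lemma smooth_on_jet:
  "smooth_on V U \<Longrightarrow> set bs \<subseteq> Basis \<Longrightarrow>
   smooth_on (\<lambda>z. partials bs V (fst z)) (U \<times> (UNIV::'e set))"
  by (intro smooth_on_fst_compose smooth_on_partials U)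

lemma diffop_smooth:
  assumes "diffop U T T'" "smooth_on V U"
  shows "smooth_on (T V) (U \<times> UNIV) \<and> (smooth_on \<psi> U \<longrightarrow> smooth_on (T' V \<psi>) (U \<times> UNIV))"
  using assms(1)
proof induction
  case (cong S S' T T')
  then show ?case
    using smooth_on_cong_open[OF open_tangent[OF U], of "S V" "T V"] assms(2)
      smooth_on_cong_open[OF open_tangent[OF U], of "S' V \<psi>" "T' V \<psi>"] by metis
qed (auto intro!: smooth_on_jet smooth_on_add smooth_on_mult open_tangent U simp: assms(2))

lemma diffop_differentiable:
  assumes "diffop U T T'" "smooth_on V U" "z \<in> U \<times> UNIV"
  shows "T V differentiable at z" and "smooth_on \<psi> U \<Longrightarrow> T' V \<psi> differentiable at z"
  using diffop_smooth[OF assms(1,2), of \<psi>] smooth_on_differentiable assms(3) by blast+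

lemma diffop_sum:
  assumes "\<And>i. i \<in> I \<Longrightarrow> diffop U (T i) (T' i)"
  shows "diffop U (\<lambda>V z. \<Sum>i\<in>I. T i V z) (\<lambda>V \<psi> z. \<Sum>i\<in>I. T' i V \<psi> z)"
proof (cases "finite I")
  case True
  then show ?thesis using assms
  proof (induction I)
    case empty
    then show ?case using diffop.const[of "\<lambda>z. 0" U] by simp
  next
    case (insert i I)
    then show ?case using diffop.add[of U "T i" "T' i"] by simp
  qed
next
  case False
  then show ?thesis using diffop.const[of "\<lambda>z. 0" U] by simp
qed

text \<open>The derivative of a jet coordinate is the next jet coordinate in a position direction
  and 0 in a velocity direction, hence the case split on \<open>fst b\<close>. The sum and product
  rules hold for smooth \<open>V\<close> over \<open>U\<close>, and the rule \<open>cong\<close>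
  admits identities with exactly this restriction.\<close>

lemma diffop_fd:
  assumes "diffop U T T'" "b \<in> Basis"
  shows "diffop U (\<lambda>V z. fd (T V) z b) (\<lambda>V \<psi> z. fd (T' V \<psi>) z b)"
  using assms(1)
proof induction
  case (const a)
  have "diffop U (\<lambda>V z. fd a z b) (\<lambda>V \<psi> z. 0)"
    by (intro diffop.const smooth_on_fd_Basis open_tangent U const assms)
  then show ?case by (simp add: frechet_derivative_const)
next
  case (jet bs)
  let ?b = "fst b"
  have *: "fd (\<lambda>z. partials bs f (fst z)) z b = (if ?b = 0 then 0 else partials (?b # bs) f (fst z))"
    if "smooth_on f U" "z \<in> U \<times> UNIV" for f z
  proof -
    have "partials bs f differentiable at (fst z)"
      using that jet by (auto intro: smooth_on_partials_differentiable)
    then show ?thesis using linear_0[OF linear_fd] by (auto simp: fd_fst_compose)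
  qed
  show ?case
  proof (cases "?b = 0")
    case True
    have "diffop U (\<lambda>V z. 0) (\<lambda>V \<psi> z. 0)" by (intro diffop.const) auto
    then show ?thesis by (rule diffop.cong) (use True * in auto)
  next
    case False
    then have "?b \<in> Basis" using assms(2) by (auto simp: Basis_prod_def)
    then have "diffop U (\<lambda>V z. partials (?b # bs) V (fst z)) (\<lambda>V \<psi> z. partials (?b # bs) \<psi> (fst z))"
      using jet by (intro diffop.jet) auto
    then show ?thesis by (rule diffop.cong) (simp_all add: * False)
  qed
next
  case (add S S' T T')
  show ?case
    by (rule diffop.cong[OF diffop.add[OF add.IH]])
      (use diffop_differentiable add.hyps in \<open>auto simp: fd_add\<close>)
next
  case (mult S S' T T')
  show ?case
  proof (rule diffop.cong[OF diffop.add[OF diffop.mult[OF mult.hyps(1) mult.IH(2)]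
        diffop.mult[OF mult.IH(1) mult.hyps(2)]]])
    fix V \<psi> :: "'e \<Rightarrow> real" and z :: "'e \<times> 'e"
    assume V: "smooth_on V U" and z: "z \<in> U \<times> UNIV"
    have d: "S V differentiable at z" "T V differentiable at z"
      using diffop_differentiable(1) mult.hyps V z by blast+
    then show "S V z * fd (T V) z b + fd (S V) z b * T V z = fd (\<lambda>z. S V z * T V z) z b"
      by (simp add: fd_mult)
    assume \<psi>: "smooth_on \<psi> U"
    have d': "S' V \<psi> differentiable at z" "T' V \<psi> differentiable at z"
      using diffop_differentiable(2) mult.hyps V z \<psi> by blast+
    show "S V z * fd (T' V \<psi>) z b + S' V \<psi> z * fd (T V) z b +
        (fd (S V) z b * T' V \<psi> z + fd (S' V \<psi>) z b * T V z) =
        fd (\<lambda>z. S V z * T' V \<psi> z + S' V \<psi> z * T V z) z b"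
      by (simp add: fd_add fd_mult d d' differentiable_mult)
  qed
next
  case (cong S S' T T')
  show ?case
  proof (rule diffop.cong[OF cong.IH])
    fix V \<psi> :: "'e \<Rightarrow> real" and z :: "'e \<times> 'e"
    assume V: "smooth_on V U" and z: "z \<in> U \<times> UNIV"
    show "fd (S V) z b = fd (T V) z b"
      using fd_cong_open[OF open_tangent[OF U] z, of "S V" "T V"] cong.hyps(2) V by simp
    assume \<psi>: "smooth_on \<psi> U"
    show "fd (S' V \<psi>) z b = fd (T' V \<psi>) z b"
      using fd_cong_open[OF open_tangent[OF U] z, of "S' V \<psi>" "T' V \<psi>"] cong.hyps(3) V \<psi> by simp
  qed
qed

text \<open>This ties \<open>T'\<close> to \<open>T\<close>: jet coordinates are affine in
  \<open>\<tau>\<close>, and the product rule is built into \<open>mult\<close>. It feeds the mean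
  value theorem in \<open>locally_dense\<close>.\<close>

lemma diffop_has_real_derivative:
  assumes "diffop U T T'" "smooth_on V U" "smooth_on \<psi> U" "z \<in> U \<times> UNIV"
  shows "((\<lambda>\<tau>. T (\<lambda>x. V x + \<tau> * \<psi> x) z) has_real_derivative T' (\<lambda>x. V x + \<tau> * \<psi> x) \<psi> z) (at \<tau>)"
  using assms(1)
proof induction
  case (jet bs)
  have "((\<lambda>\<tau>. partials bs V (fst z) + \<tau> * partials bs \<psi> (fst z)) has_real_derivative
      partials bs \<psi> (fst z)) (at \<tau>)"
    by (auto intro!: derivative_eq_intros)
  moreover have "partials bs (\<lambda>x. V x + \<tau> * \<psi> x) (fst z) =
      partials bs V (fst z) + \<tau> * partials bs \<psi> (fst z)" for \<tau>
    by (rule partials_add_scaled[OF U]) (use assms jet in auto)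
  ultimately show ?case by simp
next
  case (mult S S' T T')
  show ?case using DERIV_mult[OF mult.IH] by (simp add: algebra_simps)
next
  case (cong S S' T T')
  have "smooth_on (\<lambda>x. V x + \<tau> * \<psi> x) U" for \<tau>
    by (intro smooth_on_add smooth_on_mult U assms smooth_on_const)
  then show ?case using cong assms by simp
qed (auto intro: DERIV_add)

lemma diffop_linearisation_sum:
  assumes "diffop U T T'" "smooth_on V U" "\<And>i. i \<in> I \<Longrightarrow> smooth_on (\<phi> i) U" "finite I" "z \<in> U \<times> UNIV"
  shows "T' V (\<lambda>x. \<Sum>i\<in>I. s i * \<phi> i x) z = (\<Sum>i\<in>I. s i * T' V (\<phi> i) z)"
  using assms(1)
proof induction
  case (jet bs)
  show ?case
    using partials_add_sum[where f = "\<lambda>x. 0" and x = "fst z" and s = s, OF U _ assms(3) jet _ assms(4)]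
      assms(5) by auto
next
  case (cong S S' T T')
  have "smooth_on (\<lambda>x. \<Sum>i\<in>I. s i * \<phi> i x) U"
    by (intro smooth_on_sum smooth_on_mult U smooth_on_const assms)
  then show ?case using cong assms by simp
qed (auto simp: sum.distrib sum_distrib_left sum_distrib_right algebra_simps)

text \<open>Coordinate expressions of functions on the manifold are controlled over the chart image
  alone, and partial derivatives at a point of the open set \<open>U\<close> see no more than
  that.\<close>

lemma diffop_local:
  assumes "diffop U T T'" "smooth_on V U" "smooth_on W U" "\<And>x. x \<in> U \<Longrightarrow> V x = W x" "z \<in> U \<times> UNIV"
  shows "T V z = T W z \<and> (smooth_on \<psi> U \<longrightarrow> T' V \<psi> z = T' W \<psi> z)"
  using assms(1)
proof induction
  case (jet bs)
  then show ?case using partials_cong_open[where x = "fst z", OF U _ assms(4)] assms(5) by auto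
qed (use assms in auto)

text \<open>Stated for an arbitrary filter so that the neighbourhood filter of the strong topology
  can be inserted. Compactness of \<open>K\<close> bounds the limits, without which uniform
  convergence would not pass to products.\<close>

lemma diffop_uniform_limit:
  assumes "diffop U T T'" "smooth_on V U"
    and "compact K" "K \<subseteq> U \<times> UNIV"
    and ev: "\<forall>\<^sub>F W in \<F>. smooth_on W U"
    and lim: "\<And>bs. set bs \<subseteq> Basis \<Longrightarrow> uniform_limit (fst ` K) (partials bs) (partials bs V) \<F>"
    and \<psi>: "smooth_on \<psi> U"
  shows "uniform_limit K T (T V) \<F> \<and> uniform_limit K (\<lambda>W. T' W \<psi>) (T' V \<psi>) \<F>"
  using assms(1)
proof induction
  case (jet bs)
  have "uniform_limit K (\<lambda>W z. partials bs W (fst z)) (\<lambda>z. partials bs V (fst z)) \<F>"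
    using lim[OF jet] unfolding uniform_limit_iff by (auto elim: eventually_mono)
  then show ?case by (simp add: uniform_limit_const)
next
  case (mult S S' T T')
  have "bounded (S V ` K)" "bounded (T V ` K)" "bounded (S' V \<psi> ` K)" "bounded (T' V \<psi> ` K)"
    using diffop_smooth[OF mult.hyps(1) assms(2), of \<psi>] diffop_smooth[OF mult.hyps(2) assms(2), of \<psi>]
      \<psi> smooth_on_subset[OF _ assms(4)]
    by (auto intro!: compact_imp_bounded compact_continuous_image assms(3) smooth_on_continuous)
  then show ?case using mult.IH by (auto intro!: uniform_lim_mult uniform_limit_add)
next
  case (cong S S' T T')
  have "\<forall>\<^sub>F W in \<F>. \<forall>z\<in>K. S W z = T W z \<and> S' W \<psi> z = T' W \<psi> z"
    using ev by eventually_elim (use cong.hyps assms(4) \<psi> in blast)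
  moreover have "\<forall>z\<in>K. S V z = T V z \<and> S' V \<psi> z = T' V \<psi> z"
    using cong.hyps assms(2,4) \<psi> by blast
  ultimately show ?case
    using cong.IH uniform_limit_cong[where f = S and g = T and h = "S V" and i = "T V" and F = \<F> and X = K]
      uniform_limit_cong[where f = "\<lambda>W. S' W \<psi>" and g = "\<lambda>W. T' W \<psi>" and h = "S' V \<psi>"
        and i = "T' V \<psi>" and F = \<F> and X = K]
    by (auto simp: eventually_conj_iff Ball_def eventually_mono)
qed (auto intro: uniform_limit_add uniform_limit_const)

end


section \<open>Charts and the strong topology\<close>

text \<open>A strict inequality on a compact set leaves a margin \<open>\<epsilon> - m\<close>, and
  the expression is Lipschitz in \<open>s\<close> uniformly in \<open>p\<close>.\<close>

lemma open_Collect_small_perturbation: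
  fixes u :: "'q::topological_space \<Rightarrow> real" and w :: "'s::euclidean_space \<Rightarrow> 'q \<Rightarrow> real"
  assumes "compact K" "continuous_on K u" "\<And>b. b \<in> Basis \<Longrightarrow> continuous_on K (w b)"
  shows "open {s. \<forall>p\<in>K. \<bar>u p + (\<Sum>b\<in>Basis. (s \<bullet> b) * w b p)\<bar> < \<epsilon>}"
proof (cases "K = {}")
  case False
  have "\<exists>M. \<forall>p\<in>K. \<bar>w b p\<bar> \<le> M" if "b \<in> Basis" for b
    using compact_imp_bounded[OF compact_continuous_image[OF assms(3)[OF that] assms(1)]]
    by (auto simp: bounded_iff)
  then obtain M where M: "\<And>b p. b \<in> Basis \<Longrightarrow> p \<in> K \<Longrightarrow> \<bar>w b p\<bar> \<le> M b" by metis
  define B where "B = (\<Sum>b\<in>Basis. M b)"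
  have lip: "\<bar>\<Sum>b\<in>Basis. (h \<bullet> b) * w b p\<bar> \<le> norm h * B" if "p \<in> K" for h p
  proof -
    have "\<bar>\<Sum>b\<in>Basis. (h \<bullet> b) * w b p\<bar> \<le> (\<Sum>b\<in>Basis. norm h * M b)"
      by (rule order_trans[OF sum_abs], rule sum_mono)
        (auto simp: abs_mult intro!: mult_mono Basis_le_norm M that)
    then show ?thesis by (simp add: B_def sum_distrib_left)
  qed
  show ?thesis
    unfolding open_dist
  proof (intro ballI)
    fix s assume s: "s \<in> {s. \<forall>p\<in>K. \<bar>u p + (\<Sum>b\<in>Basis. (s \<bullet> b) * w b p)\<bar> < \<epsilon>}"
    have "continuous_on K (\<lambda>p. \<bar>u p + (\<Sum>b\<in>Basis. (s \<bullet> b) * w b p)\<bar>)"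
      by (intro continuous_intros assms) auto
    from continuous_attains_sup[OF assms(1) False this] obtain m where
      m: "m < \<epsilon>" "\<And>p. p \<in> K \<Longrightarrow> \<bar>u p + (\<Sum>b\<in>Basis. (s \<bullet> b) * w b p)\<bar> \<le> m"
      using s by auto
    define \<delta> where "\<delta> = (\<epsilon> - m) / (\<bar>B\<bar> + 1)"
    have "\<bar>u p + (\<Sum>b\<in>Basis. (t \<bullet> b) * w b p)\<bar> < \<epsilon>" if "dist t s < \<delta>" "p \<in> K" for t p
    proof -
      have "norm (t - s) * B \<le> norm (t - s) * (\<bar>B\<bar> + 1)" by (intro mult_left_mono) auto
      also have "\<dots> < \<delta> * (\<bar>B\<bar> + 1)"
        using that by (intro mult_strict_right_mono) (auto simp: dist_norm)
      also have "\<dots> = \<epsilon> - m" by (simp add: \<delta>_def)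
      finally have "\<bar>\<Sum>b\<in>Basis. ((t - s) \<bullet> b) * w b p\<bar> < \<epsilon> - m" using lip[OF that(2), of "t - s"] by simp
      moreover have "u p + (\<Sum>b\<in>Basis. (t \<bullet> b) * w b p) =
        (u p + (\<Sum>b\<in>Basis. (s \<bullet> b) * w b p)) + (\<Sum>b\<in>Basis. ((t - s) \<bullet> b) * w b p)"
        by (simp add: inner_diff_left left_diff_distrib sum_subtractf)
      ultimately show ?thesis using m(2)[OF that(2)] by linarith
    qed
    moreover have "\<delta> > 0" using m(1) by (simp add: \<delta>_def)
    ultimately show "\<exists>\<delta>>0. \<forall>t. dist t s < \<delta> \<longrightarrow>
        t \<in> {s. \<forall>p\<in>K. \<bar>u p + (\<Sum>b\<in>Basis. (s \<bullet> b) * w b p)\<bar> < \<epsilon>}" by blast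
  qed
qed simp

definition chart_extension :: "('q::topological_space, 'e::euclidean_space) chart \<Rightarrow> ('e \<Rightarrow> real) \<Rightarrow> 'q \<Rightarrow> real" where
  "chart_extension c \<psi> p = (if p \<in> chart_dom c then \<psi> (chart_map c p) else 0)"

context
  fixes A :: "('q::{second_countable_topology,t2_space}, 'e::euclidean_space) chart set"
  assumes A: "smooth_structure A"
begin

lemma chart_facts:
  assumes "c \<in> A"
  shows "open (chart_dom c)" "open (chart_img c)" "continuous_on (chart_dom c) (chart_map c)"
    "continuous_on (chart_img c) (chart_inv c)"
    "\<And>p. p \<in> chart_dom c \<Longrightarrow> chart_inv c (chart_map c p) = p"
    "\<And>x. x \<in> chart_img c \<Longrightarrow> chart_map c (chart_inv c x) = x"
    "\<And>x. x \<in> chart_img c \<Longrightarrow> chart_inv c x \<in> chart_dom c"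
proof -
  have "is_chart c" using assms A unfolding smooth_structure_def by blast
  then have "open (chart_dom c)" "open (chart_img c)"
    and h: "homeomorphism (chart_dom c) (chart_img c) (chart_map c) (chart_inv c)"
    unfolding is_chart_def by blast+
  then show "open (chart_dom c)" "open (chart_img c)" by blast+
  show "continuous_on (chart_dom c) (chart_map c)" "continuous_on (chart_img c) (chart_inv c)"
    using h unfolding homeomorphism_def by blast+
  show "chart_inv c (chart_map c p) = p" if "p \<in> chart_dom c" for p
    using h that unfolding homeomorphism_def by blast
  show "chart_map c (chart_inv c x) = x" "chart_inv c x \<in> chart_dom c" if "x \<in> chart_img c" for x
    using h that unfolding homeomorphism_def by blast+
qed

lemma chart_exists: "\<exists>c\<in>A. p \<in> chart_dom c"
  using A unfolding smooth_structure_def by blast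

lemma in_chart_image:
  assumes "c \<in> A" "x \<in> chart_img c" "chart_inv c x \<in> W"
  shows "x \<in> chart_map c ` (chart_dom c \<inter> W)"
  by (rule image_eqI[of _ _ "chart_inv c x"])
    (simp_all add: chart_facts(6,7)[OF assms(1,2)] assms(3))

lemma open_chart_image:
  assumes "c \<in> A" "open W"
  shows "open (chart_map c ` (chart_dom c \<inter> W))"
proof -
  have "chart_map c ` (chart_dom c \<inter> W) = chart_img c \<inter> chart_inv c -` W"
    using chart_facts(5)[OF assms(1)] in_chart_image[OF assms(1)] by fastforce
  then show ?thesis
    using continuous_open_preimage[OF chart_facts(4,2)[OF assms(1)] assms(2)] by simp
qed

lemma transition_smooth:
  assumes "c \<in> A" "d \<in> A"
  shows "smooth_on (\<lambda>x. chart_map d (chart_inv c x)) (chart_map c ` (chart_dom c \<inter> chart_dom d))"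
proof -
  have "smooth_compatible c d" using assms A unfolding smooth_structure_def by blast
  then show ?thesis unfolding smooth_compatible_def comp_def by blast
qed

lemma smooth_functions_chart:
  "f \<in> smooth_functions A \<Longrightarrow> c \<in> A \<Longrightarrow> smooth_on (\<lambda>x. f (chart_inv c x)) (chart_img c)"
  unfolding smooth_functions_def comp_def by blast

lemma smooth_functions_add_sum:
  assumes "V \<in> smooth_functions A" "\<And>i. i \<in> I \<Longrightarrow> \<phi> i \<in> smooth_functions A"
  shows "(\<lambda>p. V p + (\<Sum>i\<in>I. s i * \<phi> i p)) \<in> smooth_functions A"
  unfolding smooth_functions_def comp_def
  by (intro CollectI ballI smooth_on_add smooth_on_sum smooth_on_mult smooth_functions_chart assms
      chart_facts(2) smooth_on_const)

text \<open>The critical points are those outside the chart domain. There the complement of the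
  preimage of \<open>K\<close> is a neighbourhood, because compact sets are closed in a Hausdorff
  space, and the extension is 0 on it.\<close>

lemma chart_extension_smooth:
  assumes c: "c \<in> A" and \<psi>: "smooth_on \<psi> (chart_img c)"
    and K: "compact K" "K \<subseteq> chart_img c" "\<And>x. x \<in> chart_img c - K \<Longrightarrow> \<psi> x = 0"
  shows "chart_extension c \<psi> \<in> smooth_functions A"
  unfolding smooth_functions_def comp_def
proof (intro CollectI ballI smooth_on_local)
  fix d x assume d: "d \<in> A" and x: "x \<in> chart_img d"
  let ?f = "\<lambda>x. chart_extension c \<psi> (chart_inv d x)"
  show "\<exists>T. x \<in> T \<and> smooth_on ?f T"
  proof (cases "chart_inv d x \<in> chart_dom c")
    case True
    let ?T = "chart_map d ` (chart_dom d \<inter> chart_dom c)"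
    have op: "open ?T" by (intro open_chart_image d chart_facts(1) c)
    have "chart_map c (chart_inv d y) \<in> chart_img c" if "y \<in> ?T" for y
      using that chart_facts(5)[OF d] by auto
    then have "smooth_on (\<lambda>x. \<psi> (chart_map c (chart_inv d x))) ?T"
      by (intro smooth_on_compose[OF op chart_facts(2)[OF c] _ \<psi>] transition_smooth c d) blast
    then have "smooth_on ?f ?T"
    proof (rule smooth_on_cong_open[OF op, rotated])
      fix y assume "y \<in> ?T"
      then obtain p where "p \<in> chart_dom d" "p \<in> chart_dom c" "y = chart_map d p"
        by (elim imageE IntE)
      then have "chart_inv d y \<in> chart_dom c" using chart_facts(5)[OF d] by simp
      then show "\<psi> (chart_map c (chart_inv d y)) = ?f y" by (simp add: chart_extension_def)
    qed
    moreover have "x \<in> ?T" using True x d by (intro in_chart_image)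
    ultimately show ?thesis by (intro exI conjI)
  next
    case False
    have "compact (chart_inv c ` K)"
      by (intro compact_continuous_image K continuous_on_subset[OF chart_facts(4)[OF c]])
    then have op: "open (- (chart_inv c ` K))" using compact_imp_closed by blast
    let ?T = "chart_map d ` (chart_dom d \<inter> - (chart_inv c ` K))"
    have f0: "?f y = 0" if "y \<in> ?T" for y
    proof -
      have "chart_inv d y \<notin> chart_inv c ` K" using that chart_facts(5)[OF d] by auto
      then have "chart_map c (chart_inv d y) \<notin> K" if "chart_inv d y \<in> chart_dom c"
        using that chart_facts(5)[OF c] by (metis image_eqI)
      then show ?thesis using K(3) by (simp add: chart_extension_def)
    qed
    have "smooth_on ?f ?T"
      by (rule smooth_on_cong_open[OF open_chart_image[OF d op], of "\<lambda>x. 0"])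
        (rule f0[symmetric], assumption, rule smooth_on_const)
    moreover have "chart_inv d x \<notin> chart_inv c ` K"
    proof
      assume "chart_inv d x \<in> chart_inv c ` K"
      then obtain y where "chart_inv d x = chart_inv c y" "y \<in> K" by (rule imageE)
      then show False using False subsetD[OF K(2)] chart_facts(7)[OF c, of y] by simp
    qed
    then have "x \<in> ?T" using x d by (intro in_chart_image) auto
    ultimately show ?thesis by (intro exI conjI)
  qed
qed (rule chart_facts(2))

lemma topspace_strong_topology: "topspace (strong_topology A) = smooth_functions A"
proof -
  have "V \<in> topspace (strong_topology A)" if "V \<in> smooth_functions A" for V
    unfolding strong_topology_def topology_generated_by_topspace
  proof (rule UnionI)
    show "V \<in> strong_nbhd A 0 V {} (\<lambda>_. ({}, \<lambda>_. 0)) (\<lambda>_. {}) (\<lambda>_. 1)"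
      using that by (simp add: strong_nbhd_def)
    show "strong_nbhd A 0 V {} (\<lambda>_. ({}, \<lambda>_. 0)) (\<lambda>_. {}) (\<lambda>_. 1) \<in>
      {strong_nbhd A r f I \<Phi> K \<epsilon> | r f I \<Phi> K \<epsilon>.
          f \<in> smooth_functions A \<and> locally_finite_charts I \<Phi> \<and>
          (\<forall>i\<in>I. \<Phi> i \<in> A \<and> compact (K i) \<and> K i \<subseteq> chart_dom (\<Phi> i) \<and> \<epsilon> i > 0)}"
      by (intro CollectI exI conjI refl that)
        (auto simp: that locally_finite_charts_def intro: exI[of _ UNIV])
  qed
  moreover have "topspace (strong_topology A) \<subseteq> smooth_functions A"
    unfolding strong_topology_def topology_generated_by_topspace strong_nbhd_def by auto
  ultimately show ?thesis by blast
qed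

text \<open>A family consisting of the single chart \<open>c\<close> is locally finite, so closeness
  on one compact set of one chart is already an open condition.\<close>

lemma strong_nbhd_chart_openin:
  assumes "c \<in> A" "compact K" "K \<subseteq> chart_img c" "V \<in> smooth_functions A" "\<epsilon> > 0"
  shows "\<exists>\<V>. openin (strong_topology A) \<V> \<and> V \<in> \<V> \<and>
    (\<forall>W\<in>\<V>. \<forall>x\<in>K. \<forall>bs. set bs \<subseteq> Basis \<and> length bs \<le> r \<longrightarrow>
      \<bar>partials bs (\<lambda>x. W (chart_inv c x)) x - partials bs (\<lambda>x. V (chart_inv c x)) x\<bar> < \<epsilon>)"
proof -
  let ?K = "chart_inv c ` K"
  let ?\<V> = "strong_nbhd A r V {0} (\<lambda>_. c) (\<lambda>_. ?K) (\<lambda>_. \<epsilon>)"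
  have "compact ?K"
    by (intro compact_continuous_image assms continuous_on_subset[OF chart_facts(4)[OF assms(1)]])
  moreover have "?K \<subseteq> chart_dom c" using assms(3) chart_facts(7)[OF assms(1)] by blast
  ultimately have "openin (strong_topology A) ?\<V>"
    unfolding strong_topology_def
    by (intro topology_generated_by_Basis CollectI exI conjI refl)
      (auto simp: assms locally_finite_charts_def intro!: exI[of _ UNIV])
  moreover have "V \<in> ?\<V>" using assms by (simp add: strong_nbhd_def)
  moreover have "\<bar>partials bs (\<lambda>x. W (chart_inv c x)) x - partials bs (\<lambda>x. V (chart_inv c x)) x\<bar> < \<epsilon>"
    if "W \<in> ?\<V>" "x \<in> K" "set bs \<subseteq> Basis \<and> length bs \<le> r" for W x bs
  proof -
    have "chart_map c (chart_inv c x) = x" using that(2) assms(3) chart_facts(6)[OF assms(1)] by blast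
    then show ?thesis using that by (force simp: strong_nbhd_def comp_def)
  qed
  ultimately show ?thesis by blast
qed

lemma uniform_limit_partials_strong:
  assumes "c \<in> A" "compact K" "K \<subseteq> chart_img c" "V \<in> smooth_functions A" "set bs \<subseteq> Basis"
  shows "uniform_limit K (partials bs) (partials bs (\<lambda>x. V (chart_inv c x)))
    (filtermap (\<lambda>W x. W (chart_inv c x)) (nhdsin (strong_topology A) V))"
  unfolding uniform_limit_iff
proof (intro allI impI)
  fix \<epsilon> :: real assume "\<epsilon> > 0"
  from strong_nbhd_chart_openin[OF assms(1-4) this, of "length bs"] assms(5)
  show "\<forall>\<^sub>F f in filtermap (\<lambda>W x. W (chart_inv c x)) (nhdsin (strong_topology A) V).
      \<forall>x\<in>K. dist (partials bs f x) (partials bs (\<lambda>x. V (chart_inv c x)) x) < \<epsilon>"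
    unfolding eventually_filtermap eventually_nhdsin dist_real_def by (metis order_refl)
qed

lemma finite_charts_meeting_compact:
  assumes "locally_finite_charts I \<Phi>" "compact K"
  shows "finite {i \<in> I. chart_dom (\<Phi> i) \<inter> K \<noteq> {}}"
proof -
  obtain W where W: "\<And>p. open (W p)" "\<And>p. p \<in> W p"
    "\<And>p. finite {i \<in> I. chart_dom (\<Phi> i) \<inter> W p \<noteq> {}}"
    using choice[OF assms(1)[unfolded locally_finite_charts_def]] by blast
  obtain D where D: "D \<subseteq> K" "finite D" "K \<subseteq> (\<Union>p\<in>D. W p)"
    by (rule compactE_image[OF assms(2), of K W]) (use W(1,2) in auto)
  show ?thesis
  proof (rule finite_subset)
    show "{i \<in> I. chart_dom (\<Phi> i) \<inter> K \<noteq> {}} \<subseteq> (\<Union>p\<in>D. {i \<in> I. chart_dom (\<Phi> i) \<inter> W p \<noteq> {}})"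
      using D(3) by blast
    show "finite (\<Union>p\<in>D. {i \<in> I. chart_dom (\<Phi> i) \<inter> W p \<noteq> {}})"
      using D(2) W(3) by (rule finite_UN_I)
  qed
qed

text \<open>In the strong topology adding small multiples of a function is in general not continuous
  on a noncompact manifold, since infinitely many tolerances must be met at once. Compact support of
  the perturbations repairs this: all but finitely many charts of a locally finite family miss
  \<open>C\<close>, and the conditions in those do not depend on \<open>s\<close>.\<close>

lemma continuous_map_perturbation:
  fixes \<phi> :: "'s::euclidean_space \<Rightarrow> 'q \<Rightarrow> real"
  assumes V: "V \<in> smooth_functions A" and \<phi>: "\<And>b. b \<in> Basis \<Longrightarrow> \<phi> b \<in> smooth_functions A"
    and C: "compact C" "\<And>b p. b \<in> Basis \<Longrightarrow> p \<notin> C \<Longrightarrow> \<phi> b p = 0"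
  shows "continuous_map euclidean (strong_topology A) (\<lambda>s p. V p + (\<Sum>b\<in>Basis. (s \<bullet> b) * \<phi> b p))"
proof -
  let ?V = "\<lambda>s p. V p + (\<Sum>b\<in>Basis. (s \<bullet> b) * \<phi> b p)"
  have mem: "?V s \<in> smooth_functions A" for s by (intro smooth_functions_add_sum V \<phi>)
  have "open (?V -` \<V>)" if \<V>: "\<V> = strong_nbhd A r f I \<Phi> K \<epsilon>" "f \<in> smooth_functions A"
    "locally_finite_charts I \<Phi>" "\<forall>i\<in>I. \<Phi> i \<in> A \<and> compact (K i) \<and> K i \<subseteq> chart_dom (\<Phi> i) \<and> \<epsilon> i > 0"
    for \<V> r f I \<Phi> K \<epsilon>
  proof -
    define B where "B = {bs::'e list. set bs \<subseteq> Basis \<and> length bs \<le> r}"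
    have B: "finite B" unfolding B_def by (rule finite_lists_length_le) simp
    define J where "J = {i \<in> I. chart_dom (\<Phi> i) \<inter> C \<noteq> {}}"
    have J: "finite J" unfolding J_def by (intro finite_charts_meeting_compact \<V> C)
    define u where "u i bs p = partials bs (\<lambda>x. V (chart_inv (\<Phi> i) x)) (chart_map (\<Phi> i) p)
        - partials bs (\<lambda>x. f (chart_inv (\<Phi> i) x)) (chart_map (\<Phi> i) p)" for i bs p
    define w where "w i bs b p = partials bs (\<lambda>x. \<phi> b (chart_inv (\<Phi> i) x)) (chart_map (\<Phi> i) p)" for i bs b p
    define P where "P s i \<longleftrightarrow> (\<forall>bs\<in>B. \<forall>p\<in>K i. \<bar>u i bs p + (\<Sum>b\<in>Basis. (s \<bullet> b) * w i bs b p)\<bar> < \<epsilon> i)" for s i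
    have eq: "?V s \<in> \<V> \<longleftrightarrow> (\<forall>i\<in>I. P s i)" for s
    proof -
      have "partials bs (\<lambda>x. ?V s (chart_inv (\<Phi> i) x)) (chart_map (\<Phi> i) p) =
          partials bs (\<lambda>x. V (chart_inv (\<Phi> i) x)) (chart_map (\<Phi> i) p) + (\<Sum>b\<in>Basis. (s \<bullet> b) * w i bs b p)"
        if "i \<in> I" "p \<in> K i" "bs \<in> B" for i p bs
        unfolding w_def
        by (rule partials_add_sum[where S = "chart_img (\<Phi> i)"])
          (use that \<V> in \<open>auto simp: B_def intro!: chart_facts(2) smooth_functions_chart V \<phi>\<close>)
      then have "?V s \<in> \<V> \<longleftrightarrow> (\<forall>i\<in>I. \<forall>p\<in>K i. \<forall>bs\<in>B. \<bar>u i bs p + (\<Sum>b\<in>Basis. (s \<bullet> b) * w i bs b p)\<bar> < \<epsilon> i)"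
        unfolding \<V> strong_nbhd_def u_def comp_def using mem[of s]
        by (simp add: B_def[symmetric] algebra_simps) (auto simp: B_def algebra_simps)
      then show ?thesis unfolding P_def by blast
    qed
    have const: "P s i \<longleftrightarrow> P 0 i" if "i \<in> I - J" for s i
    proof -
      have i: "i \<in> I" "chart_dom (\<Phi> i) \<inter> C = {}" using that by (auto simp: J_def)
      have "w i bs b p = 0" if "b \<in> Basis" "p \<in> K i" for bs b p
      proof -
        have "partials bs (\<lambda>x. \<phi> b (chart_inv (\<Phi> i) x)) (chart_map (\<Phi> i) p) =
            partials bs (\<lambda>x. 0) (chart_map (\<Phi> i) p)"
          by (rule partials_cong_open[OF chart_facts(2)[of "\<Phi> i"]])
            (use i that \<V>(4) chart_facts(7)[of "\<Phi> i"] C(2)[of b] in blast)+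
        then show ?thesis by (simp add: w_def)
      qed
      then show ?thesis unfolding P_def by simp
    qed
    have split: "(\<forall>i\<in>I. P s i) \<longleftrightarrow> (\<forall>i\<in>J. P s i) \<and> (\<forall>i\<in>I - J. P s i)" for s
      unfolding J_def by blast
    have "(\<forall>i\<in>I - J. P s i) \<longleftrightarrow> (\<forall>i\<in>I - J. P 0 i)" for s
      by (rule ball_cong[OF refl]) (rule const)
    then have "?V s \<in> \<V> \<longleftrightarrow> (\<forall>i\<in>J. P s i) \<and> (\<forall>i\<in>I - J. P 0 i)" for s
      unfolding eq split by blast
    then have "?V -` \<V> = (\<Inter>i\<in>J. {s. P s i}) \<inter> {s. \<forall>i\<in>I - J. P 0 i}"
      by (auto simp only: vimage_eq INT_iff Int_iff mem_Collect_eq)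
    moreover have "open {s. P s i}" if "i \<in> J" for i
    proof -
      have i: "i \<in> I" "\<Phi> i \<in> A" "K i \<subseteq> chart_dom (\<Phi> i)" "compact (K i)" using that \<V> by (auto simp: J_def)
      have cont: "continuous_on (K i) (\<lambda>p. partials bs (\<lambda>x. h (chart_inv (\<Phi> i) x)) (chart_map (\<Phi> i) p))"
        if "h \<in> smooth_functions A" "bs \<in> B" for h bs
      proof (rule continuous_on_compose2[where f = "chart_map (\<Phi> i)"])
        show "continuous_on (chart_img (\<Phi> i)) (partials bs (\<lambda>x. h (chart_inv (\<Phi> i) x)))"
          using that i by (intro smooth_on_continuous smooth_on_partials smooth_functions_chart chart_facts)
            (auto simp: B_def)
      qed (use i chart_facts(3)[OF i(2)] in \<open>auto intro: continuous_on_subset\<close>)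
      have "{s. P s i} = (\<Inter>bs\<in>B. {s. \<forall>p\<in>K i. \<bar>u i bs p + (\<Sum>b\<in>Basis. (s \<bullet> b) * w i bs b p)\<bar> < \<epsilon> i})"
        by (auto simp: P_def)
      then show ?thesis
        using B by (auto intro!: open_INT open_Collect_small_perturbation i continuous_on_diff cont V \<V> \<phi>
            simp: u_def w_def)
    qed
    then have "open (\<Inter>i\<in>J. {s. P s i})" by (intro open_INT J ballI)
    ultimately show ?thesis by (simp only:) (intro open_Int open_Collect_const)
  qed
  then show ?thesis
    unfolding strong_topology_def
  proof (intro continuous_on_generated_topo, goal_cases)
    case 2
    then show ?case using mem topspace_strong_topology
      unfolding strong_topology_def topology_generated_by_topspace by auto
  qed auto
qed

end


section \<open>Generic avoidance of a negligible set\<close>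

locale smooth_chart =
  fixes A :: "('q::{second_countable_topology,t2_space}, 'e::euclidean_space) chart set"
    and c :: "('q, 'e) chart"
  assumes A: "smooth_structure A" and c: "c \<in> A"
begin

abbreviation "U \<equiv> chart_img c"
abbreviation "loc V \<equiv> \<lambda>x. V (chart_inv c x)"
abbreviation "X \<equiv> strong_topology A"

lemma U: "open U"
  by (rule chart_facts(2)[OF A c])

lemma smooth_loc: "V \<in> smooth_functions A \<Longrightarrow> smooth_on (loc V) U"
  by (rule smooth_functions_chart[OF A _ c])

lemma openin_smooth: "openin X \<V> \<Longrightarrow> V \<in> \<V> \<Longrightarrow> V \<in> smooth_functions A"
  using openin_subset topspace_strong_topology[OF A] by blast

text \<open>Joint continuity in the function and the point, with \<open>\<psi>\<close> fixed:
  uniform closeness on a closed ball around \<open>z0\<close> is combined with continuity of the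
  limit at \<open>z0\<close>.\<close>

lemma diffop_near:
  assumes "diffop U S S'" "V0 \<in> smooth_functions A" "z0 \<in> U \<times> UNIV" "\<epsilon> > 0" "smooth_on \<psi> U"
  shows "\<exists>N \<V>. open N \<and> z0 \<in> N \<and> N \<subseteq> U \<times> UNIV \<and> openin X \<V> \<and> V0 \<in> \<V> \<and>
    (\<forall>V\<in>\<V>. \<forall>z\<in>N. \<bar>S (loc V) z - S (loc V0) z0\<bar> < \<epsilon> \<and> \<bar>S' (loc V) \<psi> z - S' (loc V0) \<psi> z0\<bar> < \<epsilon>)"
proof -
  obtain \<rho> where \<rho>: "\<rho> > 0" "cball z0 \<rho> \<subseteq> U \<times> UNIV"
    using open_tangent[OF U] assms(3) open_contains_cball by metis
  let ?F = "filtermap loc (nhdsin X V0)"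
  have "\<forall>\<^sub>F V in nhdsin X V0. smooth_on (loc V) U"
    unfolding eventually_nhdsin using smooth_loc topspace_strong_topology[OF A] assms(2) openin_topspace
    by metis
  then have ev: "\<forall>\<^sub>F W in ?F. smooth_on W U" by (simp add: eventually_filtermap)
  have "uniform_limit (cball z0 \<rho>) S (S (loc V0)) ?F \<and>
      uniform_limit (cball z0 \<rho>) (\<lambda>W. S' W \<psi>) (S' (loc V0) \<psi>) ?F"
  proof (rule diffop_uniform_limit[OF U assms(1) smooth_loc[OF assms(2)] compact_cball \<rho>(2) ev _ assms(5)])
    show "uniform_limit (fst ` cball z0 \<rho>) (partials bs) (partials bs (loc V0)) ?F"
      if "set bs \<subseteq> Basis" for bs
      by (rule uniform_limit_partials_strong[OF A c _ _ assms(2) that])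
        (use \<rho>(2) in \<open>auto intro!: compact_continuous_image continuous_on_fst continuous_on_id\<close>)
  qed
  then have "\<forall>\<^sub>F W in ?F. \<forall>z\<in>cball z0 \<rho>. \<bar>S W z - S (loc V0) z\<bar> < \<epsilon> / 2"
    and "\<forall>\<^sub>F W in ?F. \<forall>z\<in>cball z0 \<rho>. \<bar>S' W \<psi> z - S' (loc V0) \<psi> z\<bar> < \<epsilon> / 2"
    unfolding uniform_limit_iff dist_real_def using half_gt_zero[OF assms(4)] by blast+
  then have "\<forall>\<^sub>F W in ?F. \<forall>z\<in>cball z0 \<rho>. \<bar>S W z - S (loc V0) z\<bar> < \<epsilon> / 2 \<and>
      \<bar>S' W \<psi> z - S' (loc V0) \<psi> z\<bar> < \<epsilon> / 2"
    by (rule eventually_elim2) simp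
  then obtain \<V> where \<V>: "openin X \<V>" "V0 \<in> \<V>" "\<And>V z. V \<in> \<V> \<Longrightarrow> z \<in> cball z0 \<rho> \<Longrightarrow>
      \<bar>S (loc V) z - S (loc V0) z\<bar> < \<epsilon> / 2 \<and> \<bar>S' (loc V) \<psi> z - S' (loc V0) \<psi> z\<bar> < \<epsilon> / 2"
    unfolding eventually_filtermap eventually_nhdsin topspace_strong_topology[OF A]
    using assms(2) by blast
  have "isCont (S (loc V0)) z0" "isCont (S' (loc V0) \<psi>) z0"
    using diffop_differentiable[OF U assms(1) smooth_loc[OF assms(2)] assms(3)] assms(5)
      differentiable_imp_continuous_within by blast+
  then obtain \<delta> \<delta>' where \<delta>: "\<delta> > 0" "\<And>z. dist z z0 < \<delta> \<Longrightarrow> \<bar>S (loc V0) z - S (loc V0) z0\<bar> < \<epsilon> / 2"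
    and \<delta>': "\<delta>' > 0" "\<And>z. dist z z0 < \<delta>' \<Longrightarrow> \<bar>S' (loc V0) \<psi> z - S' (loc V0) \<psi> z0\<bar> < \<epsilon> / 2"
    unfolding continuous_at_eps_delta dist_real_def using assms(4) by (metis half_gt_zero)
  define N where "N = ball z0 (min \<rho> (min \<delta> \<delta>'))"
  have "\<bar>S (loc V) z - S (loc V0) z0\<bar> < \<epsilon> \<and> \<bar>S' (loc V) \<psi> z - S' (loc V0) \<psi> z0\<bar> < \<epsilon>"
    if "V \<in> \<V>" "z \<in> N" for V z
  proof -
    have "dist z z0 < \<delta>" "dist z z0 < \<delta>'" "z \<in> cball z0 \<rho>" using that by (auto simp: N_def dist_commute)
    then show ?thesis using \<V>(3)[OF that(1), of z] \<delta>(2) \<delta>'(2) by (smt (verit) field_sum_of_halves)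
  qed
  moreover have "N \<subseteq> cball z0 \<rho>" by (auto simp: N_def)
  then have "open N" "z0 \<in> N" "N \<subseteq> U \<times> UNIV"
    using \<rho> \<delta>(1) \<delta>'(1) by (auto simp: N_def)
  ultimately show ?thesis using \<V>(1,2) by blast
qed

end

text \<open>Equations, perturbations and parameters are all indexed by \<open>Basis\<close> of the
  product space, so the linearisation at a common zero is a square matrix, and
  \<open>perturbation\<close> asks it to be injective. The drop of one dimension is encoded in the
  negligibility of \<open>Z\<close>, the points where common zeros are to be avoided.\<close>

locale avoidance = smooth_chart A c
  for A :: "('q::{second_countable_topology,t2_space}, 'e::euclidean_space) chart set" and c +
  fixes T :: "'e \<times> 'e \<Rightarrow> ('e \<Rightarrow> real) \<Rightarrow> 'e \<times> 'e \<Rightarrow> real"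
    and T' :: "'e \<times> 'e \<Rightarrow> ('e \<Rightarrow> real) \<Rightarrow> ('e \<Rightarrow> real) \<Rightarrow> 'e \<times> 'e \<Rightarrow> real"
    and Z :: "('e \<times> 'e) set"
  assumes diffop_T: "\<And>b. b \<in> Basis \<Longrightarrow> diffop U (T b) (T' b)"
    and Z_sub: "Z \<subseteq> U \<times> UNIV"
    and Z_negligible: "negligible Z"
    and perturbation: "\<And>V z. smooth_on V U \<Longrightarrow> z \<in> Z \<Longrightarrow> \<forall>b\<in>Basis. T b V z = 0 \<Longrightarrow>
      \<exists>\<phi> K. compact K \<and> K \<subseteq> U \<and>
        (\<forall>i\<in>(Basis::('e \<times> 'e) set). smooth_on (\<phi> i) U \<and> (\<forall>x\<in>U - K. \<phi> i x = 0)) \<and>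
        (\<forall>s. (\<forall>b\<in>Basis. (\<Sum>i\<in>Basis. (s \<bullet> i) * T' b V (\<phi> i) z) = 0) \<longrightarrow> s = 0)"
begin

definition avoids :: "('q \<Rightarrow> real) \<Rightarrow> ('e \<times> 'e) set \<Rightarrow> bool" where
  "avoids V K \<longleftrightarrow> (\<forall>z\<in>K. \<exists>b\<in>Basis. T b (loc V) z \<noteq> 0)"

lemma avoids_near:
  assumes "V0 \<in> smooth_functions A" "z0 \<in> U \<times> UNIV" "b \<in> Basis" "T b (loc V0) z0 \<noteq> 0"
  shows "\<exists>N \<V>. open N \<and> z0 \<in> N \<and> N \<subseteq> U \<times> UNIV \<and> openin X \<V> \<and> V0 \<in> \<V> \<and> (\<forall>V\<in>\<V>. avoids V N)"
proof -
  from diffop_near[OF diffop_T[OF assms(3)] assms(1,2), of "\<bar>T b (loc V0) z0\<bar>" "\<lambda>x. 0"] assms(4)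
  obtain N \<V> where N: "open N" "z0 \<in> N" "N \<subseteq> U \<times> UNIV" "openin X \<V>" "V0 \<in> \<V>"
    "\<And>V z. V \<in> \<V> \<Longrightarrow> z \<in> N \<Longrightarrow> \<bar>T b (loc V) z - T b (loc V0) z0\<bar> < \<bar>T b (loc V0) z0\<bar>" by auto
  have "T b (loc V) z \<noteq> 0" if "V \<in> \<V>" "z \<in> N" for V z using N(6)[OF that] by auto
  then have "\<forall>V\<in>\<V>. avoids V N" unfolding avoids_def using assms(3) by blast
  then show ?thesis using N by blast
qed

lemma openin_avoids:
  assumes "compact K" "K \<subseteq> U \<times> UNIV"
  shows "openin X {V \<in> smooth_functions A. avoids V K}"
proof (subst openin_subopen, intro ballI)
  fix V0 assume "V0 \<in> {V \<in> smooth_functions A. avoids V K}"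
  then have V0: "V0 \<in> smooth_functions A" "avoids V0 K" by auto
  have "\<exists>N \<V>. open N \<and> z \<in> N \<and> openin X \<V> \<and> V0 \<in> \<V> \<and> (\<forall>V\<in>\<V>. avoids V N)" if "z \<in> K" for z
  proof -
    have "\<exists>b\<in>Basis. T b (loc V0) z \<noteq> 0"
      using V0(2) that unfolding avoids_def by (rule bspec)
    then obtain b where b: "b \<in> Basis" "T b (loc V0) z \<noteq> 0" by (rule bexE)
    from avoids_near[OF V0(1) subsetD[OF assms(2) that] b] show ?thesis
      by (elim exE conjE) (intro exI conjI)
  qed
  then obtain N \<V> where N: "\<And>z. z \<in> K \<Longrightarrow> open (N z)" "\<And>z. z \<in> K \<Longrightarrow> z \<in> N z"
    "\<And>z. z \<in> K \<Longrightarrow> openin X (\<V> z)" "\<And>z. z \<in> K \<Longrightarrow> V0 \<in> \<V> z" "\<And>z V. z \<in> K \<Longrightarrow> V \<in> \<V> z \<Longrightarrow> avoids V (N z)"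
    by metis
  obtain D where D: "D \<subseteq> K" "finite D" "K \<subseteq> (\<Union>z\<in>D. N z)"
    by (rule compactE_image[OF assms(1), of K N]) (use N(1,2) in auto)
  let ?W = "topspace X \<inter> (\<Inter>z\<in>D. \<V> z)"
  have "openin X ?W"
    using D(2,1) by (induction D) (auto intro: N openin_Int simp: Int_assoc Int_left_commute)
  moreover have "V0 \<in> ?W" using V0(1) N(4) D(1) topspace_strong_topology[OF A] by blast
  moreover have "avoids V K" if "V \<in> ?W" for V
    unfolding avoids_def
  proof
    fix y assume "y \<in> K"
    then obtain z where "z \<in> D" "y \<in> N z" using D(3) by blast
    then show "\<exists>b\<in>Basis. T b (loc V) y \<noteq> 0"
      using N(5)[of z V] that D(1) unfolding avoids_def by auto
  qed
  ultimately show "\<exists>W. openin X W \<and> V0 \<in> W \<and> W \<subseteq> {V \<in> smooth_functions A. avoids V K}"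
    using topspace_strong_topology[OF A] by (intro exI[of _ ?W]) auto
qed

text \<open>Parametric transversality without the implicit function theorem: the perturbed \<open>T\<close>
  moves at least proportionally to the parameter \<open>s\<close>, so a zero \<open>z\<close> determines \<open>s\<close> in a locally Lipschitz way and
  the bad parameters form a Lipschitz image of the negligible set \<open>Z\<close>. The estimate holds for all
  \<open>V\<close> near \<open>V0\<close>, which is what allows finitely many such perturbations to be combined.\<close>

lemma locally_dense:
  assumes V0: "V0 \<in> smooth_functions A" and z0: "z0 \<in> Z"
  shows "\<exists>N \<V>. open N \<and> z0 \<in> N \<and> openin X \<V> \<and> V0 \<in> \<V> \<and>
    (\<forall>V\<in>\<V>. \<forall>\<U>. openin X \<U> \<and> V \<in> \<U> \<longrightarrow> (\<exists>W\<in>\<U>. avoids W (N \<inter> Z)))"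
proof (cases "\<exists>b\<in>Basis. T b (loc V0) z0 \<noteq> 0")
  case True
  then obtain b where "b \<in> Basis" "T b (loc V0) z0 \<noteq> 0" by blast
  from avoids_near[OF V0 subsetD[OF Z_sub z0] this] obtain N \<V> where
    N: "open N" "z0 \<in> N" "openin X \<V>" "V0 \<in> \<V>" "\<forall>V\<in>\<V>. avoids V N"
    by (elim exE conjE) (rule that, assumption+)
  have "\<forall>V\<in>\<V>. avoids V (N \<inter> Z)" using N(5) unfolding avoids_def by simp
  then show ?thesis using N(1-4) by (intro exI[of _ N] exI[of _ \<V>]) auto
next
  case False
  have z0': "z0 \<in> U \<times> UNIV" using z0 Z_sub by blast
  obtain \<phi> K where K: "compact K" "K \<subseteq> U"
    and \<phi>: "\<And>i. i \<in> Basis \<Longrightarrow> smooth_on (\<phi> i) U" "\<And>i x. i \<in> Basis \<Longrightarrow> x \<in> U - K \<Longrightarrow> \<phi> i x = 0"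
    and inj: "\<And>s::'e \<times> 'e. (\<And>b. b \<in> Basis \<Longrightarrow> (\<Sum>i\<in>Basis. (s \<bullet> i) * T' b (loc V0) (\<phi> i) z0) = 0) \<Longrightarrow> s = 0"
  proof -
    have "\<forall>b\<in>Basis. T b (loc V0) z0 = 0" using False by simp
    from perturbation[OF smooth_loc[OF V0] z0 this] obtain \<phi> K where *: "compact K" "K \<subseteq> U"
      "\<forall>i\<in>Basis. smooth_on (\<phi> i) U \<and> (\<forall>x\<in>U - K. \<phi> i x = 0)"
      "\<forall>s::'e \<times> 'e. (\<forall>b\<in>Basis. (\<Sum>i\<in>Basis. (s \<bullet> i) * T' b (loc V0) (\<phi> i) z0) = 0) \<longrightarrow> s = 0"
      by (elim exE conjE) (rule that, assumption+)
    have "smooth_on (\<phi> i) U" "x \<in> U - K \<Longrightarrow> \<phi> i x = 0" if "i \<in> Basis" for i x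
      using bspec[OF *(3) that] by auto
    moreover have "s = 0" if "\<And>b. b \<in> Basis \<Longrightarrow> (\<Sum>i\<in>Basis. (s \<bullet> i) * T' b (loc V0) (\<phi> i) z0) = 0" for s
      by (rule mp[OF spec[OF *(4)]], rule ballI) (rule that)
    ultimately show ?thesis by (rule that[OF *(1,2)])
  qed
  define M where "M b i = T' b (loc V0) (\<phi> i) z0" for b i
  define L where "L s = (\<Sum>b\<in>Basis. (\<Sum>i\<in>Basis. (s \<bullet> i) * M b i) *\<^sub>R b)" for s :: "'e \<times> 'e"
  have L_inner: "L s \<bullet> b = (\<Sum>i\<in>Basis. (s \<bullet> i) * M b i)" if "b \<in> Basis" for s b
    using that by (simp add: L_def)
  have lin: "linear L"
    by (rule linearI) (simp_all add: L_def inner_add_left inner_simps sum.distrib scaleR_add_left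
        algebra_simps sum_distrib_left scaleR_sum_right)
  have "s = 0" if "L s = 0" for s
    by (rule inj) (use L_inner[of _ s] that in \<open>simp add: M_def\<close>)
  then have "inj L" using lin linear_injective_0 by blast
  then obtain \<kappa> where \<kappa>: "\<kappa> > 0" "\<And>s. \<kappa> * norm s \<le> norm (L s)"
    using linear_inj_bounded_below_pos[OF lin] by blast
  define D where "D = real DIM('e \<times> 'e)"
  have D: "D > 0" by (simp add: D_def)
  \<comment> \<open>The matrix has \<open>D * D\<close> entries. Errors below this
    \<open>\<epsilon>\<close> in all of them change \<open>L\<close> by at most half of its lower
    bound \<open>\<kappa>\<close>.\<close>
  define \<epsilon> where "\<epsilon> = \<kappa> / (2 * (D * D))"
  have \<epsilon>: "\<epsilon> > 0" using \<kappa> D by (simp add: \<epsilon>_def)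
  have "\<exists>N \<V>. open N \<and> z0 \<in> N \<and> N \<subseteq> U \<times> UNIV \<and> openin X \<V> \<and> V0 \<in> \<V> \<and>
      (\<forall>V\<in>\<V>. \<forall>z\<in>N. \<bar>T' b (loc V) (\<phi> i) z - M b i\<bar> < \<epsilon>)" if "b \<in> Basis" "i \<in> Basis" for b i
    using diffop_near[OF diffop_T[OF that(1)] V0 z0' \<epsilon> \<phi>(1)[OF that(2)]] unfolding M_def by blast
  then obtain N \<V> where NV: "\<And>b i. b \<in> Basis \<Longrightarrow> i \<in> Basis \<Longrightarrow> open (N b i) \<and> z0 \<in> N b i \<and>
      N b i \<subseteq> U \<times> UNIV \<and> openin X (\<V> b i) \<and> V0 \<in> \<V> b i \<and>
      (\<forall>V\<in>\<V> b i. \<forall>z\<in>N b i. \<bar>T' b (loc V) (\<phi> i) z - M b i\<bar> < \<epsilon>)"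
    by metis
  define N' where "N' = (\<Inter>b\<in>Basis. \<Inter>i\<in>Basis. N b i)"
  define \<V>' where "\<V>' = (\<Inter>b\<in>Basis. \<Inter>i\<in>Basis. \<V> b i)"
  have "open N'" "z0 \<in> N'"
    unfolding N'_def using NV by (auto intro!: open_INT)
  moreover have "N' \<subseteq> N (SOME b. b \<in> Basis) (SOME b. b \<in> Basis)"
    unfolding N'_def using SOME_Basis by blast
  ultimately have N': "open N'" "z0 \<in> N'" "N' \<subseteq> U \<times> UNIV"
    using NV[OF SOME_Basis SOME_Basis] by (simp_all, blast)
  have \<V>': "openin X \<V>'" "V0 \<in> \<V>'"
    unfolding \<V>'_def using NV by (auto intro!: openin_INT2)
  have close: "\<bar>T' b (loc V) (\<phi> i) z - M b i\<bar> < \<epsilon>"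
    if "V \<in> \<V>'" "z \<in> N'" "b \<in> Basis" "i \<in> Basis" for V z b i
  proof -
    have "V \<in> \<V> b i" "z \<in> N b i" using that by (simp_all add: N'_def \<V>'_def)
    then show ?thesis using NV[OF that(3,4)] by simp
  qed
  have "\<exists>W\<in>\<U>. avoids W (N' \<inter> Z)" if V: "V \<in> \<V>'" and \<U>: "openin X \<U>" "V \<in> \<U>" for V \<U>
  proof -
    have VA: "V \<in> smooth_functions A" using \<U> openin_smooth by blast
    define \<Phi> where "\<Phi> i = chart_extension c (\<phi> i)" for i
    have \<Phi>: "\<Phi> i \<in> smooth_functions A" if "i \<in> Basis" for i
      unfolding \<Phi>_def by (rule chart_extension_smooth[OF A c \<phi>(1)[OF that] K]) (rule \<phi>(2)[OF that])
    have \<Phi>0: "\<Phi> i p = 0" if "i \<in> Basis" "p \<notin> chart_inv c ` K" for i p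
    proof (cases "p \<in> chart_dom c")
      case True
      then have "chart_map c p \<notin> K"
        using that(2) chart_facts(5)[OF A c True] by (metis image_eqI)
      then show ?thesis using \<phi>(2)[OF that(1)] True by (simp add: \<Phi>_def chart_extension_def)
    qed (simp add: \<Phi>_def chart_extension_def)
    define P where "P s p = V p + (\<Sum>i\<in>Basis. (s \<bullet> i) * \<Phi> i p)" for s p
    have PA: "P s \<in> smooth_functions A" for s
      using smooth_functions_add_sum[OF A VA \<Phi>, where s = "\<lambda>i. s \<bullet> i" and I = Basis]
      unfolding P_def by simp
    have Ploc: "loc (P s) x = loc V x + (\<Sum>i\<in>Basis. (s \<bullet> i) * \<phi> i x)" if "x \<in> U" for s x
      using that chart_facts(6,7)[OF A c that] by (simp add: P_def \<Phi>_def chart_extension_def)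
    have "compact (chart_inv c ` K)"
      by (intro compact_continuous_image K continuous_on_subset[OF chart_facts(4)[OF A c]])
    from continuous_map_perturbation[where \<phi> = \<Phi>, OF A VA \<Phi> this \<Phi>0]
    have "continuous_map euclidean X P" unfolding P_def .
    moreover have "openin X (\<V>' \<inter> \<U>)" using \<V>' \<U> by blast
    ultimately have "open (P -` (\<V>' \<inter> \<U>))"
      using openin_continuous_map_preimage[of euclidean X P "\<V>' \<inter> \<U>"]
      by (simp only: vimage_def topspace_euclidean open_openin) simp
    moreover have "P 0 = V" by (rule ext) (simp add: P_def)
    then have "0 \<in> P -` (\<V>' \<inter> \<U>)" using V \<U> by simp
    ultimately obtain \<tau> where \<tau>: "\<tau> > 0" "ball 0 \<tau> \<subseteq> P -` (\<V>' \<inter> \<U>)"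
      using open_contains_ball by metis
    define R where "R s z = (\<Sum>b\<in>Basis. T b (loc (P s)) z *\<^sub>R b)" for s z
    have R_inner: "R s z \<bullet> b = T b (loc (P s)) z" if "b \<in> Basis" for s z b
      using that by (simp add: R_def)
    have lower: "\<kappa> / 2 * norm (s - s') \<le> norm (R s z - R s' z)"
      if s: "s \<in> ball 0 \<tau>" and s': "s' \<in> ball 0 \<tau>" and zN: "z \<in> N'" for s s' z
    proof -
      define \<psi> where "\<psi> x = (\<Sum>i\<in>Basis. ((s - s') \<bullet> i) * \<phi> i x)" for x
      have \<psi>: "smooth_on \<psi> U"
        unfolding \<psi>_def by (intro smooth_on_sum smooth_on_mult U \<phi> smooth_on_const)
      have z: "z \<in> U \<times> UNIV" using zN N'(3) by blast
      have comp: "\<bar>(R s z - R s' z - L (s - s')) \<bullet> b\<bar> \<le> D * \<epsilon> * norm (s - s')" if b: "b \<in> Basis" for b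
      proof -
        have dT: "diffop U (T b) (T' b)" by (rule diffop_T[OF b])
        let ?g = "\<lambda>\<theta>. T b (\<lambda>x. loc (P s') x + \<theta> * \<psi> x) z"
        have "(?g has_real_derivative T' b (\<lambda>x. loc (P s') x + \<theta> * \<psi> x) \<psi> z) (at \<theta>)" for \<theta>
          by (rule diffop_has_real_derivative[OF U dT smooth_loc[OF PA] \<psi> z])
        \<comment> \<open>The intermediate point depends on the component \<open>b\<close>. This is
          harmless, because \<open>close\<close> holds on the whole segment from \<open>s'\<close>
          to \<open>s\<close>, which stays in the ball by convexity.\<close>
        then obtain \<theta> where \<theta>: "0 < \<theta>" "\<theta> < 1"
          "?g 1 - ?g 0 = T' b (\<lambda>x. loc (P s') x + \<theta> * \<psi> x) \<psi> z"
          using MVT2[of 0 1 ?g "\<lambda>\<theta>. T' b (\<lambda>x. loc (P s') x + \<theta> * \<psi> x) \<psi> z"] by auto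
        let ?s = "s' + \<theta> *\<^sub>R (s - s')"
        have shift: "loc (P s') x + t * \<psi> x = loc (P (s' + t *\<^sub>R (s - s'))) x" if "x \<in> U" for x t
          using that by (simp add: Ploc \<psi>_def inner_add_left inner_diff_left sum.distrib sum_subtractf
              sum_distrib_left algebra_simps)
        have sm: "smooth_on (\<lambda>x. loc (P s') x + t * \<psi> x) U" for t
          by (intro smooth_on_add smooth_on_mult U smooth_loc PA \<psi> smooth_on_const)
        have loc1: "T b (\<lambda>x. loc (P s') x + t * \<psi> x) z = T b (loc (P (s' + t *\<^sub>R (s - s')))) z"
          and loc2: "T' b (\<lambda>x. loc (P s') x + t * \<psi> x) \<psi> z = T' b (loc (P (s' + t *\<^sub>R (s - s')))) \<psi> z" for t
          using diffop_local[OF U dT sm smooth_loc[OF PA] shift z, of t \<psi>] \<psi> by blast+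
        have "?s \<in> ball 0 \<tau>"
          using convexD[OF convex_ball s' s, of "1 - \<theta>" \<theta>] \<theta> by (simp add: algebra_simps)
        then have mem: "P ?s \<in> \<V>'" using \<tau> by blast
        have "(R s z - R s' z) \<bullet> b = ?g 1 - ?g 0"
          unfolding loc1 by (simp add: inner_diff_left R_inner[OF b])
        also have "\<dots> = T' b (loc (P ?s)) \<psi> z" unfolding \<theta>(3) loc2 ..
        also have "\<dots> = (\<Sum>i\<in>Basis. ((s - s') \<bullet> i) * T' b (loc (P ?s)) (\<phi> i) z)"
          unfolding \<psi>_def
          by (rule diffop_linearisation_sum[OF U dT smooth_loc[OF PA] _ _ z]) (use \<phi> in auto)
        finally have "(R s z - R s' z - L (s - s')) \<bullet> b =
            (\<Sum>i\<in>Basis. ((s - s') \<bullet> i) * (T' b (loc (P ?s)) (\<phi> i) z - M b i))"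
          by (simp add: inner_diff_left[of _ "L (s - s')"] L_inner[OF b] right_diff_distrib sum_subtractf)
        also have "\<bar>\<dots>\<bar> \<le> (\<Sum>i\<in>(Basis::('e \<times> 'e) set). norm (s - s') * \<epsilon>)"
          by (rule order_trans[OF sum_abs], rule sum_mono)
            (auto simp: abs_mult intro!: mult_mono Basis_le_norm less_imp_le[OF close[OF mem zN b]])
        finally show ?thesis by (simp add: D_def mult_ac)
      qed
      have "norm (R s z - R s' z - L (s - s')) \<le>
          (\<Sum>b\<in>Basis. \<bar>(R s z - R s' z - L (s - s')) \<bullet> b\<bar>)" by (rule norm_le_l1)
      also have "\<dots> \<le> (\<Sum>b\<in>(Basis::('e \<times> 'e) set). D * \<epsilon> * norm (s - s'))" by (rule sum_mono) (rule comp)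
      also have "\<dots> = \<kappa> / 2 * norm (s - s')" 
        using D unfolding sum_constant D_def[symmetric] \<epsilon>_def by (simp add: field_simps)
      finally have "norm (R s z - R s' z - L (s - s')) \<le> \<kappa> / 2 * norm (s - s')" .
      moreover have "norm (L (s - s')) \<le> norm (R s z - R s' z) + norm (R s z - R s' z - L (s - s'))"
        by (metis add.commute norm_minus_commute norm_triangle_sub)
      ultimately show ?thesis using \<kappa>(2)[of "s - s'"] by linarith
    qed
    define Y where "Y = {z \<in> N' \<inter> Z. \<exists>s\<in>ball 0 \<tau>. R s z = 0}"
    \<comment> \<open>By \<open>lower\<close> the map \<open>R\<close> is injective in
      \<open>s\<close>, so this is the only parameter for which \<open>z\<close> is a common
      zero.\<close>
    define \<sigma> where "\<sigma> z = (SOME s. s \<in> ball 0 \<tau> \<and> R s z = 0)" for z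
    have \<sigma>: "\<sigma> z \<in> ball 0 \<tau>" "R (\<sigma> z) z = 0" if "z \<in> Y" for z
      using that someI_ex[of "\<lambda>s. s \<in> ball 0 \<tau> \<and> R s z = 0"] unfolding Y_def \<sigma>_def by blast+
    have "negligible (\<sigma> ` Y)"
    proof (rule negligible_locally_Lipschitz_image)
      show "negligible Y" by (rule negligible_subset[OF Z_negligible]) (auto simp: Y_def)
      fix z assume z: "z \<in> Y"
      let ?f = "R (\<sigma> z)"
      have "z \<in> U \<times> UNIV" using z Z_sub by (auto simp: Y_def)
      then have "?f differentiable at z"
        unfolding R_def[abs_def]
        by (intro differentiable_sum finite_Basis ballI differentiable_scaleR differentiable_const
            diffop_differentiable(1)[OF U diffop_T smooth_loc[OF PA]])
      then obtain f' where f': "(?f has_derivative f') (at z)" unfolding differentiable_def by blast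
      then obtain B where B: "\<And>h. norm (f' h) \<le> B * norm h"
        using has_derivative_bounded_linear bounded_linear.bounded by (metis mult.commute)
      obtain d where d: "d > 0" "\<And>y. norm (y - z) < d \<Longrightarrow> norm (?f y - ?f z - f' (y - z)) \<le> 1 * norm (y - z)"
        using f' unfolding has_derivative_at_alt by (metis zero_less_one)
      \<comment> \<open>With the parameter \<open>\<sigma> z\<close> frozen, \<open>R\<close>
        vanishes at \<open>z\<close> and grows at most like \<open>(B + 1) * norm (y - z)\<close>,
        where 1 is the tolerance in the definition of the derivative. With the parameter
        \<open>\<sigma> y\<close> it vanishes at \<open>y\<close>. Comparing both at
        \<open>y\<close> and applying \<open>lower\<close> bounds the distance of the
        parameters.\<close>
      have "norm (\<sigma> y - \<sigma> z) \<le> (2 / \<kappa> * (B + 1)) * norm (y - z)" if y: "y \<in> Y \<inter> ball z d" for y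
      proof -
        have "norm (?f y) \<le> norm (?f y - ?f z - f' (y - z)) + norm (f' (y - z))"
          using norm_triangle_ineq[of "?f y - ?f z - f' (y - z)" "f' (y - z)"] \<sigma>(2)[OF z] by simp
        also have "\<dots> \<le> (B + 1) * norm (y - z)"
          using d(2)[of y] B[of "y - z"] y by (simp add: dist_norm norm_minus_commute algebra_simps)
        finally have "norm (R (\<sigma> y) y - R (\<sigma> z) y) \<le> (B + 1) * norm (y - z)"
          using \<sigma>(2)[of y] y by simp
        moreover have "y \<in> N'" using y by (simp add: Y_def)
        then have "\<kappa> / 2 * norm (\<sigma> y - \<sigma> z) \<le> norm (R (\<sigma> y) y - R (\<sigma> z) y)"
          using lower \<sigma>(1) y z by blast
        ultimately have "\<kappa> / 2 * norm (\<sigma> y - \<sigma> z) \<le> (B + 1) * norm (y - z)" by linarith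
        then show ?thesis using \<kappa>(1) by (simp add: field_simps)
      qed
      then show "\<exists>T B. open T \<and> z \<in> T \<and> (\<forall>y\<in>Y \<inter> T. norm (\<sigma> y - \<sigma> z) \<le> B * norm (y - z))"
        using d(1) by (intro exI[of _ "ball z d"] exI[of _ "2 / \<kappa> * (B + 1)"] conjI ballI) simp_all
    qed simp
    then have "\<not> ball 0 \<tau> \<subseteq> \<sigma> ` Y"
      using open_not_negligible[of "ball (0::'e \<times> 'e) \<tau>"] negligible_subset \<tau>(1) by auto
    then obtain s where s: "s \<in> ball 0 \<tau>" "s \<notin> \<sigma> ` Y" by blast
    have "avoids (P s) (N' \<inter> Z)"
      unfolding avoids_def
    proof (intro ballI, rule ccontr)
      fix z assume z: "z \<in> N' \<inter> Z" and "\<not> (\<exists>b\<in>Basis. T b (loc (P s)) z \<noteq> 0)"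
      then have R0: "R s z = 0" by (simp add: R_def)
      then have zY: "z \<in> Y" using z s(1) by (auto simp: Y_def)
      have "\<kappa> / 2 * norm (s - \<sigma> z) \<le> norm (R s z - R (\<sigma> z) z)"
        using lower s(1) \<sigma>(1)[OF zY] z by blast
      then have "s = \<sigma> z" using R0 \<sigma>(2)[OF zY] \<kappa>(1) by (simp add: mult_le_0_iff)
      then show False using s(2) zY by blast
    qed
    moreover have "P s \<in> \<U>" using s(1) \<tau>(2) by blast
    ultimately show ?thesis by blast
  qed
  then show ?thesis using N' \<V>' by blast
qed

text \<open>A local perturbation serves one neighbourhood, and a later one may spoil it. Avoidance
  on compact sets is open, though, so later perturbations can be kept small enough to preserve it.
  Intersecting closed balls with \<open>K\<close> keeps the pieces compact.\<close>

lemma avoids_dense: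
  assumes K: "compact K" "K \<subseteq> Z" and \<U>: "openin X \<U>" "\<U> \<noteq> {}"
  shows "\<exists>V\<in>\<U>. avoids V K"
proof -
  obtain V0 where V0: "V0 \<in> \<U>" "V0 \<in> smooth_functions A" using \<U> openin_smooth by blast
  have "\<exists>\<rho> \<V>. \<rho> > 0 \<and> openin X \<V> \<and> V0 \<in> \<V> \<and>
    (\<forall>V\<in>\<V>. \<forall>\<U>. openin X \<U> \<and> V \<in> \<U> \<longrightarrow> (\<exists>W\<in>\<U>. avoids W (cball z \<rho> \<inter> K)))" if z: "z \<in> K" for z
  proof -
    obtain N \<V> where N: "open N" "z \<in> N" "openin X \<V>" "V0 \<in> \<V>"
      and *: "\<forall>V\<in>\<V>. \<forall>\<U>. openin X \<U> \<and> V \<in> \<U> \<longrightarrow> (\<exists>W\<in>\<U>. avoids W (N \<inter> Z))"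
      using locally_dense[OF V0(2) subsetD[OF K(2) z]] by (elim exE conjE) (rule that, assumption+)
    obtain \<rho> where \<rho>: "\<rho> > 0" "cball z \<rho> \<subseteq> N" using N(1,2) open_contains_cball by blast
    have "avoids W (cball z \<rho> \<inter> K)" if "avoids W (N \<inter> Z)" for W
      using that \<rho>(2) K(2) unfolding avoids_def by auto
    then show ?thesis using \<rho>(1) N(3,4) * by (intro exI[of _ \<rho>] exI[of _ \<V>]) blast
  qed
  then obtain \<rho> \<V> where \<rho>: "\<And>z. z \<in> K \<Longrightarrow> \<rho> z > 0"
    and \<V>: "\<And>z. z \<in> K \<Longrightarrow> openin X (\<V> z)" "\<And>z. z \<in> K \<Longrightarrow> V0 \<in> \<V> z"
    and dense: "\<And>z V \<U>. z \<in> K \<Longrightarrow> V \<in> \<V> z \<Longrightarrow> openin X \<U> \<Longrightarrow> V \<in> \<U> \<Longrightarrow>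
      \<exists>W\<in>\<U>. avoids W (cball z (\<rho> z) \<inter> K)"
    by metis
  obtain D where D: "D \<subseteq> K" "finite D" "K \<subseteq> (\<Union>z\<in>D. ball z (\<rho> z))"
    by (rule compactE_image[OF K(1), of K "\<lambda>z. ball z (\<rho> z)"]) (use \<rho> in auto)
  have step: "\<exists>V\<in>\<W>. \<forall>z\<in>D. avoids V (cball z (\<rho> z) \<inter> K)"
    if "openin X \<W>" "\<W> \<noteq> {}" "\<And>z. z \<in> D \<Longrightarrow> \<W> \<subseteq> \<V> z" for \<W>
    using D(2,1) that
  proof (induction D arbitrary: \<W>)
    case (insert z D)
    \<comment> \<open>The success at \<open>z\<close> is recorded as an open set, inside which the
      perturbations for the remaining centres are chosen.\<close>
    define G where "G = {V \<in> smooth_functions A. avoids V (cball z (\<rho> z) \<inter> K)}"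
    have G: "openin X G"
      unfolding G_def using K Z_sub by (intro openin_avoids compact_Int_closed closed_Int_compact) auto
    obtain V where "V \<in> \<W>" "V \<in> \<V> z" using insert.prems by blast
    then obtain W where "W \<in> \<W>" "avoids W (cball z (\<rho> z) \<inter> K)"
      using dense[of z V \<W>] insert.prems by blast
    then have "W \<in> \<W> \<inter> G" using openin_smooth[OF insert.prems(2)] by (simp add: G_def)
    then obtain W' where W': "W' \<in> \<W> \<inter> G" "\<forall>z\<in>D. avoids W' (cball z (\<rho> z) \<inter> K)"
      using insert.IH[of "\<W> \<inter> G"] insert.prems openin_Int[OF _ G] by blast
    moreover have "avoids W' (cball z (\<rho> z) \<inter> K)" using W'(1) by (simp add: G_def)
    ultimately show ?case by (intro bexI[of _ W']) auto
  qed auto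
  define \<W> where "\<W> = \<U> \<inter> (\<Inter>z\<in>D. \<V> z)"
  have "openin X \<W>"
    unfolding \<W>_def using D(2,1)
  proof (induction D)
    case (insert z D)
    then have "openin X (\<U> \<inter> (\<Inter>z\<in>D. \<V> z))" "openin X (\<V> z)" using \<V>(1) by auto
    then have "openin X ((\<U> \<inter> (\<Inter>z\<in>D. \<V> z)) \<inter> \<V> z)" by (rule openin_Int)
    then show ?case by (simp add: Int_ac)
  qed (simp add: \<U>)
  moreover have "V0 \<in> \<W>" unfolding \<W>_def using V0(1) \<V>(2) D(1) by auto
  ultimately obtain V where V: "V \<in> \<W>" "\<forall>z\<in>D. avoids V (cball z (\<rho> z) \<inter> K)"
    using step[of \<W>] unfolding \<W>_def by blast
  have "avoids V K"
    unfolding avoids_def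
  proof
    fix y assume y: "y \<in> K"
    then obtain z where "z \<in> D" "y \<in> ball z (\<rho> z)" using D(3) by blast
    then show "\<exists>b\<in>Basis. T b (loc V) y \<noteq> 0" using V(2) y unfolding avoids_def by simp
  qed
  then show ?thesis using V(1) by (auto simp: \<W>_def)
qed

text \<open>Openness is available for compact sets, so each compact piece of \<open>Z\<close>
  contributes one open dense set.\<close>

theorem residual_avoids:
  fixes K :: "nat \<Rightarrow> ('e \<times> 'e) set"
  assumes "\<And>n. compact (K n)" "Z = (\<Union>n. K n)"
  shows "residual_in X {V \<in> smooth_functions A. avoids V Z}"
proof -
  define \<U> where "\<U> = range (\<lambda>n. {V \<in> smooth_functions A. avoids V (K n)})"
  have "openin X G \<and> X closure_of G = topspace X" if G: "G \<in> \<U>" for G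
  proof -
    obtain n where n: "G = {V \<in> smooth_functions A. avoids V (K n)}" using G unfolding \<U>_def by (rule rangeE)
    have sub: "K n \<subseteq> Z" using assms(2) by blast
    have "G \<inter> \<V> \<noteq> {}" if \<V>: "openin X \<V>" "\<V> \<noteq> {}" for \<V>
    proof -
      obtain V where "V \<in> \<V>" "avoids V (K n)" using avoids_dense[OF assms(1) sub \<V>] by (rule bexE)
      then have "V \<in> G \<inter> \<V>" using openin_smooth[OF \<V>(1)] by (simp add: n)
      then show ?thesis by blast
    qed
    then show ?thesis
      unfolding dense_intersects_open using openin_avoids[OF assms(1)] sub Z_sub n by auto
  qed
  moreover have "topspace X \<inter> \<Inter>\<U> \<subseteq> {V \<in> smooth_functions A. avoids V Z}"
    unfolding \<U>_def avoids_def assms(2) by auto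
  moreover have "countable \<U>" by (simp add: \<U>_def)
  ultimately show ?thesis
    unfolding residual_in_def topspace_strong_topology[OF A] by (intro conjI exI[of _ \<U>]) auto
qed

end

text \<open>The factor \<open>topspace X\<close> keeps the result inside the space when
  \<open>I\<close> is empty.\<close>

lemma residual_in_INT:
  assumes "countable I" "\<And>i. i \<in> I \<Longrightarrow> residual_in X (C i)"
  shows "residual_in X (topspace X \<inter> (\<Inter>i\<in>I. C i))"
proof -
  obtain \<U> where \<U>: "\<And>i. i \<in> I \<Longrightarrow> countable (\<U> i)"
    "\<And>i U. i \<in> I \<Longrightarrow> U \<in> \<U> i \<Longrightarrow> openin X U \<and> X closure_of U = topspace X"
    "\<And>i. i \<in> I \<Longrightarrow> topspace X \<inter> \<Inter>(\<U> i) \<subseteq> C i"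
    using assms(2) unfolding residual_in_def by metis
  have "topspace X \<inter> \<Inter>(\<Union>i\<in>I. \<U> i) \<subseteq> C i" if "i \<in> I" for i
    using \<U>(3)[OF that] that by blast
  then show ?thesis
    unfolding residual_in_def using \<U>(1,2) assms(1)
    by (intro conjI exI[of _ "\<Union>i\<in>I. \<U> i"]) auto
qed


section \<open>A smooth bump function\<close>

text \<open>The powers of \<open>1 / t\<close> make this family closed under differentiation.\<close>

definition flat_exp :: "nat \<Rightarrow> real \<Rightarrow> real" where
  "flat_exp n t = (if t > 0 then inverse t ^ n / exp (inverse t) else 0)"

lemma flat_exp_tendsto_0: "(flat_exp n \<longlongrightarrow> 0) (at 0)"
proof (rule filterlim_split_at)
  have "((\<lambda>t. inverse t ^ n / exp (inverse t)) \<longlongrightarrow> (0::real)) (at_right 0)"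
    by (rule filterlim_compose[OF tendsto_power_div_exp_0 filterlim_inverse_at_top_right])
  then show "(flat_exp n \<longlongrightarrow> 0) (at_right 0)"
    by (rule Lim_transform_eventually) (auto simp: flat_exp_def eventually_at_filter)
  have "((\<lambda>t. 0) \<longlongrightarrow> (0::real)) (at_left 0)" by simp
  then show "(flat_exp n \<longlongrightarrow> 0) (at_left 0)"
    by (rule Lim_transform_eventually) (auto simp: flat_exp_def eventually_at_filter)
qed

lemma flat_exp_has_derivative:
  "(flat_exp n has_real_derivative flat_exp (n + 2) t - n * flat_exp (n + 1) t) (at t)"
proof -
  consider "t > 0" | "t < 0" | "t = 0" by linarith
  then show ?thesis
  proof cases
    case 1
    have "((\<lambda>t. inverse t ^ n * exp (- inverse t)) has_real_derivative
        flat_exp (n + 2) t - n * flat_exp (n + 1) t) (at t)"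
    proof -
      have pow: "((\<lambda>t. inverse t ^ n) has_real_derivative - (n * inverse t ^ (n + 1))) (at t)"
        using DERIV_power[OF DERIV_inverse[of t UNIV], of n] 1 by (cases n) (simp_all add: mult.assoc)
      have "((\<lambda>t. exp (- inverse t)) has_real_derivative exp (- inverse t) * inverse t ^ 2) (at t)"
        using 1 by (auto intro!: derivative_eq_intros simp: power2_eq_square)
      from DERIV_mult[OF pow this] show ?thesis
        using 1 by (simp add: flat_exp_def exp_minus divide_inverse power_add power2_eq_square algebra_simps)
    qed
    moreover have "inverse y ^ n * exp (- inverse y) = flat_exp n y" if "y \<in> {0<..}" for y
      using that by (simp add: flat_exp_def exp_minus field_simps)
    ultimately show ?thesis
      using 1 has_field_derivative_transform_within_open[of _ _ t "{0<..}" "flat_exp n"] by auto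
  next
    case 2
    have "((\<lambda>t. 0) has_real_derivative flat_exp (n + 2) t - n * flat_exp (n + 1) t) (at t)"
      using 2 by (simp add: flat_exp_def)
    then show ?thesis
      by (rule has_field_derivative_transform_within_open[of _ _ t "{..<0}"])
        (use 2 in \<open>auto simp: flat_exp_def\<close>)
  next
    case 3
    \<comment> \<open>Division by \<open>h\<close> raises the power of \<open>1 / h\<close>, so the
      difference quotient at 0 is \<open>flat_exp (n + 1)\<close>, which tends to 0.\<close>
    have "((\<lambda>h. flat_exp n h / h) \<longlongrightarrow> 0) (at 0)"
      by (rule Lim_transform_eventually[OF flat_exp_tendsto_0[of "n + 1"]])
        (auto simp: flat_exp_def eventually_at_filter field_simps)
    then show ?thesis using 3 by (simp add: DERIV_def flat_exp_def)
  qed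
qed

lemma smooth_on_flat_exp: "smooth_on (flat_exp n) UNIV"
proof -
  have "Ck_on k (flat_exp n) UNIV" for k
  proof (induction k arbitrary: n)
    case 0
    then show ?case
      using DERIV_isCont[OF flat_exp_has_derivative] by (simp add: Ck_on_0 continuous_at_imp_continuous_on)
  next
    case (Suc k)
    have "fd (flat_exp n) x = (\<lambda>h. h * (flat_exp (n + 2) x - n * flat_exp (n + 1) x))" for x
      using flat_exp_has_derivative[of n x]
      by (intro fd_eqI) (simp add: has_field_derivative_def mult_commute_abs)
    moreover have "Ck_on k (\<lambda>x. flat_exp (n + 2) x + (- real n) * flat_exp (n + 1) x) UNIV"
      by (intro Ck_on_add Suc open_UNIV Ck_on_bilinear[OF bounded_bilinear_mult] Ck_on_const)
    moreover have "flat_exp n differentiable at x" for x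
      using flat_exp_has_derivative[of n x] by (auto simp: has_field_derivative_def differentiable_def)
    ultimately show ?case by (simp add: Ck_on_Suc)
  qed
  then show ?thesis by (simp add: smooth_on_def)
qed

lemma smooth_bump_exists:
  fixes x0 :: "'e::euclidean_space"
  assumes "open U" "x0 \<in> U"
  shows "\<exists>\<beta> K. smooth_on \<beta> UNIV \<and> compact K \<and> K \<subseteq> U \<and> (\<forall>x. x \<notin> K \<longrightarrow> \<beta> x = (0::real)) \<and> \<beta> x0 > 0"
proof -
  obtain r where r: "r > 0" "cball x0 r \<subseteq> U" using assms open_contains_cball by blast
  \<comment> \<open>Squared radius minus squared distance: the square keeps the argument smooth at
    the centre, and it is positive exactly inside the ball.\<close>
  define \<beta> where "\<beta> x = flat_exp 0 (r\<^sup>2 - (x - x0) \<bullet> (x - x0))" for x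
  have "smooth_on \<beta> UNIV"
    unfolding \<beta>_def
    by (rule smooth_on_compose[OF open_UNIV open_UNIV _ smooth_on_flat_exp])
      (auto intro!: smooth_on_diff smooth_on_inner smooth_on_id)
  moreover have "\<beta> x = 0" if "x \<notin> cball x0 r" for x
  proof -
    have "r < norm (x - x0)" using that by (simp add: dist_norm norm_minus_commute)
    then have "r\<^sup>2 < (norm (x - x0))\<^sup>2" using r(1) by (intro power_strict_mono) auto
    then show ?thesis by (simp add: \<beta>_def flat_exp_def power2_norm_eq_inner)
  qed
  moreover have "\<beta> x0 > 0" using r by (simp add: \<beta>_def flat_exp_def)
  ultimately show ?thesis using r(2) compact_cball by blast
qed

section \<open>Generic functions have isolated critical points\<close>

text \<open>Supplies the compact pieces for \<open>residual_avoids\<close>: an open set is a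
  countable union of compact sets, and the zeros in each of them form a closed subset.\<close>

lemma sigma_compact_zeros:
  fixes f :: "'a::euclidean_space \<Rightarrow> real"
  assumes "open W" "continuous_on W f"
  shows "\<exists>K::nat \<Rightarrow> 'a set. (\<forall>n. compact (K n)) \<and> {z\<in>W. f z = 0} = (\<Union>n. K n)"
proof -
  obtain C where C: "\<And>n::nat. compact (C n)" "\<And>n. C n \<subseteq> W" "\<Union>(range C) = W"
    using open_Union_compact_subsets[OF assms(1)] by metis
  have "compact {z\<in>C n. f z = 0}" for n
  proof -
    have "closed {z\<in>C n. f z = 0}"
      using continuous_closed_preimage_constant[OF continuous_on_subset[OF assms(2) C(2)]
          compact_imp_closed[OF C(1)]] .
    then have "compact (C n \<inter> {z\<in>C n. f z = 0})" by (intro compact_Int_closed C)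
    then show ?thesis by (simp add: Int_def conj_ac)
  qed
  moreover have "{z\<in>W. f z = 0} = (\<Union>n. {z\<in>C n. f z = 0})" using C(3) by auto
  ultimately show ?thesis by (intro exI[of _ "\<lambda>n. {z\<in>C n. f z = 0}"] conjI allI)
qed

lemma residual_in_mono: "residual_in X C \<Longrightarrow> C \<subseteq> D \<Longrightarrow> D \<subseteq> topspace X \<Longrightarrow> residual_in X D"
  unfolding residual_in_def by (elim conjE exE) (intro conjI exI, assumption+, rule order_trans)

text \<open>Indexed by \<open>b = (i, 0)\<close> for the gradient at \<open>x\<close> and \<open>b = (0, i)\<close> for the Hessian at \<open>x\<close>
  applied to \<open>v\<close>, where \<open>z = (x, v)\<close>.\<close>

definition gradient_hessian :: "'e \<times> 'e \<Rightarrow> ('e::euclidean_space \<Rightarrow> real) \<Rightarrow> 'e \<times> 'e \<Rightarrow> real" where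
  "gradient_hessian b V z =
    (if snd b = 0 then partials [fst b] V (fst z)
     else \<Sum>j\<in>Basis. (snd z \<bullet> j) * partials [j, snd b] V (fst z))"

text \<open>The operator is linear in \<open>V\<close>, hence its own linearisation. The component
  of \<open>snd z\<close> is a coefficient with derivative 0.\<close>

lemma diffop_gradient_hessian:
  fixes U :: "'e::euclidean_space set"
  assumes "open U" "b \<in> Basis"
  shows "diffop U (gradient_hessian b) (\<lambda>V. gradient_hessian b)"
proof (cases "snd b = 0")
  case True
  then have "fst b \<in> Basis" using assms(2) by (auto simp: Basis_prod_def)
  then show ?thesis
    using diffop.jet[of "[fst b]" U] True by (simp add: gradient_hessian_def[abs_def])
next
  case False
  then have b: "snd b \<in> Basis" using assms(2) by (auto simp: Basis_prod_def)
  have "diffop U (\<lambda>V z. (snd z \<bullet> j) * partials [j, snd b] V (fst z))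
     (\<lambda>V \<psi> z. (snd z \<bullet> j) * partials [j, snd b] \<psi> (fst z) + 0 * partials [j, snd b] V (fst z))"
    if "j \<in> Basis" for j
    by (intro diffop.mult diffop.const diffop.jet smooth_on_inner open_tangent assms smooth_on_const
        smooth_on_linear bounded_linear_snd) (use b that in auto)
  from diffop_sum[OF assms(1) this] show ?thesis
    using False by (simp add: gradient_hessian_def[abs_def])
qed

context smooth_chart
begin

lemma residual_nondegenerate_normalised:
  fixes e :: 'e
  assumes e: "e \<in> Basis"
  shows "residual_in X {V \<in> smooth_functions A. \<forall>z \<in> {z \<in> U \<times> UNIV. snd z \<bullet> e - 1 = 0}.
    \<exists>b\<in>Basis. gradient_hessian b (loc V) z \<noteq> 0}"
proof -
  define Z where "Z = {z \<in> U \<times> UNIV. snd z \<bullet> e - 1 = 0}"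
  interpret avoidance A c gradient_hessian "\<lambda>b V. gradient_hessian b" Z
  proof
    show "diffop U (gradient_hessian b) (\<lambda>V. gradient_hessian b)" if "b \<in> Basis" for b
      by (rule diffop_gradient_hessian[OF U that])
    show "Z \<subseteq> U \<times> UNIV" by (auto simp: Z_def)
    have "negligible {z. (0, e) \<bullet> z = 1}" by (rule negligible_hyperplane) simp
    then show "negligible Z"
      by (rule negligible_subset) (auto simp: Z_def inner_prod_def inner_commute)
    fix V :: "'e \<Rightarrow> real" and z :: "'e \<times> 'e"
    assume "z \<in> Z"
    then obtain x v where z: "z = (x, v)" and x: "x \<in> U" and v: "v \<bullet> e = 1" by (auto simp: Z_def)
    obtain \<beta> K where \<beta>: "smooth_on \<beta> UNIV" "\<And>y. y \<notin> K \<Longrightarrow> \<beta> y = (0::real)" "\<beta> x > 0"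
      and K: "compact K" "K \<subseteq> U"
      using smooth_bump_exists[OF U x] by blast
    \<comment> \<open>For \<open>s = (p, q)\<close> the linear part moves the gradient at
      \<open>x\<close> by a multiple of \<open>p\<close>. The quadratic part has a Hessian
      proportional to \<open>q e^T + e q^T\<close>, which sends \<open>v\<close> to
      \<open>q + (q \<bullet> v) e\<close> because \<open>v \<bullet> e = 1\<close>; this is
      injective in \<open>q\<close>.\<close>
    define \<phi> where "\<phi> s y = \<beta> y * (fst s \<bullet> (y - x) + (snd s \<bullet> (y - x)) * (e \<bullet> (y - x)))"
      for s :: "'e \<times> 'e" and y
    have \<phi>: "smooth_on (\<phi> s) U" for s
      unfolding \<phi>_def[abs_def]
      by (intro smooth_on_mult smooth_on_add smooth_on_inner smooth_on_diff smooth_on_const smooth_on_id U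
          smooth_on_subset[OF \<beta>(1)]) auto
    have inj: "s = 0" if *: "\<And>b. b \<in> Basis \<Longrightarrow> gradient_hessian b (\<phi> s) z = 0" for s
    proof -
      obtain p q where s: "s = (p, q)" by (cases s)
      have d\<beta>: "\<beta> differentiable at y" for y using \<beta>(1) smooth_on_differentiable by blast
      have fd\<phi>: "fd (\<phi> s) y h = \<beta> y * (p \<bullet> h + ((q \<bullet> (y - x)) * (e \<bullet> h) + (q \<bullet> h) * (e \<bullet> (y - x))))
          + fd \<beta> y h * (p \<bullet> (y - x) + (q \<bullet> (y - x)) * (e \<bullet> (y - x)))" for y h
      proof -
        have "(\<phi> s has_derivative (\<lambda>h. \<beta> y * (p \<bullet> h + ((q \<bullet> (y - x)) * (e \<bullet> h) + (q \<bullet> h) * (e \<bullet> (y - x))))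
          + fd \<beta> y h * (p \<bullet> (y - x) + (q \<bullet> (y - x)) * (e \<bullet> (y - x))))) (at y)"
          unfolding \<phi>_def[abs_def] s
          by (auto intro!: derivative_eq_intros has_derivative_fd[OF d\<beta>])
        from fd_eqI[OF this] show ?thesis by simp
      qed
      have "p \<bullet> i = 0" if "i \<in> Basis" for i
        using *[of "(i, 0)"] that \<beta>(3) by (simp add: gradient_hessian_def z fd\<phi> Basis_prod_def)
      then have p: "p = 0" by (simp add: euclidean_eq_iff[of p])
      have hess: "(q \<bullet> i) + (q \<bullet> v) * (e \<bullet> i) = 0" if i: "i \<in> Basis" for i
      proof -
        let ?g = "\<lambda>y. fd (\<phi> s) y i"
        have "(\<lambda>y. fd \<beta> y i) differentiable at x"
          using smooth_on_fd_Basis[OF open_UNIV \<beta>(1) i] smooth_on_differentiable by blast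
        then obtain \<gamma> where \<gamma>: "((\<lambda>y. fd \<beta> y i) has_derivative \<gamma>) (at x)"
          unfolding differentiable_def by blast
        have g: "(?g has_derivative (\<lambda>h. \<beta> x * ((q \<bullet> h) * (e \<bullet> i) + (q \<bullet> i) * (e \<bullet> h)))) (at x)"
          unfolding fd\<phi> p by (auto intro!: derivative_eq_intros has_derivative_fd[OF d\<beta>] \<gamma>)
        have "gradient_hessian (0, i) (\<phi> s) z = (\<Sum>j\<in>Basis. (v \<bullet> j) *\<^sub>R fd ?g x j)"
          using i by (auto simp: gradient_hessian_def z)
        also have "\<dots> = fd ?g x v"
          using g by (intro fd_eq_sum_Basis[symmetric]) (auto simp: differentiable_def)
        finally have "\<beta> x * ((q \<bullet> v) * (e \<bullet> i) + (q \<bullet> i) * (e \<bullet> v)) = 0"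
          using *[of "(0, i)"] i fd_eqI[OF g] by (simp add: Basis_prod_def)
        then have "(q \<bullet> v) * (e \<bullet> i) + (q \<bullet> i) * (e \<bullet> v) = 0" using \<beta>(3) by simp
        then show ?thesis using v by (simp add: inner_commute algebra_simps)
      qed
      have q: "q \<bullet> i = 0" if "i \<in> Basis" "i \<noteq> e" for i
        using hess[OF that(1)] that e by (simp add: inner_Basis)
      \<comment> \<open>Only the component of \<open>q\<close> along \<open>e\<close> is left, so
        \<open>q \<bullet> v\<close> equals \<open>q \<bullet> e\<close> and the equation at
        \<open>e\<close> becomes \<open>2 * (q \<bullet> e) = 0\<close>.\<close>
      have "q \<bullet> v = (\<Sum>i\<in>Basis. (q \<bullet> i) * (v \<bullet> i))" by (rule euclidean_inner)
      also have "\<dots> = (\<Sum>i\<in>Basis. if i = e then q \<bullet> e else 0)" using q v by (intro sum.cong) auto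
      also have "\<dots> = q \<bullet> e" using e by simp
      finally have "q \<bullet> e = 0" using hess[OF e] e by (simp add: inner_Basis)
      then have "q = 0" using q by (metis euclidean_eq_iff inner_zero_left)
      then show ?thesis using p s by (simp add: zero_prod_def)
    qed
    have "(\<Sum>i\<in>Basis. (s \<bullet> i) * gradient_hessian b (\<phi> i) z) = gradient_hessian b (\<phi> s) z"
      if "b \<in> Basis" for b s
    proof -
      have "\<phi> s y = (\<Sum>i\<in>Basis. (s \<bullet> i) * \<phi> i y)" for y
      proof -
        have "linear (\<lambda>s. \<phi> s y)"
          by (rule linearI) (simp_all add: \<phi>_def inner_add_left algebra_simps)
        from linear_eq_sum_Basis[OF this, of s] show ?thesis by simp
      qed
      then have "\<phi> s = (\<lambda>y. \<Sum>i\<in>Basis. (s \<bullet> i) * \<phi> i y)" by blast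
      then show ?thesis
        using diffop_linearisation_sum[OF U diffop_gradient_hessian[OF U that], where V = "\<lambda>x. 0"
            and I = Basis and \<phi> = \<phi> and s = "\<lambda>i. s \<bullet> i" and z = z] \<phi> x z by simp
    qed
    then show "\<exists>\<phi> K. compact K \<and> K \<subseteq> U \<and>
        (\<forall>i\<in>(Basis::('e \<times> 'e) set). smooth_on (\<phi> i) U \<and> (\<forall>x\<in>U - K. \<phi> i x = 0)) \<and>
        (\<forall>s. (\<forall>b\<in>Basis. (\<Sum>i\<in>Basis. (s \<bullet> i) * gradient_hessian b (\<phi> i) z) = 0) \<longrightarrow> s = 0)"
      using K \<phi> inj \<beta>(2) by (intro exI[of _ \<phi>] exI[of _ K]) (auto simp: \<phi>_def)
  qed
  have "continuous_on (U \<times> UNIV) (\<lambda>z. snd z \<bullet> e - 1)" by (intro continuous_intros)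
  from sigma_compact_zeros[OF open_tangent[OF U] this]
  obtain K where "\<And>n::nat. compact (K n)" "Z = (\<Union>n. K n)"
    unfolding Z_def by blast
  from residual_avoids[OF this] show ?thesis unfolding avoids_def Z_def .
qed

text \<open>A kernel vector of the Hessian can be rescaled so that one of its coordinates is 1, and
  the finitely many normalised statements are intersected. At a critical point the gradient
  equations hold, so the equation that fails belongs to the Hessian.\<close>

lemma residual_nondegenerate:
  "residual_in X {V \<in> smooth_functions A. \<forall>x\<in>U. (\<forall>i\<in>Basis. fd (loc V) x i = 0) \<longrightarrow>
    (\<forall>v. v \<noteq> 0 \<longrightarrow> (\<exists>i\<in>Basis. fd (\<lambda>y. fd (loc V) y i) x v \<noteq> 0))}" (is "residual_in X ?D")
proof -
  let ?C = "\<lambda>e. {V \<in> smooth_functions A. \<forall>z \<in> {z \<in> U \<times> UNIV. snd z \<bullet> e - 1 = 0}.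
    \<exists>b\<in>Basis. gradient_hessian b (loc V) z \<noteq> 0}"
  have sub: "topspace X \<inter> (\<Inter>e\<in>Basis. ?C e) \<subseteq> ?D"
  proof (intro subsetI CollectI conjI ballI allI impI)
    fix V x v
    assume V: "V \<in> topspace X \<inter> (\<Inter>e\<in>Basis. ?C e)"
    then show VA: "V \<in> smooth_functions A" using topspace_strong_topology[OF A] by blast
    assume x: "x \<in> U" and crit: "\<forall>i\<in>Basis. fd (loc V) x i = 0" and "v \<noteq> (0::'e)"
    then obtain e where e: "e \<in> Basis" "v \<bullet> e \<noteq> 0" using euclidean_all_zero_iff by blast
    define w where "w = (1 / (v \<bullet> e)) *\<^sub>R v"
    have "(x, w) \<in> {z \<in> U \<times> UNIV. snd z \<bullet> e - 1 = 0}" using x e by (simp add: w_def)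
    then obtain b where b: "b \<in> Basis" "gradient_hessian b (loc V) (x, w) \<noteq> 0" using V e(1) by blast
    have "snd b \<noteq> 0"
    proof
      assume "snd b = 0"
      then have "fst b \<in> Basis" using b(1) by (auto simp: Basis_prod_def)
      then show False using b(2) crit \<open>snd b = 0\<close> by (simp add: gradient_hessian_def)
    qed
    then have i: "snd b \<in> Basis" using b(1) by (auto simp: Basis_prod_def)
    have d: "(\<lambda>y. fd (loc V) y (snd b)) differentiable at x"
      using smooth_on_fd_Basis[OF U smooth_loc[OF VA] i] x smooth_on_differentiable by blast
    have "gradient_hessian b (loc V) (x, w) = fd (\<lambda>y. fd (loc V) y (snd b)) x w"
      using \<open>snd b \<noteq> 0\<close> fd_eq_sum_Basis[OF d, of w] by (simp add: gradient_hessian_def)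
    also have "\<dots> = (1 / (v \<bullet> e)) * fd (\<lambda>y. fd (loc V) y (snd b)) x v"
      using linear_scale[OF linear_fd[OF d]] by (simp add: w_def)
    finally show "\<exists>i\<in>Basis. fd (\<lambda>y. fd (loc V) y i) x v \<noteq> 0" using b(2) i by auto
  qed
  show ?thesis
    by (rule residual_in_mono[OF residual_in_INT[OF countable_finite[OF finite_Basis]
          residual_nondegenerate_normalised] sub]) (auto simp: topspace_strong_topology[OF A])
qed

text \<open>The gradient has an injective derivative at \<open>x\<close>. It therefore grows at
  least like \<open>\<kappa> * norm (y - x)\<close>, up to an error of half that size, and has no
  second zero nearby.\<close>

lemma critical_point_isolated:
  assumes V: "V \<in> smooth_functions A" and x: "x \<in> U" and crit: "\<forall>i\<in>Basis. fd (loc V) x i = 0"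
    and nondeg: "\<forall>v. v \<noteq> 0 \<longrightarrow> (\<exists>i\<in>Basis. fd (\<lambda>y. fd (loc V) y i) x v \<noteq> 0)"
  shows "\<exists>N. open N \<and> x \<in> N \<and> N \<subseteq> U \<and> (\<forall>y\<in>N. (\<forall>i\<in>Basis. fd (loc V) y i = 0) \<longrightarrow> y = x)"
proof -
  define G where "G y = (\<Sum>i\<in>Basis. fd (loc V) y i *\<^sub>R i)" for y
  define H where "H v = (\<Sum>i\<in>Basis. fd (\<lambda>y. fd (loc V) y i) x v *\<^sub>R i)" for v
  have G: "(G has_derivative H) (at x)"
    unfolding G_def[abs_def] H_def[abs_def]
    by (intro has_derivative_sum has_derivative_scaleR_left has_derivative_fd
        smooth_on_differentiable[OF _ x] smooth_on_fd_Basis U smooth_loc V)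
  then have lin: "linear H" using has_derivative_linear by blast
  have "v = 0" if "H v = 0" for v
  proof (rule ccontr)
    assume "v \<noteq> 0"
    with nondeg obtain i where "i \<in> Basis" "fd (\<lambda>y. fd (loc V) y i) x v \<noteq> 0" by blast
    moreover from this have "H v \<bullet> i = fd (\<lambda>y. fd (loc V) y i) x v" by (simp add: H_def)
    ultimately show False using that by simp
  qed
  then have "inj H" using lin linear_injective_0 by blast
  then obtain \<kappa> where \<kappa>: "\<kappa> > 0" "\<And>v. \<kappa> * norm v \<le> norm (H v)"
    using linear_inj_bounded_below_pos[OF lin] by blast
  obtain d where d: "d > 0" "\<And>y. norm (y - x) < d \<Longrightarrow> norm (G y - G x - H (y - x)) \<le> \<kappa> / 2 * norm (y - x)"
    using G \<kappa>(1) unfolding has_derivative_at_alt by (metis half_gt_zero)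
  have "y = x" if "y \<in> ball x d" "\<forall>i\<in>Basis. fd (loc V) y i = 0" for y
  proof -
    have "G y = 0" "G x = 0" using that crit by (simp_all add: G_def)
    then have "\<kappa> * norm (y - x) \<le> \<kappa> / 2 * norm (y - x)"
      using d(2)[of y] \<kappa>(2)[of "y - x"] that(1) by (simp add: dist_norm norm_minus_commute)
    then show ?thesis using \<kappa>(1) by (simp add: mult_le_cancel_right)
  qed
  then show ?thesis
    using U x d(1) by (intro exI[of _ "ball x d \<inter> U"]) auto
qed

end


section \<open>Iterated derivatives along a vector field\<close>

locale vector_field =
  fixes \<Omega> :: "'a::euclidean_space set" and \<xi> :: "'a \<Rightarrow> 'a"
  assumes \<Omega>: "open \<Omega>" and \<xi>: "smooth_on \<xi> \<Omega>"
begin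

text \<open>The Lie derivative. Its iterates at a point are the time derivatives of \<open>f\<close>
  along the integral curve through that point, computed without integrating the field.\<close>

definition D :: "('a \<Rightarrow> real) \<Rightarrow> 'a \<Rightarrow> real" where
  "D f z = fd f z (\<xi> z)"

lemma smooth_D: "smooth_on f \<Omega> \<Longrightarrow> smooth_on (D f) \<Omega>"
  unfolding D_def[abs_def] by (intro smooth_on_fd \<Omega> \<xi>)

lemma smooth_iter: "smooth_on f \<Omega> \<Longrightarrow> smooth_on ((D ^^ i) f) \<Omega>"
  by (induction i) (auto intro: smooth_D)

lemma iter_Suc: "(D ^^ Suc i) f = (D ^^ i) (D f)"
  by (simp add: funpow_swap1)

lemma D_cong: "(\<And>z. z \<in> \<Omega> \<Longrightarrow> f z = g z) \<Longrightarrow> z \<in> \<Omega> \<Longrightarrow> D f z = D g z"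
  unfolding D_def using fd_cong_open[OF \<Omega>] by metis

lemma iter_cong:
  assumes "\<And>z. z \<in> \<Omega> \<Longrightarrow> f z = g z" "z \<in> \<Omega>"
  shows "(D ^^ i) f z = (D ^^ i) g z"
  using assms(2)
proof (induction i arbitrary: z)
  case (Suc i)
  then show ?case using D_cong[of "(D ^^ i) f" "(D ^^ i) g"] by simp
qed (use assms in simp)

lemma iter_add:
  assumes "smooth_on f \<Omega>" "smooth_on g \<Omega>" "z \<in> \<Omega>"
  shows "(D ^^ i) (\<lambda>z. f z + g z) z = (D ^^ i) f z + (D ^^ i) g z"
  using assms(3)
proof (induction i arbitrary: z)
  case (Suc i)
  have "D ((D ^^ i) (\<lambda>z. f z + g z)) z = D (\<lambda>z. (D ^^ i) f z + (D ^^ i) g z) z"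
    by (rule D_cong[OF Suc.IH Suc.prems])
  also have "\<dots> = D ((D ^^ i) f) z + D ((D ^^ i) g) z"
    using smooth_on_differentiable[OF smooth_iter] assms(1,2) Suc.prems unfolding D_def by (simp add: fd_add)
  finally show ?case by simp
qed simp

lemma D_mult:
  "smooth_on f \<Omega> \<Longrightarrow> smooth_on g \<Omega> \<Longrightarrow> z \<in> \<Omega> \<Longrightarrow> D (\<lambda>z. f z * g z) z = f z * D g z + D f z * g z"
  unfolding D_def by (intro fd_mult smooth_on_differentiable)

lemma iter_Suc_mult:
  assumes "smooth_on f \<Omega>" "smooth_on g \<Omega>" "z \<in> \<Omega>"
  shows "(D ^^ Suc i) (\<lambda>z. f z * g z) z =
    (D ^^ i) (\<lambda>z. f z * D g z) z + (D ^^ i) (\<lambda>z. D f z * g z) z"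
proof -
  have "(D ^^ Suc i) (\<lambda>z. f z * g z) z = (D ^^ i) (\<lambda>z. f z * D g z + D f z * g z) z"
    unfolding iter_Suc by (rule iter_cong[OF _ assms(3)]) (rule D_mult[OF assms(1,2)])
  also have "\<dots> = (D ^^ i) (\<lambda>z. f z * D g z) z + (D ^^ i) (\<lambda>z. D f z * g z) z"
    by (intro iter_add smooth_on_mult smooth_D \<Omega> assms)
  finally show ?thesis .
qed

text \<open>The order of the zero along the integral curve through \<open>z\<close>, which can be
  much larger than the order of the zero at \<open>z\<close> as a function of all variables.\<close>

definition vanishes :: "nat \<Rightarrow> ('a \<Rightarrow> real) \<Rightarrow> 'a \<Rightarrow> bool" where
  "vanishes m f z \<longleftrightarrow> (\<forall>i<m. (D ^^ i) f z = 0)"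

lemma vanishes_D: "vanishes m f z \<Longrightarrow> vanishes (m - 1) (D f) z"
  unfolding vanishes_def
proof (intro allI impI)
  fix i assume "\<forall>i<m. (D ^^ i) f z = 0" "i < m - 1"
  then have "(D ^^ Suc i) f z = 0" by (metis less_diff_conv Suc_eq_plus1)
  then show "(D ^^ i) (D f) z = 0" by (simp only: iter_Suc)
qed

text \<open>Orders of zeros along a curve add. By the product rule one derivative falls on one
  factor and lowers the order of that factor by one; if the order is already 0, the truncated
  \<open>m - 1\<close> or \<open>n - 1\<close> is still correct.\<close>

lemma vanishes_mult:
  assumes "smooth_on f \<Omega>" "smooth_on g \<Omega>" "z \<in> \<Omega>" "vanishes m f z" "vanishes n g z"
  shows "vanishes (m + n) (\<lambda>z. f z * g z) z"
proof -
  have "(D ^^ i) (\<lambda>z. f z * g z) z = 0" if "i < m + n" for i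
    using assms that
  proof (induction i arbitrary: f g m n)
    case 0
    then show ?case unfolding vanishes_def by (cases "m > 0") auto
  next
    case (Suc i)
    have "(D ^^ i) (\<lambda>z. f z * D g z) z = 0"
      using Suc.prems vanishes_D[of n g z] by (intro Suc.IH[of f "D g" m "n - 1"] smooth_D) auto
    moreover have "(D ^^ i) (\<lambda>z. D f z * g z) z = 0"
      using Suc.prems vanishes_D[of m f z] by (intro Suc.IH[of "D f" g "m - 1" n] smooth_D) auto
    ultimately show ?case using Suc.prems by (simp only: iter_Suc_mult)
  qed
  then show ?thesis by (simp add: vanishes_def)
qed

lemma vanishes_power:
  assumes "smooth_on l \<Omega>" "z \<in> \<Omega>" "l z = 0"
  shows "vanishes n (\<lambda>z. l z ^ n) z"
proof (induction n)
  case (Suc n)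
  have "vanishes (1 + n) (\<lambda>z. l z * l z ^ n) z"
    by (intro vanishes_mult smooth_on_power \<Omega> assms Suc) (simp add: vanishes_def assms)
  then show ?case by simp
qed (simp add: vanishes_def)

lemma vanishes_mult_left:
  assumes "smooth_on f \<Omega>" "smooth_on g \<Omega>" "z \<in> \<Omega>" "vanishes m f z"
  shows "vanishes m (\<lambda>z. f z * g z) z"
  using vanishes_mult[OF assms, of 0] by (simp add: vanishes_def)

text \<open>A term of the Leibniz expansion survives at \<open>z\<close> if each of the
  \<open>n\<close> derivatives hits a different factor \<open>l\<close>. In the induction,
  differentiating \<open>a\<close> leaves too high a power of \<open>l\<close>, and differentiating
  the power reproduces the claim for \<open>n\<close> with \<open>Suc n * D l * a\<close> in place
  of \<open>a\<close>.\<close>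

lemma iter_power_leading:
  assumes "smooth_on l \<Omega>" "z \<in> \<Omega>" "l z = 0" "smooth_on a \<Omega>"
  shows "(D ^^ n) (\<lambda>z. l z ^ n * a z) z = fact n * (D l z) ^ n * a z"
  using assms(4)
proof (induction n arbitrary: a)
  case (Suc n)
  have D_power: "D (\<lambda>z. l z ^ Suc n) y = l y ^ n * (real (Suc n) * D l y)" if "y \<in> \<Omega>" for y
  proof (induction n)
    case (Suc n)
    have "D (\<lambda>z. l z ^ Suc (Suc n)) y = l y * D (\<lambda>z. l z ^ Suc n) y + D l y * l y ^ Suc n"
      using D_mult[of l "\<lambda>z. l z ^ Suc n" y] smooth_on_power[OF \<Omega> assms(1), of "Suc n"] assms(1) that
      by simp
    then show ?case unfolding Suc by (simp add: algebra_simps)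
  qed simp
  have "(D ^^ Suc n) (\<lambda>z. l z ^ Suc n * a z) z =
      (D ^^ n) (\<lambda>z. l z ^ Suc n * D a z) z + (D ^^ n) (\<lambda>z. D (\<lambda>z. l z ^ Suc n) z * a z) z"
    by (intro iter_Suc_mult smooth_on_power \<Omega> assms Suc.prems)
  also have "(D ^^ n) (\<lambda>z. l z ^ Suc n * D a z) z = 0"
    using vanishes_mult_left[OF smooth_on_power[OF \<Omega> assms(1)] smooth_D[OF Suc.prems] assms(2)
        vanishes_power[OF assms(1-3)], of "Suc n"] by (simp only: vanishes_def lessI)
  also have "(D ^^ n) (\<lambda>z. D (\<lambda>z. l z ^ Suc n) z * a z) z =
      (D ^^ n) (\<lambda>z. l z ^ n * (real (Suc n) * D l z * a z)) z"
    by (rule iter_cong[OF _ assms(2)]) (simp only: D_power mult.assoc)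
  also have "\<dots> = fact n * (D l z) ^ n * (real (Suc n) * D l z * a z)"
    by (intro Suc.IH smooth_on_mult smooth_D \<Omega> assms smooth_on_const Suc.prems)
  finally show ?case by (simp add: algebra_simps)
qed simp

end


section \<open>Second-order equations with a conserved function\<close>

text \<open>
  The equation is \<open>x'' = a (x, x') - (\<Sum>j. \<partial>\<^sub>jV(x) H\<^sub>j(x))\<close>, with \<open>H\<close> the inverse metric.
\<close>

locale second_order = smooth_chart A c
  for A :: "('q::{second_countable_topology,t2_space}, 'e::euclidean_space) chart set" and c +
  fixes a :: "'e \<times> 'e \<Rightarrow> 'e" and H :: "'e \<Rightarrow> 'e \<Rightarrow> 'e" and h :: "'e \<Rightarrow> real"
  assumes smooth_a: "smooth_on a (U \<times> UNIV)"
    and smooth_H: "\<And>j. j \<in> Basis \<Longrightarrow> smooth_on (H j) U"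
    and smooth_h: "smooth_on h U"
    and pos: "\<And>x w. x \<in> U \<Longrightarrow> w \<noteq> 0 \<Longrightarrow> 0 < (\<Sum>j\<in>Basis. (w \<bullet> j) * (w \<bullet> H j x))"
begin

definition spray :: "('e \<Rightarrow> real) \<Rightarrow> 'e \<times> 'e \<Rightarrow> 'e \<times> 'e" where
  "spray V z = (snd z, a z - (\<Sum>j\<in>Basis. partials [j] V (fst z) *\<^sub>R H j (fst z)))"

definition dspray :: "('e \<Rightarrow> real) \<Rightarrow> 'e \<times> 'e \<Rightarrow> 'e \<times> 'e" where
  "dspray \<psi> z = (0, - (\<Sum>j\<in>Basis. partials [j] \<psi> (fst z) *\<^sub>R H j (fst z)))"

primrec P :: "nat \<Rightarrow> ('e \<Rightarrow> real) \<Rightarrow> 'e \<times> 'e \<Rightarrow> real" where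
  "P 0 V = (\<lambda>z. h (fst z))"
| "P (Suc k) V = (\<lambda>z. fd (P k V) z (spray V z))"

text \<open>The recursion of \<open>P\<close> differentiated in \<open>V\<close>: first the function
  varies, then the vector field, whose derivative is \<open>dspray\<close>.\<close>

primrec P' :: "nat \<Rightarrow> ('e \<Rightarrow> real) \<Rightarrow> ('e \<Rightarrow> real) \<Rightarrow> 'e \<times> 'e \<Rightarrow> real" where
  "P' 0 V \<psi> = (\<lambda>z. 0)"
| "P' (Suc k) V \<psi> = (\<lambda>z. fd (P' k V \<psi>) z (spray V z) + fd (P k V) z (dspray \<psi> z))"

lemma \<Omega>: "open (U \<times> (UNIV :: 'e set))"
  by (rule open_tangent[OF U])

lemma smooth_H': "j \<in> Basis \<Longrightarrow> smooth_on (\<lambda>z. H j (fst z)) (U \<times> (UNIV :: 'e set))"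
  by (intro smooth_on_fst_compose U smooth_H)

lemma smooth_snd: "smooth_on snd (U \<times> (UNIV :: 'e set))"
  by (intro smooth_on_linear bounded_linear_snd \<Omega>)

lemma smooth_spray: "smooth_on V U \<Longrightarrow> smooth_on (spray V) (U \<times> UNIV)"
  unfolding spray_def[abs_def]
  by (intro smooth_on_Pair smooth_on_diff smooth_on_sum smooth_on_scaleR smooth_on_jet \<Omega> U
      smooth_a smooth_H' smooth_snd) auto

lemma diffop_spray:
  "diffop U (\<lambda>V z. spray V z \<bullet> b) (\<lambda>V \<psi> z. dspray \<psi> z \<bullet> b)"
proof -
  have 1: "diffop U (\<lambda>V z. (snd z, a z) \<bullet> b) (\<lambda>V \<psi> z. 0)"
    by (intro diffop.const smooth_on_inner smooth_on_Pair smooth_a smooth_snd smooth_on_const \<Omega>)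
  have "diffop U (\<lambda>V z. partials [j] V (fst z) * - ((0, H j (fst z)) \<bullet> b))
    (\<lambda>V \<psi> z. partials [j] V (fst z) * 0 + partials [j] \<psi> (fst z) * - ((0, H j (fst z)) \<bullet> b))"
    if "j \<in> Basis" for j
    by (intro diffop.mult diffop.jet diffop.const smooth_on_minus smooth_on_inner smooth_on_Pair
        smooth_on_const smooth_H' \<Omega> that) (use that in auto)
  from diffop.add[OF 1 diffop_sum[OF U this]] show ?thesis
  proof (rule diffop.cong)
    fix V \<psi> :: "'e \<Rightarrow> real" and z :: "'e \<times> 'e"
    show "(snd z, a z) \<bullet> b + (\<Sum>j\<in>Basis. partials [j] V (fst z) * - ((0, H j (fst z)) \<bullet> b)) = spray V z \<bullet> b"
      unfolding spray_def by (cases b) (simp add: inner_diff_left inner_sum_left sum_negf)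
    show "0 + (\<Sum>j\<in>Basis. partials [j] V (fst z) * 0 + partials [j] \<psi> (fst z) * - ((0, H j (fst z)) \<bullet> b)) = dspray \<psi> z \<bullet> b"
      unfolding dspray_def by (cases b) (simp add: inner_sum_left sum_negf)
  qed
qed

text \<open>The derivative along the spray is expanded in basis directions because
  \<open>diffop_fd\<close> is stated for those; \<open>diffop_spray\<close> supplies the
  coefficients together with their linearisations.\<close>

lemma diffop_P: "diffop U (P k) (P' k)"
proof (induction k)
  case 0
  show ?case
    using diffop.const[OF smooth_on_fst_compose[OF U smooth_h]] by (simp add: P'_def P_def)
next
  case (Suc k)
  from diffop_sum[OF U diffop.mult[OF diffop_spray diffop_fd[OF U Suc]], of Basis "\<lambda>b. b"]
  have "diffop U (\<lambda>V z. \<Sum>b\<in>Basis. (spray V z \<bullet> b) * fd (P k V) z b)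
     (\<lambda>V \<psi> z. \<Sum>b\<in>Basis. (spray V z \<bullet> b) * fd (P' k V \<psi>) z b + (dspray \<psi> z \<bullet> b) * fd (P k V) z b)"
    by simp
  then show ?case
  proof (rule diffop.cong)
    fix V \<psi> :: "'e \<Rightarrow> real" and z :: "'e \<times> 'e"
    assume V: "smooth_on V U" and z: "z \<in> U \<times> UNIV"
    note d = diffop_differentiable[OF U Suc V z]
    show "(\<Sum>b\<in>Basis. (spray V z \<bullet> b) * fd (P k V) z b) = P (Suc k) V z"
      by (simp only: P.simps fd_eq_sum_Basis[OF d(1), of "spray V z"] real_scaleR_def)
    assume "smooth_on \<psi> U"
    then show "(\<Sum>b\<in>Basis. (spray V z \<bullet> b) * fd (P' k V \<psi>) z b + (dspray \<psi> z \<bullet> b) * fd (P k V) z b) =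
        P' (Suc k) V \<psi> z"
      by (simp only: P'.simps fd_eq_sum_Basis[OF d(1), of "dspray \<psi> z"] sum.distrib
          fd_eq_sum_Basis[OF d(2), of \<psi> "spray V z"] real_scaleR_def)
  qed
qed

lemma smooth_P: "smooth_on V U \<Longrightarrow> smooth_on (P k V) (U \<times> UNIV)"
  using diffop_smooth[OF U diffop_P] by blast

lemma smooth_P': "smooth_on V U \<Longrightarrow> smooth_on \<psi> U \<Longrightarrow> smooth_on (P' k V \<psi>) (U \<times> UNIV)"
  using diffop_smooth[OF U diffop_P] by blast

lemma P_1: "x \<in> U \<Longrightarrow> P (Suc 0) V (x, v) = fd h x v"
  using fd_fst_compose[of h "(x, v)"] smooth_on_differentiable[OF smooth_h] by (simp add: spray_def)

text \<open>
  A perturbation that vanishes to order \<open>j\<close> along the flow first shows up in \<open>P (j + 2)\<close>; this makes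
  the linearisation triangular. Since \<open>h\<close> is conserved to high order, \<open>h - h(x)\<close> itself is negligible
  and only its gradient counts.
\<close>

lemma P'_perturbation:
  assumes V: "smooth_on V U" and x: "x \<in> U" and \<beta>: "smooth_on \<beta> U"
    and flat: "\<And>k. 1 \<le> k \<Longrightarrow> k \<le> j \<Longrightarrow> P k V (x, v) = 0"
  defines "\<psi> \<equiv> \<lambda>y. \<beta> y * ((h y - h x) * (v \<bullet> (y - x)) ^ j)"
  shows "1 \<le> k \<Longrightarrow> k \<le> j + 1 \<Longrightarrow> P' k V \<psi> (x, v) = 0" (is "_ \<Longrightarrow> _ \<Longrightarrow> ?low")
    and "P' (j + 2) V \<psi> (x, v) =
      - (fact j * (v \<bullet> v) ^ j * (\<beta> x * (\<Sum>i\<in>Basis. fd h x i * fd h x (H i x))))" (is ?top)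
proof -
  let ?\<Omega> = "U \<times> (UNIV :: 'e set)"
  let ?z = "(x, v)"
  interpret vf: vector_field ?\<Omega> "spray V" by unfold_locales (rule \<Omega>, rule smooth_spray[OF V])
  have z: "?z \<in> ?\<Omega>" using x by simp
  have \<psi>: "smooth_on \<psi> U"
    unfolding \<psi>_def by (intro smooth_on_mult smooth_on_diff smooth_on_power smooth_on_inner smooth_on_id
        smooth_on_const U \<beta> smooth_h)
  have P_iter: "(vf.D ^^ k) (\<lambda>z. h (fst z)) = P k V" for k
    by (induction k) (auto simp: vf.D_def)
  define g where "g z = h (fst z) - h x" for z :: "'e \<times> 'e"
  define l where "l z = v \<bullet> (fst z - x)" for z :: "'e \<times> 'e"
  have smooth_fst: "smooth_on (\<lambda>z. f (fst z)) ?\<Omega>" if "smooth_on f U" for f :: "'e \<Rightarrow> real"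
    by (rule smooth_on_fst_compose[OF U that])
  have g: "smooth_on g ?\<Omega>"
    unfolding g_def[abs_def] by (intro smooth_on_diff smooth_fst smooth_h smooth_on_const \<Omega>)
  have l: "smooth_on l ?\<Omega>"
    unfolding l_def[abs_def] by (intro smooth_fst smooth_on_inner smooth_on_diff smooth_on_const smooth_on_id U)
  have l0: "l ?z = 0" by (simp add: l_def)
  have Dl: "vf.D l ?z = v \<bullet> v"
  proof -
    have "(l has_derivative (\<lambda>w. v \<bullet> fst w)) (at ?z)"
      unfolding l_def[abs_def] by (auto intro!: derivative_eq_intros)
    from fd_eqI[OF this] show ?thesis by (simp add: vf.D_def spray_def)
  qed
  \<comment> \<open>Order 0 is removed by subtracting \<open>h x\<close>; orders 1 to
    \<open>j\<close> are the hypothesis \<open>flat\<close>.\<close>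
  have van_g: "vf.vanishes (Suc j) g ?z"
    unfolding vf.vanishes_def
  proof (intro allI impI)
    fix i assume i: "i < Suc j"
    have "g = (\<lambda>z. h (fst z) + (- h x))" by (rule ext) (simp add: g_def)
    moreover have "(vf.D ^^ i) (\<lambda>z. - h x) ?z = (if i = 0 then - h x else 0)"
    proof (cases i)
      case (Suc m)
      have "vf.D (\<lambda>z. - h x) = (\<lambda>z. 0)" by (rule ext) (simp add: vf.D_def frechet_derivative_const)
      moreover have "(vf.D ^^ m) (\<lambda>z. 0) = (\<lambda>z. 0)"
        by (induction m) (auto simp: vf.D_def frechet_derivative_const)
      ultimately show ?thesis by (simp only: Suc vf.iter_Suc) simp
    qed simp
    ultimately have "(vf.D ^^ i) g ?z = P i V ?z + (if i = 0 then - h x else 0)"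
      using vf.iter_add[OF smooth_fst[OF smooth_h] smooth_on_const z, of i "- h x"] by (simp add: P_iter)
    then show "(vf.D ^^ i) g ?z = 0" using flat[of i] i by (cases "i = 0") auto
  qed
  define S where "S k z = fd (P k V) z (dspray \<psi> z)" for k z
  define B where "B k i z = fd (P k V) z (0, H i (fst z))" for k i z
  \<comment> \<open>The gradient of \<open>\<psi>\<close> is split. The term that differentiates
    \<open>h\<close> keeps the factor \<open>l ^ j\<close> and goes into \<open>M\<close>; those
    that differentiate \<open>\<beta>\<close> or the power keep the factor \<open>g\<close> and go
    into \<open>R\<close>. For \<open>j = 0\<close> the truncated exponent \<open>j - 1\<close>
    occurs with coefficient 0.\<close>
  define M where "M k z = \<beta> (fst z) * (\<Sum>i\<in>Basis. - fd h (fst z) i * B k i z)" for k z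
  define R where "R k z = (\<Sum>i\<in>Basis. - (fd \<beta> (fst z) i * l z ^ j
      + \<beta> (fst z) * (real j * (v \<bullet> i) * l z ^ (j - 1))) * B k i z)" for k z
  have B: "smooth_on (B k i) ?\<Omega>" if "i \<in> Basis" for k i
    unfolding B_def[abs_def]
    by (intro smooth_on_fd smooth_P smooth_on_Pair smooth_on_const smooth_H' that V \<Omega>)
  have M: "smooth_on (M k) ?\<Omega>" for k
    unfolding M_def[abs_def]
    by (intro smooth_on_mult smooth_on_sum smooth_on_minus smooth_fst \<beta> smooth_on_fd_Basis smooth_h U \<Omega> B)
  have R: "smooth_on (R k) ?\<Omega>" for k
    unfolding R_def[abs_def]
    by (intro smooth_on_mult smooth_on_sum smooth_on_minus smooth_on_add smooth_on_power l smooth_fst \<beta>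
        smooth_on_fd_Basis smooth_on_const U \<Omega> B)
  have S_eq: "S k y = l y ^ j * M k y + g y * R k y" if y: "y \<in> ?\<Omega>" for k y
  proof -
    have yU: "fst y \<in> U" using y by auto
    have lin: "linear (fd (P k V) y)"
      by (intro linear_fd smooth_on_differentiable[OF smooth_P[OF V] y])
    have fd\<psi>: "fd \<psi> (fst y) i = \<beta> (fst y) * (g y * (real j * (v \<bullet> i) * l y ^ (j - 1)) + fd h (fst y) i * l y ^ j)
        + fd \<beta> (fst y) i * (g y * l y ^ j)" for i
    proof -
      have "(\<psi> has_derivative (\<lambda>i. \<beta> (fst y) * (g y * (real j * (v \<bullet> i) * l y ^ (j - 1)) + fd h (fst y) i * l y ^ j)
          + fd \<beta> (fst y) i * (g y * l y ^ j))) (at (fst y))"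
        unfolding \<psi>_def g_def l_def
        by (auto intro!: derivative_eq_intros has_derivative_fd smooth_on_differentiable[OF \<beta> yU]
            smooth_on_differentiable[OF smooth_h yU])
      from fd_eqI[OF this] show ?thesis by simp
    qed
    have "dspray \<psi> y = (\<Sum>i\<in>Basis. (- fd \<psi> (fst y) i) *\<^sub>R (0, H i (fst y)))"
      by (rule prod_eqI) (simp_all add: dspray_def fst_sum snd_sum sum_negf)
    then have "S k y = fd (P k V) y (\<Sum>i\<in>Basis. (- fd \<psi> (fst y) i) *\<^sub>R (0, H i (fst y)))"
      unfolding S_def by (rule arg_cong)
    also have "\<dots> = (\<Sum>i\<in>Basis. - fd \<psi> (fst y) i * B k i y)"
      unfolding linear_sum[OF lin] linear_scale[OF lin] B_def by simp
    also have "\<dots> = l y ^ j * M k y + g y * R k y"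
      unfolding M_def R_def sum_distrib_left sum.distrib[symmetric] fd\<psi>
      by (intro sum.cong refl) (simp add: algebra_simps)
    finally show ?thesis .
  qed
  have S: "smooth_on (S k) ?\<Omega>" for k
    by (rule smooth_on_cong_open[OF \<Omega>, of "\<lambda>y. l y ^ j * M k y + g y * R k y"])
      (auto simp: S_eq intro!: smooth_on_add smooth_on_mult smooth_on_power l M g R \<Omega>)
  have iter_S: "(vf.D ^^ i) (S k) ?z = (vf.D ^^ i) (\<lambda>y. l y ^ j * M k y) ?z" if "i \<le> j" for i k
  proof -
    have "(vf.D ^^ i) (S k) ?z = (vf.D ^^ i) (\<lambda>y. l y ^ j * M k y + g y * R k y) ?z"
      by (rule vf.iter_cong[OF S_eq z])
    also have "\<dots> = (vf.D ^^ i) (\<lambda>y. l y ^ j * M k y) ?z + (vf.D ^^ i) (\<lambda>y. g y * R k y) ?z"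
      by (intro vf.iter_add smooth_on_mult smooth_on_power l M g R \<Omega> z)
    also have "(vf.D ^^ i) (\<lambda>y. g y * R k y) ?z = 0"
      using vf.vanishes_mult_left[OF g R z van_g] that by (simp add: vf.vanishes_def)
    finally show ?thesis by simp
  qed
  have iter_S_low: "(vf.D ^^ i) (S k) ?z = 0" if "i < j" for i k
    using iter_S[of i k] that vf.vanishes_mult_left[OF smooth_on_power[OF \<Omega> l] M z
        vf.vanishes_power[OF l z l0], of j] by (simp add: vf.vanishes_def)
  have iter_S_top: "(vf.D ^^ j) (S k) ?z = fact j * (v \<bullet> v) ^ j * M k ?z" for k
    using iter_S[of j k] vf.iter_power_leading[OF l z l0 M] Dl by simp
  have P'_Suc: "(vf.D ^^ i) (P' (Suc k) V \<psi>) ?z = (vf.D ^^ Suc i) (P' k V \<psi>) ?z + (vf.D ^^ i) (S k) ?z" for i k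
  proof -
    have "P' (Suc k) V \<psi> = (\<lambda>z. vf.D (P' k V \<psi>) z + S k z)" by (simp add: vf.D_def S_def)
    then show ?thesis
      unfolding vf.iter_Suc using vf.iter_add[OF vf.smooth_D[OF smooth_P'[OF V \<psi>]] S z] by simp
  qed
  have zero: "(vf.D ^^ i) (\<lambda>z. 0) = (\<lambda>z. 0)" for i
    by (induction i) (auto simp: vf.D_def frechet_derivative_const)
  \<comment> \<open>A change of potential alters only the acceleration, which \<open>P 0\<close>, a
    function of position, does not see. The first contribution is thus \<open>S 1\<close>, hence the
    shift by 2 in the result.\<close>
  have S0: "S 0 y = 0" if "y \<in> ?\<Omega>" for y
    using fd_fst_compose[of h y "dspray \<psi> y"] smooth_on_differentiable[OF smooth_h, of "fst y"] that
      linear_0[OF linear_fd, of h "fst y"] by (auto simp: S_def dspray_def)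
  have P'_1: "(vf.D ^^ i) (P' (Suc 0) V \<psi>) ?z = 0" for i
    unfolding P'_Suc using vf.iter_cong[where i = i, OF S0 z] zero[of i] zero[of "Suc i"] by (simp add: P'.simps(1))
  \<comment> \<open>Unrolling \<open>P'_Suc\<close> yields the sum over \<open>m\<close> from 1 to
    \<open>k\<close> of \<open>S m\<close> differentiated \<open>i + k - m\<close> times, and all
    these orders are below \<open>j\<close>. The additional \<open>i\<close> derivatives make the
    induction on \<open>k\<close> work.\<close>
  have low: "(vf.D ^^ i) (P' (Suc k) V \<psi>) ?z = 0" if "i + k \<le> j" for i k
    using that
  proof (induction k arbitrary: i)
    case (Suc k)
    have "(vf.D ^^ Suc i) (P' (Suc k) V \<psi>) ?z = 0" using Suc.prems by (intro Suc.IH) simp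
    then show ?case unfolding P'_Suc[of i "Suc k"] using iter_S_low[of i] Suc.prems by simp
  qed (rule P'_1)
  \<comment> \<open>One level higher, the term with \<open>S 1\<close> is differentiated exactly
    \<open>j\<close> times and gives the leading coefficient; all others still vanish.\<close>
  have top: "(vf.D ^^ i) (P' (Suc (Suc k)) V \<psi>) ?z = fact j * (v \<bullet> v) ^ j * M 1 ?z" if "i + k = j" for i k
    using that
  proof (induction k arbitrary: i)
    case 0
    then show ?case unfolding P'_Suc[of i "Suc 0"] P'_1 using iter_S_top[of 1] by simp
  next
    case (Suc k)
    have "(vf.D ^^ Suc i) (P' (Suc (Suc k)) V \<psi>) ?z = fact j * (v \<bullet> v) ^ j * M 1 ?z"
      using Suc.prems by (intro Suc.IH) simp
    then show ?case unfolding P'_Suc[of i "Suc (Suc k)"] using iter_S_low[of i] Suc.prems by simp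
  qed
  show ?low if k: "1 \<le> k" "k \<le> j + 1"
  proof -
    obtain m where "k = Suc m" using k(1) by (cases k) auto
    then show ?thesis using low[of 0 m] k by simp
  qed
  \<comment> \<open>\<open>P 1\<close> is linear in the velocity, so its derivative in a velocity
    direction is read off along a line.\<close>
  have "B 1 i ?z = fd h x (H i x)" for i
  proof -
    have "P 1 V (x, v + t *\<^sub>R w) = fd h x v + t * fd h x w" for t w
      unfolding One_nat_def P_1[OF x] linear_add[OF linear_fd[OF smooth_on_differentiable[OF smooth_h x]]]
        linear_scale[OF linear_fd[OF smooth_on_differentiable[OF smooth_h x]]] by simp
    then have "((\<lambda>t. P 1 V (x, v + t *\<^sub>R w)) has_real_derivative fd h x w) (at 0)" for w
      by (auto intro!: derivative_eq_intros)
    moreover have "((\<lambda>t. P 1 V (x, v + t *\<^sub>R w)) has_real_derivative fd (P 1 V) ?z (0, w)) (at 0)" for w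
    proof -
      have "((\<lambda>t. (x, v + t *\<^sub>R w)) has_derivative (\<lambda>t. (0, t *\<^sub>R w))) (at 0)"
        by (auto intro!: derivative_eq_intros)
      moreover have "(P 1 V has_derivative fd (P 1 V) ?z) (at ?z)"
        by (intro has_derivative_fd smooth_on_differentiable[OF smooth_P[OF V] z])
      ultimately have "((\<lambda>t. P 1 V (x, v + t *\<^sub>R w)) has_derivative (\<lambda>t. fd (P 1 V) ?z (0, t *\<^sub>R w))) (at 0)"
        using has_derivative_compose[of "\<lambda>t. (x, v + t *\<^sub>R w)" "\<lambda>t. (0, t *\<^sub>R w)" 0 UNIV "P 1 V"] by simp
      moreover have "fd (P 1 V) ?z (0, t *\<^sub>R w) = fd (P 1 V) ?z (0, w) * t" for t
        using linear_scale[OF linear_fd[OF smooth_on_differentiable[OF smooth_P[OF V] z]], of 1 t "(0, w)"]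
        by (simp add: scaleR_Pair mult.commute)
      ultimately show ?thesis by (simp add: has_field_derivative_def)
    qed
    ultimately show ?thesis unfolding B_def using DERIV_unique by fastforce
  qed
  then have "M 1 ?z = - (\<beta> x * (\<Sum>i\<in>Basis. fd h x i * fd h x (H i x)))"
    by (simp add: M_def sum_negf)
  then show ?top using top[of 0 j] by simp
qed

text \<open>The zero function stands for an arbitrary potential, since by \<open>P_1\<close> the
  first derivative of \<open>h\<close> along the flow is \<open>fd h x v\<close> for every
  \<open>V\<close>. The index \<open>e\<close> marks a nonvanishing partial derivative of
  \<open>h\<close>, so that the equation can be solved for the component of \<open>v\<close> along
  \<open>e\<close>.\<close>

definition tangent_zeros :: "'e \<Rightarrow> ('e \<times> 'e) set" where
  "tangent_zeros e = {z \<in> {z \<in> U \<times> UNIV. snd z \<noteq> 0 \<and> fd h (fst z) e \<noteq> 0}. P (Suc 0) (\<lambda>x. 0) z = 0}"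

lemma in_tangent_zeros:
  "(x, v) \<in> tangent_zeros e \<longleftrightarrow> x \<in> U \<and> v \<noteq> 0 \<and> fd h x e \<noteq> 0 \<and> fd h x v = 0"
  unfolding tangent_zeros_def using P_1[of x "\<lambda>x. 0" v] by auto

lemma fd_h_quotient: "open W \<Longrightarrow> W \<subseteq> U \<times> UNIV \<Longrightarrow> e \<in> Basis \<Longrightarrow> smooth_on (\<lambda>z. fd h (fst z) e) W"
  by (rule smooth_on_subset[OF smooth_on_fst_compose[OF U smooth_on_fd_Basis[OF U smooth_h]]])

lemma open_noncritical:
  assumes "e \<in> Basis"
  shows "open {z \<in> U \<times> (UNIV :: 'e set). fd h (fst z) e \<noteq> 0}"
proof -
  have "continuous_on (U \<times> (UNIV :: 'e set)) (\<lambda>z. fd h (fst z) e)"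
    by (intro smooth_on_continuous fd_h_quotient \<Omega> assms order_refl)
  then have "open (U \<times> (UNIV :: 'e set) \<inter> (\<lambda>z. fd h (fst z) e) -` (- {0}))"
    by (rule continuous_open_preimage[OF _ \<Omega> open_Compl[OF closed_singleton]])
  then show ?thesis by (simp add: vimage_def Int_def)
qed

text \<open>A graph over a null set: \<open>G\<close> restores the component of the velocity along
  \<open>e\<close> from the other components by solving \<open>fd h x v = 0\<close>, so the
  hypersurface lies in the image of the hyperplane where that component is 0.\<close>

lemma negligible_tangent_zeros:
  assumes e: "e \<in> Basis"
  shows "negligible (tangent_zeros e)"
proof -
  let ?W = "{z \<in> U \<times> (UNIV :: 'e set). fd h (fst z) e \<noteq> 0}"
  let ?N = "{z. (0, e) \<bullet> z = 0} \<inter> ?W"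
  define G where "G z = (fst z, snd z - (P (Suc 0) (\<lambda>x. 0) z / fd h (fst z) e) *\<^sub>R e)" for z
  have W: "open ?W" by (rule open_noncritical[OF e])
  have "smooth_on G ?W"
    unfolding G_def[abs_def]
    by (intro smooth_on_Pair smooth_on_diff smooth_on_scaleR smooth_on_divide smooth_on_const W
        fd_h_quotient e smooth_on_linear bounded_linear_fst bounded_linear_snd
        smooth_on_subset[OF smooth_P[OF smooth_on_const]]) auto
  from smooth_on_differentiable[OF this] have "G differentiable_on ?N"
    unfolding differentiable_on_def by (meson Int_iff differentiable_at_withinI)
  moreover have "negligible ?N"
    by (rule negligible_subset[OF negligible_hyperplane[of "(0, e)" 0]]) (use e in \<open>auto simp: zero_prod_def\<close>)
  ultimately have "negligible (G ` ?N)"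
    by (intro negligible_differentiable_image_negligible) auto
  moreover have "tangent_zeros e \<subseteq> G ` ?N"
  proof
    fix z assume z: "z \<in> tangent_zeros e"
    obtain x v where xv: "z = (x, v)" by (cases z)
    have x: "x \<in> U" "fd h x e \<noteq> 0" "fd h x v = 0" using z unfolding xv in_tangent_zeros by auto
    have lin: "linear (fd h x)" by (intro linear_fd smooth_on_differentiable[OF smooth_h x(1)])
    define w where "w = v - (v \<bullet> e) *\<^sub>R e"
    have "fd h x w = - (v \<bullet> e) * fd h x e"
      unfolding w_def linear_diff[OF lin] linear_scale[OF lin] using x(3) by simp
    then have "z = G (x, w)"
      using x(2) unfolding G_def xv fst_conv snd_conv P_1[OF x(1)] by (simp add: w_def)
    moreover have "(x, w) \<in> ?N"
      using x e by (simp add: w_def inner_diff_right inner_commute)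
    ultimately show "z \<in> G ` ?N" by blast
  qed
  ultimately show ?thesis by (rule negligible_subset)
qed

lemma residual_nonconstant_along:
  assumes e: "e \<in> Basis"
  shows "residual_in X {V \<in> smooth_functions A. \<forall>z \<in> tangent_zeros e. \<exists>k\<ge>2. P k (loc V) z \<noteq> 0}"
proof -
  \<comment> \<open>The numbering turns basis vectors into orders of differentiation. The equations
    are \<open>P 2\<close> up to \<open>P (DIM('e \<times> 'e) + 1)\<close>; \<open>P 1\<close> is
    already spent on the hypersurface.\<close>
  obtain num :: "'e \<times> 'e \<Rightarrow> nat" where num: "bij_betw num Basis {..<DIM('e \<times> 'e)}"
    using ex_bij_betw_finite_nat[OF finite_Basis] unfolding lessThan_atLeast0 by blast
  interpret avoidance A c "\<lambda>b. P (num b + 2)" "\<lambda>b. P' (num b + 2)" "tangent_zeros e"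
  proof
    show "diffop U (P (num b + 2)) (P' (num b + 2))" for b by (rule diffop_P)
    show "tangent_zeros e \<subseteq> U \<times> UNIV" by (auto simp: tangent_zeros_def)
    show "negligible (tangent_zeros e)" by (rule negligible_tangent_zeros[OF e])
    fix V :: "'e \<Rightarrow> real" and z :: "'e \<times> 'e"
    assume V: "smooth_on V U" and z: "z \<in> tangent_zeros e"
      and bad: "\<forall>b\<in>Basis. P (num b + 2) V z = 0"
    obtain x v where xv: "z = (x, v)" by (cases z)
    have x: "x \<in> U" "v \<noteq> 0" "fd h x e \<noteq> 0" "fd h x v = 0" using z unfolding xv in_tangent_zeros by auto
    obtain \<beta> K where \<beta>: "smooth_on \<beta> UNIV" "\<And>y. y \<notin> K \<Longrightarrow> \<beta> y = (0::real)" "\<beta> x > 0"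
      and K: "compact K" "K \<subseteq> U"
      using smooth_bump_exists[OF U x(1)] by blast
    have \<beta>U: "smooth_on \<beta> U" by (rule smooth_on_subset[OF \<beta>(1)]) simp
    define \<phi> where "\<phi> i y = \<beta> y * ((h y - h x) * (v \<bullet> (y - x)) ^ num i)" for i y
    have \<phi>: "smooth_on (\<phi> i) U" for i
      unfolding \<phi>_def[abs_def]
      by (intro smooth_on_mult smooth_on_diff smooth_on_power smooth_on_inner smooth_on_id
          smooth_on_const U \<beta>U smooth_h)
    \<comment> \<open>Order 1 vanishes on the hypersurface, and order \<open>k \<ge> 2\<close> by
      the equation numbered \<open>k - 2\<close>.\<close>
    have flat: "P k V (x, v) = 0" if "1 \<le> k" "k \<le> num i" "i \<in> Basis" for k i
    proof (cases "k = 1")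
      case True
      then show ?thesis using P_1[OF x(1)] x(4) by simp
    next
      case False
      have "num i < DIM('e \<times> 'e)" using bij_betwE[OF num] that(3) by blast
      then have "k - 2 \<in> {..<DIM('e \<times> 'e)}" using that(2) by (simp only: lessThan_iff)
      then obtain b where "b \<in> Basis" "num b = k - 2" using num unfolding bij_betw_def by (metis imageE)
      moreover from this have "num b + 2 = k" using False that(1) by simp
      ultimately show ?thesis using bad unfolding xv by metis
    qed
    define w where "w = (\<Sum>i\<in>Basis. fd h x i *\<^sub>R i)"
    have fd_w: "fd h x u = w \<bullet> u" for u
    proof -
      have "fd h x u = (\<Sum>i\<in>Basis. (u \<bullet> i) *\<^sub>R fd h x i)"
        by (rule fd_eq_sum_Basis[OF smooth_on_differentiable[OF smooth_h x(1)]])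
      then show ?thesis
        unfolding w_def inner_sum_left inner_scaleR_left by (simp add: inner_commute mult.commute)
    qed
    have "w \<noteq> 0" using x(3) fd_w[of e] by auto
    then have G: "(\<Sum>i\<in>Basis. fd h x i * fd h x (H i x)) > 0"
      using pos[OF x(1)] by (simp add: fd_w)
    have diag: "P' (num i + 2) V (\<phi> i) z \<noteq> 0" if "i \<in> Basis" for i
    proof -
      have "P' (num i + 2) V (\<phi> i) z = - (fact (num i) * (v \<bullet> v) ^ num i *
          (\<beta> x * (\<Sum>i\<in>Basis. fd h x i * fd h x (H i x))))"
        unfolding \<phi>_def[abs_def] xv by (rule P'_perturbation(2)[OF V x(1) \<beta>U flat[OF _ _ that]])
      then show ?thesis using G \<beta>(3) x(2) by simp
    qed
    have upper: "P' (num b + 2) V (\<phi> i) z = 0" if "i \<in> Basis" "num b < num i" for b i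
      unfolding \<phi>_def[abs_def] xv
      by (rule P'_perturbation(1)[OF V x(1) \<beta>U flat[OF _ _ that(1)]]) (use that(2) in auto)
    have "s = 0" if s: "\<forall>b\<in>Basis. (\<Sum>i\<in>Basis. (s \<bullet> i) * P' (num b + 2) V (\<phi> i) z) = 0" for s :: "'e \<times> 'e"
    proof -
      \<comment> \<open>Forward substitution: in row \<open>b\<close> the directions with larger
        number have entry 0 by \<open>upper\<close>, those with smaller number have coefficient 0 by
        induction, and the diagonal entry is nonzero.\<close>
      have "s \<bullet> b = 0" if "b \<in> Basis" for b
        using that
      proof (induction "num b" arbitrary: b rule: less_induct)
        case less
        have "(s \<bullet> i) * P' (num b + 2) V (\<phi> i) z =
            (if i = b then (s \<bullet> b) * P' (num b + 2) V (\<phi> b) z else 0)" if i: "i \<in> Basis" for i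
        proof -
          consider "num i < num b" | "num b < num i" | "i = b"
            using num i less.prems unfolding bij_betw_def inj_on_def by (metis nat_neq_iff)
          then show ?thesis
          proof cases
            case 1
            then have "s \<bullet> i = 0" "i \<noteq> b" using less.hyps i by auto
            then show ?thesis by simp
          next
            case 2
            then have "i \<noteq> b" by auto
            then show ?thesis using upper[OF i 2] by simp
          qed simp
        qed
        then have "(\<Sum>i\<in>Basis. (s \<bullet> i) * P' (num b + 2) V (\<phi> i) z) =
            (\<Sum>i\<in>Basis. if i = b then (s \<bullet> b) * P' (num b + 2) V (\<phi> b) z else 0)"
          by (rule sum.cong[OF refl])
        also have "\<dots> = (s \<bullet> b) * P' (num b + 2) V (\<phi> b) z"
          using less.prems by (simp only: sum.delta finite_Basis if_True)
        finally have "(s \<bullet> b) * P' (num b + 2) V (\<phi> b) z = 0" using bspec[OF s less.prems] by simp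
        then show ?case using diag[OF less.prems] by (metis mult_eq_0_iff)
      qed
      then show ?thesis by (metis euclidean_eq_iff inner_zero_left)
    qed
    then show "\<exists>\<phi> K. compact K \<and> K \<subseteq> U \<and>
        (\<forall>i\<in>(Basis::('e \<times> 'e) set). smooth_on (\<phi> i) U \<and> (\<forall>x\<in>U - K. \<phi> i x = 0)) \<and>
        (\<forall>s. (\<forall>b\<in>Basis. (\<Sum>i\<in>Basis. (s \<bullet> i) * P' (num b + 2) V (\<phi> i) z) = 0) \<longrightarrow> s = 0)"
      using K \<phi> \<beta>(2) by (intro exI[of _ \<phi>] exI[of _ K] conjI ballI allI impI) (auto simp: \<phi>_def)
  qed
  let ?W = "{z \<in> U \<times> (UNIV :: 'e set). snd z \<noteq> 0 \<and> fd h (fst z) e \<noteq> 0}"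
  have "open ({z \<in> U \<times> (UNIV :: 'e set). fd h (fst z) e \<noteq> 0} \<inter> snd -` (- {0}))"
    by (intro open_Int open_noncritical e open_vimage_snd open_Compl closed_singleton)
  moreover have "{z \<in> U \<times> (UNIV :: 'e set). fd h (fst z) e \<noteq> 0} \<inter> snd -` (- {0}) = ?W" by auto
  ultimately have "open ?W" by simp
  moreover have "continuous_on ?W (P (Suc 0) (\<lambda>x. 0))"
    by (rule continuous_on_subset[OF smooth_on_continuous[OF smooth_P[OF smooth_on_const]]]) auto
  ultimately have "\<exists>K::nat \<Rightarrow> ('e \<times> 'e) set. (\<forall>n. compact (K n)) \<and> tangent_zeros e = (\<Union>n. K n)"
    unfolding tangent_zeros_def by (rule sigma_compact_zeros)
  then obtain K where "\<And>n::nat. compact (K n)" "tangent_zeros e = (\<Union>n. K n)"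
    by (elim exE conjE) (rule that, erule spec)
  from residual_avoids[OF this] have "residual_in X {V \<in> smooth_functions A. avoids V (tangent_zeros e)}" .
  then show ?thesis
  proof (rule residual_in_mono)
    show "{V \<in> smooth_functions A. avoids V (tangent_zeros e)} \<subseteq>
        {V \<in> smooth_functions A. \<forall>z \<in> tangent_zeros e. \<exists>k\<ge>2. P k (loc V) z \<noteq> 0}"
      unfolding avoids_def
    proof (intro subsetI CollectI, elim CollectE conjE, intro conjI ballI, assumption)
      fix V z assume "\<forall>z\<in>tangent_zeros e. \<exists>b\<in>Basis. P (num b + 2) (loc V) z \<noteq> 0" "z \<in> tangent_zeros e"
      then obtain b where "P (num b + 2) (loc V) z \<noteq> 0" by (elim ballE bexE) auto
      then show "\<exists>k\<ge>2. P k (loc V) z \<noteq> 0" by (intro exI[of _ "num b + 2"] conjI) simp_all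
    qed
  qed (auto simp: topspace_strong_topology[OF A])
qed

lemma residual_not_conserved:
  "residual_in X {V \<in> smooth_functions A. \<forall>x\<in>U. \<forall>v. v \<noteq> 0 \<and> (\<exists>e\<in>Basis. fd h x e \<noteq> 0) \<longrightarrow>
    (\<exists>k\<ge>1. P k (loc V) (x, v) \<noteq> 0)}" (is "residual_in X ?D")
proof (rule residual_in_mono[OF residual_in_INT[OF countable_finite[OF finite_Basis] residual_nonconstant_along]])
  let ?C = "\<lambda>e. {V \<in> smooth_functions A. \<forall>z\<in>tangent_zeros e. \<exists>k\<ge>2. P k (loc V) z \<noteq> 0}"
  show "topspace X \<inter> (\<Inter>e\<in>Basis. ?C e) \<subseteq> ?D"
  proof (intro subsetI CollectI conjI ballI allI impI)
    fix V and x v :: 'e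
    assume V: "V \<in> topspace X \<inter> (\<Inter>e\<in>Basis. ?C e)"
    then show "V \<in> smooth_functions A" using topspace_strong_topology[OF A] by blast
    assume x: "x \<in> U" and v: "v \<noteq> 0 \<and> (\<exists>e\<in>Basis. fd h x e \<noteq> 0)"
    then obtain e where e: "e \<in> Basis" "fd h x e \<noteq> 0" by blast
    show "\<exists>k\<ge>1. P k (loc V) (x, v) \<noteq> 0"
    proof (cases "fd h x v = 0")
      case True
      then have "(x, v) \<in> tangent_zeros e" using x v e by (simp add: in_tangent_zeros)
      then obtain k where "k \<ge> 2" "P k (loc V) (x, v) \<noteq> 0" using V e(1) by blast
      then show ?thesis by (intro exI[of _ k]) auto
    next
      case False
      then show ?thesis using P_1[OF x] by (metis One_nat_def order_refl)
    qed
  qed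
qed (auto simp: topspace_strong_topology[OF A])

text \<open>By the equation of motion the lifted curve \<open>(y, y')\<close> follows the spray, so
  \<open>P (Suc k)\<close> is the time derivative of \<open>P k\<close> along it and constancy
  propagates from each order to the next.\<close>

lemma conserved_along_solution:
  assumes J: "open J" and V: "smooth_on V U"
    and y: "\<And>t. t \<in> J \<Longrightarrow> y t \<in> U" "\<And>t. t \<in> J \<Longrightarrow> (y has_vector_derivative y' t) (at t)"
    and y': "\<And>t. t \<in> J \<Longrightarrow> (y' has_vector_derivative
      a (y t, y' t) - (\<Sum>j\<in>Basis. partials [j] V (y t) *\<^sub>R H j (y t))) (at t)"
    and h: "\<And>t. t \<in> J \<Longrightarrow> h (y t) = C"
  shows "t \<in> J \<Longrightarrow> P (Suc k) V (y t, y' t) = 0"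
proof (induction k arbitrary: t)
  have chain: "((\<lambda>s. P k V (y s, y' s)) has_real_derivative P (Suc k) V (y t, y' t)) (at t)"
    if "t \<in> J" for t k
  proof -
    have "((\<lambda>s. (y s, y' s)) has_vector_derivative spray V (y t, y' t)) (at t)"
      using has_vector_derivative_Pair[OF y(2) y', OF that that] by (simp add: spray_def)
    moreover have "(P k V has_derivative fd (P k V) (y t, y' t)) (at (y t, y' t))"
      using y(1)[OF that] by (intro has_derivative_fd smooth_on_differentiable[OF smooth_P[OF V]]) simp
    ultimately have "((P k V \<circ> (\<lambda>s. (y s, y' s))) has_vector_derivative
        fd (P k V) (y t, y' t) (spray V (y t, y' t))) (at t)"
      by (rule vector_derivative_diff_chain_within[of _ _ _ UNIV, simplified, OF _ has_derivative_at_withinI])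
    then show ?thesis by (simp add: comp_def has_real_derivative_iff_has_vector_derivative)
  qed
  have const: "P (Suc k) V (y t, y' t) = 0" if "t \<in> J" "\<And>s. s \<in> J \<Longrightarrow> P k V (y s, y' s) = C'" for t k C'
  proof -
    have "((\<lambda>s. P k V (y s, y' s)) has_real_derivative 0) (at t)"
      by (rule has_field_derivative_transform_within_open[OF DERIV_const J that(1)])
        (simp add: that(2) del: P.simps)
    then show ?thesis using chain[OF that(1)] DERIV_unique by blast
  qed
  {
    case 0
    then show ?case using const[of t 0 C] h by simp
  next
    case (Suc k)
    then show ?case using const[of t "Suc k" 0] by blast
  }
qed

end


section \<open>The Euler-Lagrange equation in a chart\<close>

lemma bilinear_eq_sum_Basis:
  fixes B :: "'a::euclidean_space \<Rightarrow> 'a \<Rightarrow> real"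
  assumes "bilinear B"
  shows "B v w = (\<Sum>i\<in>Basis. \<Sum>j\<in>Basis. (v \<bullet> i) * (w \<bullet> j) * B i j)"
proof -
  have "B v w = B (\<Sum>i\<in>Basis. (v \<bullet> i) *\<^sub>R i) (\<Sum>i\<in>Basis. (w \<bullet> i) *\<^sub>R i)"
    by (simp add: euclidean_representation)
  then show ?thesis
    unfolding bilinear_sum[OF assms] sum.cartesian_product[symmetric] bilinear_lmul[OF assms]
      bilinear_rmul[OF assms] by (simp add: mult_ac)
qed

text \<open>Schur complement: the inverse on \<open>span B\<close> is extended to \<open>span (insert b B)\<close> by the rank-one
  projection to the \<open>G\<close>-orthogonal complement \<open>u\<close> of \<open>b\<close>.\<close>

lemma smooth_inverse_on_span:
  fixes U :: "'e::euclidean_space set" and G :: "'e \<Rightarrow> 'e \<Rightarrow> 'e \<Rightarrow> real"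
  assumes U: "open U" and bil: "\<And>x. x \<in> U \<Longrightarrow> bilinear (G x)"
    and sym: "\<And>x v w. x \<in> U \<Longrightarrow> G x v w = G x w v"
    and pos: "\<And>x v. x \<in> U \<Longrightarrow> v \<noteq> 0 \<Longrightarrow> G x v v > 0"
    and smooth: "\<And>i j. i \<in> Basis \<Longrightarrow> j \<in> Basis \<Longrightarrow> smooth_on (\<lambda>x. G x i j) U"
    and "finite B" "B \<subseteq> Basis"
  shows "\<exists>H. (\<forall>j\<in>Basis. smooth_on (H j) U) \<and> (\<forall>x\<in>U. \<forall>w. (\<Sum>j\<in>Basis. (w \<bullet> j) *\<^sub>R H j x) \<in> span B \<and>
    (\<forall>e\<in>span B. G x (\<Sum>j\<in>Basis. (w \<bullet> j) *\<^sub>R H j x) e = w \<bullet> e))"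
  using assms(6,7)
proof (induction B)
  case empty
  have "G x 0 0 = 0" if "x \<in> U" for x using bilinear_lzero[OF bil[OF that]] .
  then show ?case by (intro exI[of _ "\<lambda>j x. 0"]) simp
next
  case (insert b B)
  then have "B \<subseteq> Basis" by blast
  from insert.IH[OF this] obtain H where H0: "\<forall>j\<in>Basis. smooth_on (H j) U"
    and inv: "\<forall>x\<in>U. \<forall>w. (\<Sum>j\<in>Basis. (w \<bullet> j) *\<^sub>R H j x) \<in> span B \<and>
      (\<forall>e\<in>span B. G x (\<Sum>j\<in>Basis. (w \<bullet> j) *\<^sub>R H j x) e = w \<bullet> e)"
    by (elim exE conjE)
  then have H: "smooth_on (H j) U" if "j \<in> Basis" for j using that by blast
  define L where "L x w = (\<Sum>j\<in>Basis. (w \<bullet> j) *\<^sub>R H j x)" for x w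
  have L: "L x w \<in> span B" "\<And>e. e \<in> span B \<Longrightarrow> G x (L x w) e = w \<bullet> e" if "x \<in> U" for x w
    using bspec[OF inv that] unfolding L_def by auto
  define \<gamma> where "\<gamma> x = (\<Sum>k\<in>Basis. G x b k *\<^sub>R k)" for x
  have \<gamma>: "\<gamma> x \<bullet> e = G x b e" if "x \<in> U" for x e
  proof -
    have "linear (G x b)" using bil[OF that] by (simp add: bilinear_def)
    from linear_eq_sum_Basis[OF this, of e] show ?thesis
      unfolding \<gamma>_def inner_sum_left inner_scaleR_left by (simp add: inner_commute mult.commute)
  qed
  \<comment> \<open>\<open>\<gamma> x\<close> represents the functional \<open>G x b\<close>, so
    \<open>L x (\<gamma> x)\<close> is the \<open>G x\<close>-orthogonal projection of
    \<open>b\<close> to \<open>span B\<close>.\<close>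
  define u where "u x = b - L x (\<gamma> x)" for x
  \<comment> \<open>This is the squared \<open>G x\<close>-length of \<open>u x\<close>, written out
    in the coefficients of \<open>G\<close> because their smoothness is what is given.\<close>
  define n where "n x = (\<Sum>i\<in>Basis. \<Sum>j\<in>Basis. (u x \<bullet> i) * (u x \<bullet> j) * G x i j)" for x
  have n: "n x = G x (u x) (u x)" if "x \<in> U" for x
    unfolding n_def by (rule bilinear_eq_sum_Basis[OF bil[OF that], symmetric])
  have u_orth: "G x (u x) e = 0" if "x \<in> U" "e \<in> span B" for x e
    using L(2)[OF that, of "\<gamma> x"] \<gamma>[OF that(1)] by (simp add: u_def bilinear_lsub[OF bil[OF that(1)]])
  have n_pos: "n x > 0" if "x \<in> U" for x
  proof -
    have "b \<notin> span B"
    proof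
      assume "b \<in> span B"
      moreover have "B \<subseteq> Basis - {b}" using insert.prems insert.hyps by blast
      ultimately have "b \<in> span (Basis - {b})" using span_mono by blast
      then show False using independent_Basis insert.prems unfolding dependent_def by blast
    qed
    then have "u x \<noteq> 0" using L(1)[OF that, of "\<gamma> x"] by (auto simp: u_def)
    then show ?thesis using pos[OF that] n[OF that] by simp
  qed
  have b: "b \<in> Basis" using insert.prems by blast
  have \<gamma>_smooth: "smooth_on \<gamma> U"
    unfolding \<gamma>_def[abs_def] by (intro smooth_on_sum smooth_on_scaleR smooth_on_const smooth b U)
  have u: "smooth_on u U"
    unfolding u_def[abs_def] L_def
    by (intro smooth_on_diff smooth_on_sum smooth_on_scaleR smooth_on_inner smooth_on_const \<gamma>_smooth U H)
  have n_smooth: "smooth_on n U"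
    unfolding n_def[abs_def]
    by (intro smooth_on_sum smooth_on_mult smooth_on_inner smooth_on_const smooth u U)
  define H' where "H' j x = H j x + ((j \<bullet> u x) / n x) *\<^sub>R u x" for j x
  have "smooth_on (H' j) U" if "j \<in> Basis" for j
    unfolding H'_def[abs_def]
    by (intro smooth_on_add smooth_on_scaleR smooth_on_divide smooth_on_inner smooth_on_const u U n_smooth H that)
      (use n_pos in fastforce)
  moreover have "(\<Sum>j\<in>Basis. (w \<bullet> j) *\<^sub>R H' j x) \<in> span (insert b B) \<and>
      (\<forall>e\<in>span (insert b B). G x (\<Sum>j\<in>Basis. (w \<bullet> j) *\<^sub>R H' j x) e = w \<bullet> e)" if x: "x \<in> U" for x w
  proof -
    note bl = bil[OF x]
    have "(\<Sum>j\<in>Basis. (w \<bullet> j) * ((j \<bullet> u x) / n x)) = (w \<bullet> u x) / n x"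
      unfolding euclidean_inner[of w "u x"] by (simp add: sum_divide_distrib inner_commute)
    then have L': "(\<Sum>j\<in>Basis. (w \<bullet> j) *\<^sub>R H' j x) = L x w + ((w \<bullet> u x) / n x) *\<^sub>R u x"
      unfolding H'_def L_def by (simp add: scaleR_add_right sum.distrib scaleR_sum_left[symmetric])
    have sub: "span B \<subseteq> span (insert b B)" by (rule span_mono) blast
    have "u x \<in> span (insert b B)"
      unfolding u_def using L(1)[OF x] sub by (intro span_diff) (auto intro: span_base)
    then have "L x w + ((w \<bullet> u x) / n x) *\<^sub>R u x \<in> span (insert b B)"
      using L(1)[OF x] sub by (intro span_add span_scale) auto
    moreover have "G x (L x w + ((w \<bullet> u x) / n x) *\<^sub>R u x) e = w \<bullet> e" if e: "e \<in> span (insert b B)" for e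
    proof -
      obtain k where k: "e - k *\<^sub>R b \<in> span B" using e span_breakdown_eq by blast
      define e' where "e' = e - k *\<^sub>R u x"
      have "e' = (e - k *\<^sub>R b) + k *\<^sub>R L x (\<gamma> x)" by (simp add: e'_def u_def algebra_simps)
      then have e': "e' \<in> span B" using k L(1)[OF x] by (simp add: span_add span_scale)
      have e_eq: "e = e' + k *\<^sub>R u x" by (simp add: e'_def)
      have "G x (L x w) (u x) = 0" using u_orth[OF x L(1)[OF x]] sym[OF x] by metis
      then show ?thesis
        using L(2)[OF x e', of w] u_orth[OF x e'] n[OF x] n_pos[OF x]
        unfolding e_eq by (simp add: bilinear_ladd[OF bl] bilinear_lmul[OF bl] bilinear_radd[OF bl]
            bilinear_rmul[OF bl] inner_add_right)
    qed
    ultimately show ?thesis unfolding L' by blast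
  qed
  ultimately show ?case by (intro exI[of _ H']) blast
qed

section \<open>Metric and Lagrangian in coordinates\<close>

locale riemannian_chart = smooth_chart A c
  for A :: "('q::{second_countable_topology,t2_space}, 'e::euclidean_space) chart set" and c +
  fixes g :: "'q \<Rightarrow> ('q, 'e) tangent \<Rightarrow> ('q, 'e) tangent \<Rightarrow> real"
  assumes g: "riemannian_metric A g"
begin

abbreviation tangent :: "'e \<Rightarrow> 'e \<Rightarrow> ('q, 'e) tangent" where
  "tangent x v \<equiv> tangent_of_coords A c (chart_inv c x) v"

definition G :: "'e \<Rightarrow> 'e \<Rightarrow> 'e \<Rightarrow> real" where
  "G x v w = g (chart_inv c x) (tangent x v) (tangent x w)"

lemma transition_differentiable:
  assumes "d \<in> A" "d' \<in> A" "p \<in> chart_dom d" "p \<in> chart_dom d'"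
  shows "(chart_map d' \<circ> chart_inv d) differentiable at (chart_map d p)"
  unfolding comp_def
  by (rule smooth_on_differentiable[OF transition_smooth[OF A assms(1,2)]]) (use assms(3,4) in blast)

text \<open>The chain rule on the common part of the three chart domains: changing coordinates from
  \<open>c\<close> to \<open>d\<close> and then to \<open>d'\<close> is the direct change from
  \<open>c\<close> to \<open>d'\<close>.\<close>

lemma tangent_in_tangent_space:
  assumes x: "x \<in> U"
  shows "tangent x v \<in> tangent_space A (chart_inv c x)"
  unfolding tangent_space_def
proof (intro CollectI conjI ballI allI impI)
  let ?p = "chart_inv c x"
  have p: "?p \<in> chart_dom c" "chart_map c ?p = x" using chart_facts(6,7)[OF A c x] by auto
  show "tangent x v d = 0" if "\<not> (d \<in> A \<and> ?p \<in> chart_dom d)" for d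
    using that unfolding tangent_of_coords_def by auto
  fix d d' assume d: "d \<in> A" and d': "d' \<in> A" and pd: "?p \<in> chart_dom d \<and> ?p \<in> chart_dom d'"
  let ?W = "chart_map c ` (chart_dom c \<inter> (chart_dom d \<inter> chart_dom d'))"
  have W: "open ?W" using chart_facts(1)[OF A] d d' by (intro open_chart_image[OF A c] open_Int)
  have xW: "x \<in> ?W" using p pd x by (intro in_chart_image[OF A c]) auto
  have "fd (chart_map d' \<circ> chart_inv c) x = fd (\<lambda>y. (chart_map d' \<circ> chart_inv d) ((chart_map d \<circ> chart_inv c) y)) x"
  proof (rule fd_cong_open[OF W xW])
    fix y assume "y \<in> ?W"
    then obtain r where r: "y = chart_map c r" "r \<in> chart_dom c \<inter> (chart_dom d \<inter> chart_dom d')" by (rule imageE)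
    then show "(chart_map d' \<circ> chart_inv c) y = (chart_map d' \<circ> chart_inv d) ((chart_map d \<circ> chart_inv c) y)"
      using chart_facts(5)[OF A c, of r] chart_facts(5)[OF A d, of r] by simp
  qed
  also have "\<dots> = (\<lambda>v. fd (chart_map d' \<circ> chart_inv d) (chart_map d ?p) (fd (chart_map d \<circ> chart_inv c) x v))"
    using fd_compose[of "chart_map d' \<circ> chart_inv d" "chart_map d \<circ> chart_inv c" x]
      transition_differentiable[OF d d'] transition_differentiable[OF c d p(1)] pd p by simp
  finally show "tangent x v d' = fd (chart_map d' \<circ> chart_inv d) (chart_map d ?p) (tangent x v d)"
    using d d' pd p(2) by (simp add: tangent_of_coords_def)
qed

lemma tangent_linear:
  assumes x: "x \<in> U"
  shows "tangent x (s *\<^sub>R v + w) = (\<lambda>d. s *\<^sub>R tangent x v d + tangent x w d)"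
proof
  fix d
  let ?p = "chart_inv c x"
  have p: "?p \<in> chart_dom c" using chart_facts(7)[OF A c x] .
  show "tangent x (s *\<^sub>R v + w) d = s *\<^sub>R tangent x v d + tangent x w d"
  proof (cases "d \<in> A \<and> ?p \<in> chart_dom d")
    case True
    then have "linear (fd (chart_map d \<circ> chart_inv c) (chart_map c ?p))"
      using transition_differentiable[OF c _ p] by (intro linear_fd) blast
    then show ?thesis using True by (simp add: tangent_of_coords_def linear_add linear_scale)
  qed (auto simp: tangent_of_coords_def)
qed

text \<open>Used for positivity of \<open>G\<close>: a nonzero coordinate vector must not represent
  the zero tangent vector.\<close>

lemma tangent_c: "x \<in> U \<Longrightarrow> tangent x v c = v"
proof -
  assume x: "x \<in> U"
  have "fd (chart_map c \<circ> chart_inv c) x = fd (\<lambda>y. y) x"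
    by (rule fd_cong_open[OF U x]) (use chart_facts(6)[OF A c] in simp)
  then show ?thesis
    using c chart_facts(6,7)[OF A c x] by (simp add: tangent_of_coords_def frechet_derivative_ident)
qed

lemma G_sym: "x \<in> U \<Longrightarrow> G x v w = G x w v"
  using g tangent_in_tangent_space unfolding riemannian_metric_def G_def by blast

lemma G_linear: "x \<in> U \<Longrightarrow> G x (s *\<^sub>R v + v') w = s * G x v w + G x v' w"
  unfolding G_def tangent_linear
  using g[unfolded riemannian_metric_def] tangent_in_tangent_space by blast

lemma G_bilinear: "x \<in> U \<Longrightarrow> bilinear (G x)"
proof -
  assume x: "x \<in> U"
  have 0: "G x 0 w = 0" for w using G_linear[OF x, of 1 0 0 w] by simp
  have "linear (\<lambda>v. G x v w)" for w
    by (rule linearI) (use G_linear[OF x, of 1] G_linear[OF x, of _ _ 0] 0 in auto)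
  then show ?thesis unfolding bilinear_def using G_sym[OF x] by (simp cong: G_sym)
qed

lemma G_pos: "x \<in> U \<Longrightarrow> v \<noteq> 0 \<Longrightarrow> G x v v > 0"
proof -
  assume x: "x \<in> U" and "v \<noteq> 0"
  then have "tangent x v \<noteq> (\<lambda>_. 0)" using tangent_c[OF x, of v] by metis
  then show ?thesis
    using g[unfolded riemannian_metric_def] tangent_in_tangent_space[OF x, of v] unfolding G_def by blast
qed

lemma G_smooth: "i \<in> Basis \<Longrightarrow> j \<in> Basis \<Longrightarrow> smooth_on (\<lambda>x. G x i j) U"
  using g c unfolding riemannian_metric_def G_def by blast

lemma G_sum: "x \<in> U \<Longrightarrow> G x v w = (\<Sum>i\<in>Basis. \<Sum>j\<in>Basis. (v \<bullet> i) * (w \<bullet> j) * G x i j)"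
  by (rule bilinear_eq_sum_Basis[OF G_bilinear])

lemma G_sum_left: "x \<in> U \<Longrightarrow> G x v w = (\<Sum>i\<in>Basis. (v \<bullet> i) * G x i w)"
  using linear_eq_sum_Basis[of "\<lambda>v. G x v w" v] G_bilinear[of x] by (simp add: bilinear_def)

abbreviation lagrangian :: "('q \<Rightarrow> real) \<Rightarrow> 'q \<times> ('q, 'e) tangent \<Rightarrow> real" where
  "lagrangian V \<equiv> \<lambda>(p, Y). kinetic_energy g (p, Y) - V p"

lemma local_lagrangian_eq:
  assumes "x \<in> U"
  shows "local_lagrangian A (lagrangian V) c x v = G x v v / 2 - loc V x"
proof -
  \<comment> \<open>The kinetic energy squares a square root, which is undone for a nonnegative
    argument.\<close>
  have "G x v v \<ge> 0"
    using G_pos[OF assms, of v] bilinear_lzero[OF G_bilinear[OF assms]] by (cases "v = 0") auto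
  then show ?thesis
    by (simp add: local_lagrangian_def kinetic_energy_def riemannian_norm_def G_def)
qed

lemma fd_lagrangian_velocity:
  assumes x: "x \<in> U"
  shows "fd (\<lambda>v. local_lagrangian A (lagrangian V) c x v) v w = G x v w"
proof -
  have "bounded_bilinear (G x)" using G_bilinear[OF x] bilinear_conv_bounded_bilinear by blast
  from bounded_bilinear.FDERIV[OF this has_derivative_ident has_derivative_ident, of v]
  have "((\<lambda>v. G x v v / 2 - loc V x) has_derivative (\<lambda>w. (G x v w + G x w v) / 2 - 0)) (at v)"
    by (intro has_derivative_diff has_derivative_const) (rule bounded_linear.has_derivative[OF bounded_linear_divide])
  from fd_eqI[OF this] show ?thesis using G_sym[OF x] unfolding local_lagrangian_eq[OF x] by simp
qed

lemma fd_lagrangian_position: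
  assumes V: "V \<in> smooth_functions A" and x: "x \<in> U"
  shows "fd (\<lambda>y. local_lagrangian A (lagrangian V) c y v) x w =
    (\<Sum>i\<in>Basis. \<Sum>j\<in>Basis. (v \<bullet> i) * (v \<bullet> j) * fd (\<lambda>x. G x i j) x w) / 2 - fd (loc V) x w"
proof -
  \<comment> \<open>The expansion leaves the coefficients \<open>G y i j\<close> to be
    differentiated, and these are the functions known to be smooth.\<close>
  have "fd (\<lambda>y. local_lagrangian A (lagrangian V) c y v) x =
     fd (\<lambda>y. (\<Sum>i\<in>Basis. \<Sum>j\<in>Basis. (v \<bullet> i) * (v \<bullet> j) * G y i j) / 2 - loc V y) x"
    by (rule fd_cong_open[OF U x]) (simp add: local_lagrangian_eq G_sum[symmetric])
  moreover have "((\<lambda>y. (\<Sum>i\<in>Basis. \<Sum>j\<in>Basis. (v \<bullet> i) * (v \<bullet> j) * G y i j) / 2 - loc V y) has_derivative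
    (\<lambda>w. (\<Sum>i\<in>Basis. \<Sum>j\<in>Basis. (v \<bullet> i) * (v \<bullet> j) * fd (\<lambda>x. G x i j) x w) / 2 - fd (loc V) x w)) (at x)"
    by (intro has_derivative_diff has_derivative_fd smooth_on_differentiable[OF smooth_loc[OF V] x]
        bounded_linear.has_derivative[OF bounded_linear_divide] has_derivative_sum has_derivative_mult_right
        smooth_on_differentiable[OF G_smooth x])
  ultimately show ?thesis by (simp add: fd_eqI)
qed

lemma inverse_metric_exists:
  "\<exists>H. (\<forall>j\<in>Basis. smooth_on (H j) U) \<and> (\<forall>x\<in>U. \<forall>w e. G x (\<Sum>j\<in>Basis. (w \<bullet> j) *\<^sub>R H j x) e = w \<bullet> e)"
  using smooth_inverse_on_span[OF U G_bilinear G_sym G_pos G_smooth finite_Basis order_refl]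
  by (simp add: span_Basis)

text \<open>Minus the Christoffel symbols of the first kind, contracted twice with the velocity: the
  covector that becomes the geodesic acceleration once its index is raised by the inverse
  metric.\<close>

definition christoffel :: "'e \<times> 'e \<Rightarrow> 'e \<Rightarrow> real" where
  "christoffel z j =
    (\<Sum>i\<in>Basis. \<Sum>k\<in>Basis. (snd z \<bullet> i) * (snd z \<bullet> k) * fd (\<lambda>x. G x i k) (fst z) j) / 2
    - (\<Sum>i\<in>Basis. (snd z \<bullet> i) * fd (\<lambda>x. G x i j) (fst z) (snd z))"

lemma smooth_christoffel:
  assumes j: "j \<in> Basis"
  shows "smooth_on (\<lambda>z. christoffel z j) (U \<times> UNIV)"
proof -
  note O = open_tangent[OF U]
  have snd: "smooth_on snd (U \<times> (UNIV :: 'e set))"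
    by (intro smooth_on_linear bounded_linear_snd O)
  have "smooth_on (\<lambda>z. fd (\<lambda>x. G x i j) (fst z) (snd z)) (U \<times> (UNIV :: 'e set))" if i: "i \<in> Basis" for i
  proof (rule smooth_on_cong_open[OF O])
    show "smooth_on (\<lambda>z. fd (\<lambda>z. G (fst z) i j) z (snd z, 0)) (U \<times> (UNIV :: 'e set))"
      by (intro smooth_on_fd O smooth_on_fst_compose U G_smooth i j smooth_on_Pair snd smooth_on_const)
    show "fd (\<lambda>z. G (fst z) i j) z (snd z, 0) = fd (\<lambda>x. G x i j) (fst z) (snd z)"
      if "z \<in> U \<times> (UNIV :: 'e set)" for z
      using fd_fst_compose[of "\<lambda>x. G x i j" z "(snd z, 0)"] smooth_on_differentiable[OF G_smooth[OF i j]] that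
      by auto
  qed
  then show ?thesis
    unfolding christoffel_def
    by (intro smooth_on_diff smooth_on_divide smooth_on_sum smooth_on_mult smooth_on_inner snd
        smooth_on_const smooth_on_fst_compose smooth_on_fd_Basis G_smooth U O j) auto
qed

lemma chart_curve:
  assumes sol: "euler_lagrange_solution A (lagrangian V) I q" and J: "J = {t \<in> I. q t \<in> chart_dom c}"
  defines "y \<equiv> chart_map c \<circ> q" and "y' \<equiv> \<lambda>t. vector_derivative (chart_map c \<circ> q) (at t)"
  shows "open J" and "t \<in> J \<Longrightarrow> y t \<in> U" and "t \<in> J \<Longrightarrow> (y has_vector_derivative y' t) (at t)"
    and "t \<in> J \<Longrightarrow> (y' has_vector_derivative vector_derivative y' (at t)) (at t)"
proof -
  have I: "open I" "continuous_on I q" using sol unfolding euler_lagrange_solution_def by auto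
  have "J = I \<inter> q -` chart_dom c" using J by auto
  then show oJ: "open J" using continuous_open_preimage[OF I(2,1) chart_facts(1)[OF A c]] by simp
  show "t \<in> J \<Longrightarrow> y t \<in> U" by (auto simp: J y_def)
  have "Ck_on 2 y J"
    using sol c unfolding euler_lagrange_solution_def Let_def J y_def by blast
  \<comment> \<open>The basis of the reals is \<open>{1}\<close>, so the two levels of
    \<open>Ck_on 2\<close> are differentiability of the curve and of its velocity
    \<open>fd y t 1\<close>.\<close>
  then have y1: "y differentiable at t" and y2: "(\<lambda>t. fd y t 1) differentiable at t" if "t \<in> J" for t
    using that by (auto simp: numeral_2_eq_2 Ck_on_Suc[OF oJ])
  show vd: "(y has_vector_derivative y' t) (at t)" if "t \<in> J" for t
    using y1[OF that] vector_derivative_works unfolding y'_def y_def by blast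
  have eq: "fd y t 1 = y' t" if "t \<in> J" for t
    using vd[OF that] by (simp add: has_vector_derivative_def fd_eqI)
  show "(y' has_vector_derivative vector_derivative y' (at t)) (at t)" if "t \<in> J" for t
    using differentiable_cong_open[OF oJ that eq y2[OF that]] vector_derivative_works by blast
qed

lemma equation_of_motion:
  assumes V: "V \<in> smooth_functions A" and sol: "euler_lagrange_solution A (lagrangian V) I q"
    and H: "\<And>x w e. x \<in> U \<Longrightarrow> G x (\<Sum>j\<in>Basis. (w \<bullet> j) *\<^sub>R H j x) e = w \<bullet> e"
    and t: "t \<in> I" "q t \<in> chart_dom c"
  defines "y \<equiv> chart_map c \<circ> q" and "y' \<equiv> \<lambda>t. vector_derivative (chart_map c \<circ> q) (at t)"
  shows "vector_derivative y' (at t) = (\<Sum>j\<in>Basis. christoffel (y t, y' t) j *\<^sub>R H j (y t))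
    - (\<Sum>j\<in>Basis. partials [j] (loc V) (y t) *\<^sub>R H j (y t))"
proof -
  define J where "J = {t \<in> I. q t \<in> chart_dom c}"
  have curve: "open J" "\<And>s. s \<in> J \<Longrightarrow> y s \<in> U"
    "\<And>s. s \<in> J \<Longrightarrow> (y has_vector_derivative y' s) (at s)"
    "\<And>s. s \<in> J \<Longrightarrow> (y' has_vector_derivative vector_derivative y' (at s)) (at s)"
    unfolding y_def y'_def using chart_curve[OF sol J_def] by blast+
  have tJ: "t \<in> J" using t by (simp add: J_def)
  have yt: "y t \<in> U" by (rule curve(2)[OF tJ])
  let ?y'' = "vector_derivative y' (at t)"
  \<comment> \<open>The total force as a covector; its raised version is to be identified with the
    acceleration.\<close>
  define w where "w = (\<Sum>j\<in>Basis. (christoffel (y t, y' t) j - fd (loc V) (y t) j) *\<^sub>R j)"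
  have w: "w \<bullet> j = christoffel (y t, y' t) j - fd (loc V) (y t) j" if "j \<in> Basis" for j
    using that by (simp add: w_def)
  have "G (y t) ?y'' j = w \<bullet> j" if j: "j \<in> Basis" for j
  proof -
    have el: "((\<lambda>s. fd (\<lambda>v. local_lagrangian A (lagrangian V) c (y s) v) (y' s) j) has_real_derivative
        fd (\<lambda>x. local_lagrangian A (lagrangian V) c x (y' t)) (y t) j) (at t)"
      using sol c tJ unfolding euler_lagrange_solution_def Let_def J_def y_def y'_def by blast
    have "fd (\<lambda>v. local_lagrangian A (lagrangian V) c (y s) v) (y' s) j = (\<Sum>i\<in>Basis. (y' s \<bullet> i) * G (y s) i j)"
      if "s \<in> J" for s
      unfolding fd_lagrangian_velocity[OF curve(2)[OF that]] by (rule G_sum_left[OF curve(2)[OF that]])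
    with el have "((\<lambda>s. \<Sum>i\<in>Basis. (y' s \<bullet> i) * G (y s) i j) has_real_derivative
        fd (\<lambda>x. local_lagrangian A (lagrangian V) c x (y' t)) (y t) j) (at t)"
      by (rule has_field_derivative_transform_within_open[OF _ curve(1) tJ])
    moreover have "((\<lambda>s. \<Sum>i\<in>Basis. (y' s \<bullet> i) * G (y s) i j) has_real_derivative
        (\<Sum>i\<in>Basis. (y' t \<bullet> i) * fd (\<lambda>x. G x i j) (y t) (y' t) + (?y'' \<bullet> i) * G (y t) i j)) (at t)"
    proof (rule DERIV_sum)
      fix i :: 'e assume i: "i \<in> Basis"
      have "((\<lambda>s. y' s \<bullet> i) has_real_derivative ?y'' \<bullet> i) (at t)"
        using bounded_linear.has_vector_derivative[OF bounded_linear_inner_left curve(4)[OF tJ]]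
        by (simp add: has_real_derivative_iff_has_vector_derivative)
      moreover have "((\<lambda>s. G (y s) i j) has_real_derivative fd (\<lambda>x. G x i j) (y t) (y' t)) (at t)"
        using vector_derivative_diff_chain_within[of y "y' t" t UNIV "\<lambda>x. G x i j" "fd (\<lambda>x. G x i j) (y t)"]
          curve(3)[OF tJ] has_derivative_at_withinI[OF has_derivative_fd[OF smooth_on_differentiable[OF G_smooth[OF i j] yt]]]
        by (simp add: has_real_derivative_iff_has_vector_derivative comp_def)
      ultimately show "((\<lambda>s. (y' s \<bullet> i) * G (y s) i j) has_real_derivative
          (y' t \<bullet> i) * fd (\<lambda>x. G x i j) (y t) (y' t) + (?y'' \<bullet> i) * G (y t) i j) (at t)"
        by (rule DERIV_cong[OF DERIV_mult]) (simp add: mult.commute)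
    qed
    ultimately have "fd (\<lambda>x. local_lagrangian A (lagrangian V) c x (y' t)) (y t) j =
        (\<Sum>i\<in>Basis. (y' t \<bullet> i) * fd (\<lambda>x. G x i j) (y t) (y' t)) + (\<Sum>i\<in>Basis. (?y'' \<bullet> i) * G (y t) i j)"
      using DERIV_unique by (fastforce simp: sum.distrib)
    moreover have "G (y t) ?y'' j = (\<Sum>i\<in>Basis. (?y'' \<bullet> i) * G (y t) i j)" by (rule G_sum_left[OF yt])
    ultimately show ?thesis
      by (simp add: w[OF j] christoffel_def fd_lagrangian_position[OF V yt])
  qed
  then have zero: "G (y t) (?y'' - (\<Sum>j\<in>Basis. (w \<bullet> j) *\<^sub>R H j (y t))) j = 0" if "j \<in> Basis" for j
    using that by (simp add: bilinear_lsub[OF G_bilinear[OF yt]] H[OF yt])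
  \<comment> \<open>The difference of the two candidates pairs to 0 with every basis vector, hence
    with itself, and \<open>G\<close> is positive definite.\<close>
  then have "G (y t) \<delta> \<delta> = 0" if "\<delta> = ?y'' - (\<Sum>j\<in>Basis. (w \<bullet> j) *\<^sub>R H j (y t))" for \<delta>
  proof -
    have lin: "linear (G (y t) \<delta>)" using G_bilinear[OF yt] by (simp add: bilinear_def)
    have "G (y t) \<delta> \<delta> = (\<Sum>j\<in>Basis. (\<delta> \<bullet> j) *\<^sub>R G (y t) \<delta> j)" by (rule linear_eq_sum_Basis[OF lin])
    also have "\<dots> = 0" by (rule sum.neutral) (simp add: zero that)
    finally show ?thesis .
  qed
  then have "?y'' = (\<Sum>j\<in>Basis. (w \<bullet> j) *\<^sub>R H j (y t))" 
    using G_pos[OF yt, of "?y'' - (\<Sum>j\<in>Basis. (w \<bullet> j) *\<^sub>R H j (y t))"] by fastforce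
  then show ?thesis by (simp add: w scaleR_diff_left sum_subtractf)
qed

text \<open>Along a constant curve the momentum does not change and the metric term of the position
  derivative carries the factor \<open>v = 0\<close>, leaving \<open>dV = 0\<close>. Isolation of
  the critical points of \<open>V\<close> thus passes to the equilibria.\<close>

lemma equilibrium_imp_critical:
  assumes V: "V \<in> smooth_functions A" and p: "p \<in> equilibrium_points A (lagrangian V)" "p \<in> chart_dom c"
  shows "fd (loc V) (chart_map c p) w = 0"
proof -
  let ?x = "chart_map c p"
  have x: "?x \<in> U" using p(2) by blast
  have "euler_lagrange_solution A (lagrangian V) UNIV (\<lambda>_. p)" using p(1) by (simp add: equilibrium_points_def)
  then have "((\<lambda>s. fd (\<lambda>v. local_lagrangian A (lagrangian V) c ?x v) (vector_derivative (\<lambda>_. ?x) (at s)) w)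
      has_real_derivative
        fd (\<lambda>y. local_lagrangian A (lagrangian V) c y (vector_derivative (\<lambda>_. ?x) (at 0))) ?x w) (at (0::real))"
    using c p(2) unfolding euler_lagrange_solution_def Let_def comp_def by blast
  then have "fd (\<lambda>y. local_lagrangian A (lagrangian V) c y 0) ?x w = 0"
    using DERIV_unique[OF _ DERIV_const] by simp
  then show ?thesis by (simp add: fd_lagrangian_position[OF V x])
qed

end


text \<open>The open set \<open>J\<close> localises the statement to times when the curve is in this
  chart and \<open>h\<close> is known to be conserved. One residual set, fixed by the chart and
  \<open>h\<close>, serves all solutions, all \<open>J\<close> and all values
  \<open>C\<close>.\<close>

lemma (in riemannian_chart) residual_no_conserved_motion:
  fixes h :: "'e \<Rightarrow> real"
  assumes h: "smooth_on h U"
  shows "residual_in X {V \<in> smooth_functions A. \<forall>I q J t C.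
    euler_lagrange_solution A (lagrangian V) I q \<longrightarrow> open J \<longrightarrow> t \<in> J \<longrightarrow> J \<subseteq> I \<longrightarrow>
    (\<forall>s\<in>J. q s \<in> chart_dom c \<and> h (chart_map c (q s)) = C) \<longrightarrow>
    vector_derivative (chart_map c \<circ> q) (at t) \<noteq> 0 \<longrightarrow> (\<forall>e\<in>Basis. fd h (chart_map c (q t)) e = 0)}"
proof -
  obtain H where H: "\<And>j. j \<in> Basis \<Longrightarrow> smooth_on (H j) U"
    and inv: "\<And>x w e. x \<in> U \<Longrightarrow> G x (\<Sum>j\<in>Basis. (w \<bullet> j) *\<^sub>R H j x) e = w \<bullet> e"
    using inverse_metric_exists by blast
  define a where "a z = (\<Sum>j\<in>Basis. christoffel z j *\<^sub>R H j (fst z))" for z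
  interpret second_order A c a H h
  proof
    show "smooth_on a (U \<times> UNIV)"
      unfolding a_def[abs_def]
      by (intro smooth_on_sum smooth_on_scaleR smooth_christoffel smooth_on_fst_compose H U open_tangent)
    fix x w :: 'e assume x: "x \<in> U" and "w \<noteq> 0"
    let ?u = "\<Sum>j\<in>Basis. (w \<bullet> j) *\<^sub>R H j x"
    have "?u \<noteq> 0"
    proof
      assume "?u = 0"
      then have "w \<bullet> w = 0" using inv[OF x, of w w] bilinear_lzero[OF G_bilinear[OF x]] by simp
      then show False using \<open>w \<noteq> 0\<close> by simp
    qed
    \<comment> \<open>Pairing \<open>w\<close> with its raised vector \<open>?u\<close> gives
      \<open>G x ?u ?u\<close>, so the inverse metric inherits positivity.\<close>
    then have "w \<bullet> ?u > 0" using G_pos[OF x] inv[OF x, of w ?u] by metis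
    then show "0 < (\<Sum>j\<in>Basis. (w \<bullet> j) * (w \<bullet> H j x))" by (simp add: inner_sum_right)
  qed (use H h in auto)
  show ?thesis
  proof (rule residual_in_mono[OF residual_not_conserved], intro subsetI CollectI conjI allI impI ballI,
      elim CollectE conjE, assumption)
    fix V I q J t C e
    assume "V \<in> {V \<in> smooth_functions A. \<forall>x\<in>U. \<forall>v. v \<noteq> 0 \<and> (\<exists>e\<in>Basis. fd h x e \<noteq> 0) \<longrightarrow>
        (\<exists>k\<ge>1. P k (loc V) (x, v) \<noteq> 0)}"
    then have V: "V \<in> smooth_functions A"
      and good: "\<And>x v e. x \<in> U \<Longrightarrow> v \<noteq> 0 \<Longrightarrow> e \<in> Basis \<Longrightarrow> fd h x e \<noteq> 0 \<Longrightarrow>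
        \<exists>k\<ge>1. P k (loc V) (x, v) \<noteq> 0" by auto
    assume sol: "euler_lagrange_solution A (lagrangian V) I q" and J: "open J" "t \<in> J" "J \<subseteq> I"
      and cons: "\<forall>s\<in>J. q s \<in> chart_dom c \<and> h (chart_map c (q s)) = C"
      and nz: "vector_derivative (chart_map c \<circ> q) (at t) \<noteq> 0" and e: "(e::'e) \<in> Basis"
    define y where "y = chart_map c \<circ> q"
    define y' where "y' = (\<lambda>t. vector_derivative (chart_map c \<circ> q) (at t))"
    have mem: "s \<in> {t \<in> I. q t \<in> chart_dom c}" if "s \<in> J" for s using that J cons by blast
    have y: "y s \<in> U" "(y has_vector_derivative y' s) (at s)"
      "(y' has_vector_derivative vector_derivative y' (at s)) (at s)" if "s \<in> J" for s
      using chart_curve(2-4)[OF sol refl mem[OF that]] unfolding y_def y'_def by auto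
    have acc: "vector_derivative y' (at s) =
        a (y s, y' s) - (\<Sum>j\<in>Basis. partials [j] (loc V) (y s) *\<^sub>R H j (y s))" if "s \<in> J" for s
      using equation_of_motion[OF V sol inv, of s] mem[OF that] unfolding y_def y'_def a_def by simp
    have "P (Suc k) (loc V) (y t, y' t) = 0" for k
      using y acc cons by (intro conserved_along_solution[OF J(1) smooth_loc[OF V] _ _ _ _ J(2), of y y' C])
        (auto simp: y_def)
    then have "P k (loc V) (y t, y' t) = 0" if "k \<ge> 1" for k using that by (cases k) auto
    then show "fd h (chart_map c (q t)) e = 0"
      using good[OF y(1)[OF J(2)], of "y' t" e] nz e by (auto simp: y_def y'_def)
  qed (auto simp: topspace_strong_topology[OF A])
qed

section \<open>From single charts to the manifold\<close>

context
  fixes A :: "('q::{second_countable_topology,t2_space}, 'e::euclidean_space) chart set"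
  assumes A: "smooth_structure A"
begin

text \<open>Residual sets survive countable intersections, whereas the atlas is maximal; second
  countability enters here through the Lindelof property. The family \<open>B\<close> is arbitrary
  so that slice charts can be thinned out too.\<close>

lemma countable_subcharts:
  assumes "B \<subseteq> A"
  shows "\<exists>B'\<subseteq>B. countable B' \<and> (\<Union>c\<in>B'. chart_dom c) = (\<Union>c\<in>B. chart_dom c)"
proof -
  obtain \<F> where \<F>: "\<F> \<subseteq> chart_dom ` B" "countable \<F>" "\<Union>\<F> = \<Union>(chart_dom ` B)"
    by (rule Lindelof[of "chart_dom ` B"]) (use assms chart_facts(1)[OF A] in blast)
  then obtain B' where "countable B'" "B' \<subseteq> B" "\<F> = chart_dom ` B'"
    using countable_subset_image[of \<F> chart_dom B] by blast
  then show ?thesis using \<F>(3) by blast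
qed

lemma transition_has_derivative:
  assumes "c \<in> A" "d \<in> A" "p \<in> chart_dom c" "p \<in> chart_dom d"
  obtains D where "((\<lambda>x. chart_map c (chart_inv d x)) has_derivative D) (at (chart_map d p))"
  using smooth_on_differentiable[OF transition_smooth[OF A assms(2,1)], of "chart_map d p"] assms(3,4)
  unfolding differentiable_def by blast

text \<open>A critical point is defined by all charts around it, while the rigidity argument
  produces the condition in one chart; the chain rule transfers it.\<close>

lemma critical_pointI:
  assumes c: "c \<in> A" "p \<in> chart_dom c" and f: "f \<in> smooth_functions A"
    and crit: "\<And>e. e \<in> Basis \<Longrightarrow> fd (\<lambda>x. f (chart_inv c x)) (chart_map c p) e = 0"
  shows "critical_point A f p"
  unfolding critical_point_def
proof (intro ballI impI)
  fix d assume d: "d \<in> A" "p \<in> chart_dom d"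
  obtain D where D: "((\<lambda>x. chart_map c (chart_inv d x)) has_derivative D) (at (chart_map d p))"
    using transition_has_derivative[OF c(1) d(1) c(2) d(2)] .
  let ?f = "\<lambda>x. f (chart_inv c x)"
  have df: "?f differentiable at (chart_map c p)"
    using smooth_on_differentiable[OF smooth_functions_chart[OF A f c(1)]] c(2) by blast
  have "fd ?f (chart_map c p) = (\<lambda>v. 0)"
    using fd_eq_sum_Basis[OF df] crit by auto
  then have "(?f has_derivative (\<lambda>v. 0)) (at (chart_map c (chart_inv d (chart_map d p))))"
    using has_derivative_fd[OF df] chart_facts(5)[OF A d] by simp
  from has_derivative_compose[OF D this]
  have "((\<lambda>x. ?f (chart_map c (chart_inv d x))) has_derivative (\<lambda>v. 0)) (at (chart_map d p))" .
  then show "((f \<circ> chart_inv d) has_derivative (\<lambda>_. 0)) (at (chart_map d p))"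
  proof (rule has_derivative_transform_within_open)
    show "open (chart_map d ` (chart_dom d \<inter> chart_dom c))"
      by (rule open_chart_image[OF A d(1) chart_facts(1)[OF A c(1)]])
    show "chart_map d p \<in> chart_map d ` (chart_dom d \<inter> chart_dom c)" using c(2) d(2) by blast
    fix x assume "x \<in> chart_map d ` (chart_dom d \<inter> chart_dom c)"
    then obtain r where "x = chart_map d r" "r \<in> chart_dom d \<inter> chart_dom c" by (rule imageE)
    then show "f (chart_inv c (chart_map c (chart_inv d x))) = (f \<circ> chart_inv d) x"
      using chart_facts(5)[OF A d(1), of r] chart_facts(5)[OF A c(1), of r] by simp
  qed
qed

text \<open>Its contrapositive carries a nonzero velocity from a chart of the general cover to a
  slice chart.\<close>

lemma velocity_zero_transition:
  assumes c: "c \<in> A" and d: "d \<in> A" and J: "open J" "t \<in> J" "\<And>s. s \<in> J \<Longrightarrow> q s \<in> chart_dom c \<inter> chart_dom d"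
    and vel: "((chart_map d \<circ> q) has_vector_derivative 0) (at t)"
  shows "((chart_map c \<circ> q) has_vector_derivative 0) (at t)"
proof -
  have q: "q t \<in> chart_dom c" "q t \<in> chart_dom d" using J(2,3) by auto
  obtain D where D: "((\<lambda>x. chart_map c (chart_inv d x)) has_derivative D) (at ((chart_map d \<circ> q) t))"
    using transition_has_derivative[OF c d q] by auto
  have "D 0 = 0" using has_derivative_linear[OF D] by (rule linear_0)
  moreover have "(((\<lambda>x. chart_map c (chart_inv d x)) \<circ> (chart_map d \<circ> q)) has_vector_derivative D 0) (at t)"
    by (rule vector_derivative_diff_chain_within) (rule vel, rule has_derivative_at_withinI, rule D)
  ultimately have "(((\<lambda>x. chart_map c (chart_inv d x)) \<circ> (chart_map d \<circ> q)) has_vector_derivative 0) (at t)"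
    by simp
  then show ?thesis
  proof (rule has_vector_derivative_transform_within_open[OF _ J(1,2)])
    fix s assume "s \<in> J"
    then show "((\<lambda>x. chart_map c (chart_inv d x)) \<circ> (chart_map d \<circ> q)) s = (chart_map c \<circ> q) s"
      using chart_facts(5)[OF A d, of "q s"] J(3)[of s] by simp
  qed
qed

end

text \<open>The curve may cross many charts. Zero velocity makes it locally constant inside each,
  and connectedness of the interval does the rest.\<close>

lemma constant_on_if_stationary:
  fixes A :: "('q::{second_countable_topology,t2_space}, 'e::euclidean_space) chart set"
  assumes A: "smooth_structure A" and I: "open I" "is_interval I" "continuous_on I q"
    and stationary: "\<And>t. t \<in> I \<Longrightarrow> \<exists>c\<in>A. q t \<in> chart_dom c \<and>
      (\<forall>s\<in>I. q s \<in> chart_dom c \<longrightarrow> ((chart_map c \<circ> q) has_vector_derivative 0) (at (s::real)))"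
  shows "q constant_on I"
proof -
  have "\<forall>t\<in>I. \<forall>\<^sub>F s in at t within I. q t = q s"
  proof
    fix t assume t: "t \<in> I"
    then obtain c where c: "c \<in> A" "q t \<in> chart_dom c"
      and vel: "\<And>s. s \<in> I \<Longrightarrow> q s \<in> chart_dom c \<Longrightarrow> ((chart_map c \<circ> q) has_vector_derivative 0) (at s)"
      using stationary[OF t] by (elim bexE conjE) auto
    have "open (I \<inter> q -` chart_dom c)"
      by (rule continuous_open_preimage[OF I(3,1) chart_facts(1)[OF A c(1)]])
    then obtain r where r: "r > 0" "ball t r \<subseteq> I \<inter> q -` chart_dom c"
      by (rule openE[of _ t]) (use t c(2) in auto)
    have "q t = q s" if s: "s \<in> ball t r" for s
    proof -
      have "\<exists>C. \<forall>s\<in>ball t r. (chart_map c \<circ> q) s = C"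
      proof (rule has_derivative_zero_constant[OF convex_ball])
        fix s assume "s \<in> ball t r"
        then have "s \<in> I" "q s \<in> chart_dom c" using r(2) by auto
        from vel[OF this] have "((chart_map c \<circ> q) has_derivative (\<lambda>h. 0)) (at s)"
          by (simp add: has_vector_derivative_def)
        then show "((chart_map c \<circ> q) has_derivative (\<lambda>h. 0)) (at s within ball t r)"
          by (rule has_derivative_at_withinI)
      qed
      then have "chart_map c (q t) = chart_map c (q s)" using s r(1) by (elim exE) simp
      moreover have "q s \<in> chart_dom c" using s r(2) by blast
      ultimately show ?thesis
        using chart_facts(5)[OF A c(1) c(2)] chart_facts(5)[OF A c(1), of "q s"] by metis
    qed
    then show "\<forall>\<^sub>F s in at t within I. q t = q s"
      unfolding eventually_at using r(1) by (intro exI[of _ r]) (auto simp: dist_commute)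
  qed
  then show ?thesis
    unfolding constant_on_def using connected_local_const[OF is_interval_connected[OF I(2)]] by metis
qed

theorem theorem4p6:
  fixes A :: "('q::{second_countable_topology,t2_space}, 'e::euclidean_space) chart set"
    and g :: "'q \<Rightarrow> ('q, 'e) tangent \<Rightarrow> ('q, 'e) tangent \<Rightarrow> real"
    and F :: "'q \<Rightarrow> real"
  assumes "smooth_structure A"
    and "riemannian_metric A g"
    and "F \<in> smooth_functions A"
    and "\<exists>S. submanifold_of_codim 1 A S \<and> {p. critical_point A F p} \<subseteq> S"
  shows "\<exists>C. residual_in (strong_topology A) C \<and>
           (\<forall>V\<in>C. let L = (\<lambda>(p, X). kinetic_energy g (p, X) - V p) in
              \<not> (\<exists>I q. euler_lagrange_solution A L I q \<and>
                       \<not> q constant_on I \<and> (F \<circ> q) constant_on I) \<and>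
              discrete (equilibrium_points A L))"
proof -
  note A = assms(1) and g = assms(2) and F = assms(3)
  let ?X = "strong_topology A"
  let ?L = "\<lambda>V (p, Y). kinetic_energy g (p, Y) - V p"
  obtain S where S: "submanifold_of_codim 1 A S" "\<And>p. critical_point A F p \<Longrightarrow> p \<in> S"
    using assms(4) by blast
  have chart: "riemannian_chart A c g" if "c \<in> A" for c
    using A g that by unfold_locales
  obtain C0 where C0: "C0 \<subseteq> A" "countable C0" "\<And>p. \<exists>c\<in>C0. p \<in> chart_dom c"
    using countable_subcharts[OF A order_refl] chart_exists[OF A] by (metis UN_iff)
  \<comment> \<open>From a slice chart one keeps a normal vector of a hyperplane containing the
    image of \<open>S\<close>. The linear function it defines vanishes on \<open>S\<close> and has a
    differential that is nowhere 0.\<close>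
  define slice where "slice c \<nu> \<longleftrightarrow> \<nu> \<noteq> 0 \<and> (\<forall>p\<in>chart_dom c \<inter> S. \<nu> \<bullet> chart_map c p = 0)"
    for c :: "('q, 'e) chart" and \<nu>
  have "\<exists>c\<in>A. p \<in> chart_dom c \<and> (\<exists>\<nu>. slice c \<nu>)" if "p \<in> S" for p
  proof -
    from bspec[OF S(1)[unfolded submanifold_of_codim_def] that]
    obtain c L where c: "c \<in> A" "p \<in> chart_dom c" and L: "dim L + 1 = DIM('e)"
      "chart_map c ` (chart_dom c \<inter> S) = chart_img c \<inter> L"
      by (elim bexE conjE exE)
    have "dim L < DIM('e)" using L(1) by simp
    then obtain \<nu> where "\<nu> \<noteq> 0" "span L \<subseteq> {x. \<nu> \<bullet> x = 0}" using lowdim_subset_hyperplane by blast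
    moreover have "chart_map c r \<in> span L" if "r \<in> chart_dom c \<inter> S" for r
      using L(2) that span_base by blast
    ultimately show ?thesis using c unfolding slice_def by blast
  qed
  moreover obtain C1 where C1: "C1 \<subseteq> {c \<in> A. \<exists>\<nu>. slice c \<nu>}" "countable C1"
    "(\<Union>c\<in>C1. chart_dom c) = (\<Union>c\<in>{c \<in> A. \<exists>\<nu>. slice c \<nu>}. chart_dom c)"
    using countable_subcharts[OF A, of "{c \<in> A. \<exists>\<nu>. slice c \<nu>}"] by blast
  ultimately have C1_cover: "\<exists>c\<in>C1. p \<in> chart_dom c" if "p \<in> S" for p using that by blast
  have "\<forall>c\<in>C1. \<exists>\<nu>. slice c \<nu>" using C1(1) by blast
  from bchoice[OF this] obtain \<nu> where "\<forall>c\<in>C1. slice c (\<nu> c)" by (rule exE)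
  then have \<nu>: "slice c (\<nu> c)" if "c \<in> C1" for c using that by (rule bspec)
  define conserved where "conserved c h = {V \<in> smooth_functions A. \<forall>I q J t C.
    euler_lagrange_solution A (?L V) I q \<longrightarrow> open J \<longrightarrow> t \<in> J \<longrightarrow> J \<subseteq> I \<longrightarrow>
    (\<forall>s\<in>J. q s \<in> chart_dom c \<and> h (chart_map c (q s)) = C) \<longrightarrow>
    vector_derivative (chart_map c \<circ> q) (at t) \<noteq> 0 \<longrightarrow> (\<forall>e\<in>Basis. fd h (chart_map c (q t)) e = 0)}"
    for c :: "('q, 'e) chart" and h :: "'e \<Rightarrow> real"
  define morse where "morse c = {V \<in> smooth_functions A. \<forall>x\<in>chart_img c.
    (\<forall>i\<in>Basis. fd (\<lambda>x. V (chart_inv c x)) x i = 0) \<longrightarrow>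
    (\<forall>v. v \<noteq> 0 \<longrightarrow> (\<exists>i\<in>Basis. fd (\<lambda>y. fd (\<lambda>x. V (chart_inv c x)) y i) x v \<noteq> 0))}"
    for c :: "('q, 'e) chart"
  \<comment> \<open>Countably many conditions: \<open>C0\<close> covers the whole manifold and
    serves the critical points of \<open>V\<close> and the function \<open>F\<close>;
    \<open>C1\<close> covers \<open>S\<close> and serves the linear functions of the slice
    charts.\<close>
  define R where "R = morse ` C0 \<union> (\<lambda>c. conserved c (\<lambda>x. F (chart_inv c x))) ` C0 \<union>
    (\<lambda>c. conserved c (\<lambda>x. \<nu> c \<bullet> x)) ` C1"
  have conserved_residual: "residual_in ?X (conserved c h)" if "c \<in> A" "smooth_on h (chart_img c)" for c h
    using riemannian_chart.residual_no_conserved_motion[OF chart[OF that(1)] that(2)]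
    unfolding conserved_def .
  have "residual_in ?X D" if D: "D \<in> R" for D
  proof -
    consider c where "c \<in> C0" "D = morse c" | c where "c \<in> C0" "D = conserved c (\<lambda>x. F (chart_inv c x))"
      | c where "c \<in> C1" "D = conserved c (\<lambda>x. \<nu> c \<bullet> x)"
      using D unfolding R_def by blast
    then show ?thesis
    proof cases
      case (1 c)
      then interpret smooth_chart A c using A C0(1) by unfold_locales auto
      show ?thesis using residual_nondegenerate unfolding 1(2) morse_def .
    next
      case (2 c)
      then have "c \<in> A" using C0(1) by blast
      then show ?thesis
        unfolding 2(2) by (intro conserved_residual smooth_functions_chart[OF A F])
    next
      case (3 c)
      then have c: "c \<in> A" using C1(1) by blast
      then show ?thesis
        unfolding 3(2) using chart_facts(2)[OF A c]
        by (intro conserved_residual smooth_on_inner smooth_on_const smooth_on_id)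
    qed
  qed
  moreover have "countable R" unfolding R_def using C0(2) C1(2) by simp
  ultimately have res: "residual_in ?X (topspace ?X \<inter> (\<Inter>D\<in>R. D))" by (intro residual_in_INT)
  show ?thesis
  proof (intro exI conjI ballI, rule res, unfold Let_def, intro conjI notI)
    fix V assume V: "V \<in> topspace ?X \<inter> (\<Inter>D\<in>R. D)"
    then have VA: "V \<in> smooth_functions A" using topspace_strong_topology[OF A] by blast
    have rigid: "\<forall>e\<in>Basis. fd h (chart_map c (q t)) e = 0"
      if "conserved c h \<in> R" "euler_lagrange_solution A (?L V) I q" "open J" "t \<in> J" "J \<subseteq> I"
        "\<And>s. s \<in> J \<Longrightarrow> q s \<in> chart_dom c \<and> h (chart_map c (q s)) = C"
        "vector_derivative (chart_map c \<circ> q) (at t) \<noteq> 0" for c h I q J t C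
    proof -
      have "V \<in> conserved c h" using V that(1) by blast
      then show ?thesis using that(2-) unfolding conserved_def by blast
    qed
    {
      assume "\<exists>I q. euler_lagrange_solution A (?L V) I q \<and> \<not> q constant_on I \<and> (F \<circ> q) constant_on I"
      then obtain I q where sol: "euler_lagrange_solution A (?L V) I q"
        and nonconst: "\<not> q constant_on I" and "(F \<circ> q) constant_on I" by blast
      then obtain C where C: "\<And>t. t \<in> I \<Longrightarrow> F (q t) = C" unfolding constant_on_def by auto
      have I: "open I" "is_interval I" "continuous_on I q"
        using sol unfolding euler_lagrange_solution_def by auto
      have curve: "open {t \<in> I. q t \<in> chart_dom c}"
        "\<And>t. t \<in> I \<Longrightarrow> q t \<in> chart_dom c \<Longrightarrow>
          ((chart_map c \<circ> q) has_vector_derivative vector_derivative (chart_map c \<circ> q) (at t)) (at t)"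
        "\<And>t. t \<in> I \<Longrightarrow> q t \<in> chart_dom c \<Longrightarrow> isCont (\<lambda>t. vector_derivative (chart_map c \<circ> q) (at t)) t"
        if "c \<in> A" for c
        using riemannian_chart.chart_curve[OF chart[OF that] sol refl]
          has_vector_derivative_continuous by blast+
      \<comment> \<open>The residual conditions refer to the countable cover, so the nonzero
        velocity has to be found in one of its charts.\<close>
      have "\<exists>t\<in>I. \<exists>c\<in>C0. q t \<in> chart_dom c \<and> vector_derivative (chart_map c \<circ> q) (at t) \<noteq> 0"
      proof (rule ccontr)
        assume *: "\<not> ?thesis"
        have z: "vector_derivative (chart_map c \<circ> q) (at s) = 0"
          if "c \<in> C0" "s \<in> I" "q s \<in> chart_dom c" for c s
        proof (rule ccontr)
          assume "vector_derivative (chart_map c \<circ> q) (at s) \<noteq> 0"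
          with that(3) have "\<exists>t\<in>I. \<exists>c\<in>C0. q t \<in> chart_dom c \<and>
              vector_derivative (chart_map c \<circ> q) (at t) \<noteq> 0"
            by (intro bexI[OF _ that(2)] bexI[OF _ that(1)] conjI)
          then show False using * by (rule notE[rotated])
        qed
        have "q constant_on I"
        proof (rule constant_on_if_stationary[OF A I])
          fix t assume "t \<in> I"
          obtain c where c: "c \<in> C0" "q t \<in> chart_dom c" using C0(3) by blast
          have "((chart_map c \<circ> q) has_vector_derivative 0) (at s)" if "s \<in> I" "q s \<in> chart_dom c" for s
            using curve(2)[of c s] C0(1) c(1) that z[OF c(1) that] by auto
          then show "\<exists>c\<in>A. q t \<in> chart_dom c \<and>
              (\<forall>s\<in>I. q s \<in> chart_dom c \<longrightarrow> ((chart_map c \<circ> q) has_vector_derivative 0) (at s))"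
            using C0(1) c by (intro bexI[of _ c]) auto
        qed
        then show False using nonconst by blast
      qed
      then obtain t c where t: "t \<in> I" and c: "c \<in> C0" "q t \<in> chart_dom c"
        and nz: "vector_derivative (chart_map c \<circ> q) (at t) \<noteq> 0"
        by (elim bexE conjE)
      have cA: "c \<in> A" using c(1) C0(1) by blast
      \<comment> \<open>The velocity stays nonzero near \<open>t\<close>, so rigidity for
        \<open>F\<close> applies at every time of \<open>J\<close> and a whole arc, rather than one
        point, lies in the critical set and hence in \<open>S\<close>.\<close>
      have "isCont (\<lambda>t. vector_derivative (chart_map c \<circ> q) (at t)) t" by (rule curve(3)[OF cA t c(2)])
      from continuous_at_avoid[OF this nz] obtain r where r: "r > 0"
        "\<forall>s. dist t s < r \<longrightarrow> vector_derivative (chart_map c \<circ> q) (at s) \<noteq> 0"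
        by (elim exE conjE)
      define N where "N = ball t r"
      have N: "open N" "t \<in> N" "\<And>s. s \<in> N \<Longrightarrow> vector_derivative (chart_map c \<circ> q) (at s) \<noteq> 0"
        using r by (simp_all add: N_def)
      define J where "J = N \<inter> {t \<in> I. q t \<in> chart_dom c}"
      have J: "open J" "t \<in> J" "J \<subseteq> I" "\<And>s. s \<in> J \<Longrightarrow> q s \<in> chart_dom c"
        using N curve(1)[OF cA] t c(2) by (auto simp: J_def)
      have "\<forall>e\<in>Basis. fd (\<lambda>x. F (chart_inv c x)) (chart_map c (q s)) e = 0" if "s \<in> J" for s
      proof (rule rigid[OF _ sol J(1) that J(3)])
        show "conserved c (\<lambda>x. F (chart_inv c x)) \<in> R" unfolding R_def using c(1) by blast
        show "q r \<in> chart_dom c \<and> F (chart_inv c (chart_map c (q r))) = C" if "r \<in> J" for r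
          using J(3,4) that C chart_facts(5)[OF A cA, of "q r"] by auto
        show "vector_derivative (chart_map c \<circ> q) (at s) \<noteq> 0" using N(3) that by (simp add: J_def)
      qed
      then have "critical_point A F (q s)" if "s \<in> J" for s
        using critical_pointI[OF A cA J(4)[OF that] F] that by blast
      then have inS: "q s \<in> S" if "s \<in> J" for s using S(2) that by blast
      obtain d where d: "d \<in> C1" "q t \<in> chart_dom d" using C1_cover[OF inS[OF J(2)]] by blast
      have dA: "d \<in> A" using d(1) C1(1) by blast
      define J' where "J' = J \<inter> {t \<in> I. q t \<in> chart_dom d}"
      have J': "open J'" "t \<in> J'" "J' \<subseteq> I"
        using J curve(1)[OF dA] t d(2) by (auto simp: J'_def)
      \<comment> \<open>On the arc in \<open>S\<close> the linear function of the slice chart is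
        constantly 0 while the curve moves, so rigidity forces its differential, which is
        \<open>\<nu> d\<close>, to vanish.\<close>
      have "\<forall>e\<in>Basis. fd (\<lambda>x. \<nu> d \<bullet> x) (chart_map d (q t)) e = 0"
      proof (rule rigid[OF _ sol J'])
        show "conserved d (\<lambda>x. \<nu> d \<bullet> x) \<in> R" unfolding R_def using d(1) by blast
        show "q s \<in> chart_dom d \<and> \<nu> d \<bullet> chart_map d (q s) = 0" if "s \<in> J'" for s
          using \<nu>[OF d(1)] inS that unfolding slice_def J'_def by blast
        show "vector_derivative (chart_map d \<circ> q) (at t) \<noteq> 0"
        proof
          assume "vector_derivative (chart_map d \<circ> q) (at t) = 0"
          then have "((chart_map d \<circ> q) has_vector_derivative 0) (at t)"
            using curve(2)[OF dA t d(2)] by simp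
          then have "((chart_map c \<circ> q) has_vector_derivative 0) (at t)"
            by (rule velocity_zero_transition[OF A cA dA J'(1,2), rotated]) (auto simp: J'_def J(4))
          then show False using nz vector_derivative_at by blast
        qed
      qed
      moreover have "fd (\<lambda>x. \<nu> d \<bullet> x) x = (\<lambda>v. \<nu> d \<bullet> v)" for x
        by (intro fd_eqI bounded_linear_imp_has_derivative bounded_linear_inner_right)
      ultimately have "\<nu> d = 0" using euclidean_all_zero_iff[of "\<nu> d"] by simp
      then show False using \<nu>[OF d(1)] by (simp add: slice_def)
    }
    show "discrete (equilibrium_points A (?L V))"
    proof (rule discreteI)
      fix p assume p: "p \<in> equilibrium_points A (?L V)"
      obtain c where pc: "c \<in> C0" "p \<in> chart_dom c" using C0(3) by blast
      then have cA: "c \<in> A" using C0(1) by blast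
      interpret riemannian_chart A c g by (rule chart[OF cA])
      have "morse c \<in> R" unfolding R_def using pc(1) by simp
      then have "V \<in> morse c" using V by blast
      then have "\<forall>x\<in>U. (\<forall>i\<in>Basis. fd (loc V) x i = 0) \<longrightarrow>
          (\<forall>v. v \<noteq> 0 \<longrightarrow> (\<exists>i\<in>Basis. fd (\<lambda>y. fd (loc V) y i) x v \<noteq> 0))"
        unfolding morse_def by simp
      note nondeg = bspec[OF this, THEN mp]
      have x: "chart_map c p \<in> U" using pc(2) by (rule imageI)
      have crit: "\<forall>i\<in>Basis. fd (loc V) (chart_map c p) i = 0"
        using equilibrium_imp_critical[OF VA p pc(2)] by simp
      from critical_point_isolated[OF VA x crit nondeg[OF x crit]]
      obtain N where N: "open N" "chart_map c p \<in> N" "N \<subseteq> U"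
        "\<forall>y\<in>N. (\<forall>i\<in>Basis. fd (loc V) y i = 0) \<longrightarrow> y = chart_map c p"
        by (elim exE conjE)
      let ?W = "chart_dom c \<inter> chart_map c -` N"
      have "open ?W"
        by (rule continuous_open_preimage[OF chart_facts(3,1)[OF A cA] N(1)])
      have unique: "r = p" if "r \<in> ?W" "r \<in> equilibrium_points A (?L V)" for r
      proof -
        have "chart_map c r = chart_map c p"
          using bspec[OF N(4), of "chart_map c r"] that(1) equilibrium_imp_critical[OF VA that(2)] by simp
        then show ?thesis
          using chart_facts(5)[OF A cA, of r] chart_facts(5)[OF A cA pc(2)] that(1) by simp
      qed
      have "p \<in> ?W" using pc(2) N(2) by simp
      then have "?W \<inter> equilibrium_points A (?L V) = {p}"
        using p unique by (intro subset_antisym subsetI) (elim IntE, blast, elim singletonE, blast)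
      with \<open>open ?W\<close> p show "p isolated_in equilibrium_points A (?L V)"
        unfolding isolated_in_def by (intro conjI exI)
    qed
  qed
qed

end
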